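(* Let $u$ be a totally real algebraic integer with $2<u<14$ and let $A$ be a V-arithmetic $4\times4$ matrix, with ground field $\mathbb K$, of one of the following five types (indexed by $e_1,\dots,e_4$, diagonal entries $-2$, unlisted off-diagonal entries $0$, and $c(n):=2\cos(\pi/n)$): (1) $a_{12}=u$, $a_{13}=c(s)$, $a_{23}=c(k)$, $a_{14}=c(r)$, $a_{24}=c(p)$, where ($s=k=3$, $3\le p\le r\le5$) or ($s=p=3$, $4\le k\le r\le5$); (2) $a_{12}=u$, $a_{13}=c(s)$, $a_{23}=c(k)$, $a_{34}=c(p)$, where ($3\le s\le k\le5$, $p=3$) or ($s=k=3$, $p\in\{4,5\}$); (3) $a_{12}=u$, $a_{23}=c(k)$, $a_{34}=c(r)$, $a_{14}=c(s)$, where $(s,k,r)$ is one of $(2,3,3),(2,3,4),(2,3,5),(2,4,3),(2,5,3)$, or $3\le s\le k\le5$ with $r=3$, or $(3,3,4),(3,3,5)$; (4) $a_{12}=u$, $a_{13}=c(s)$, $a_{23}=c(k)$, $a_{14}=c(r)$, where $k\ge2$ and $(s,r)\in\{(3,3),(3,4),(3,5),(4,3),(5,3)\}$; (5) $a_{12}=u$, $a_{13}=c(s)$, $a_{24}=c(k)$, where $3\le s\le k$. Then $[\mathbb K:\mathbb Q]\le23$ for types (1) and (2), and $[\mathbb K:\mathbb Q]\le25$ for types (3), (4), (5). Consequently, for every V-arithmetic edge matrix of minimality $14$ whose hyperbolic connected component has at least $4$ elements, the ground field has degree at most $25$ over $\mathbb Q$; i.e. the constant $N(14)$ can be taken to be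 $25$.
   Context: A fundamental matrix is a real symmetric matrix $A=(a_{ij})$ with $a_{ii}=-2$, $a_{ij}\ge0$ for $i\ne j$, and $a_{ij}=2\cos(\pi/m_{ij})$ for an integer $m_{ij}\ge2$ whenever $a_{ij}<2$. It is hyperbolic if it has exactly one positive eigenvalue. Its cyclic products are $a_{i_1i_2}a_{i_2i_3}\cdots a_{i_ki_1}$; its ground field $\mathbb K$ is the field generated over $\mathbb Q$ by all cyclic products. A hyperbolic fundamental matrix is V-arithmetic if all cyclic products are algebraic integers, the field $\mathbb Q(\{a_{ij}\})$ is totally real, and for every embedding $\varphi:\mathbb Q(\{a_{ij}\})\to\mathbb R$ whose restriction to $\mathbb K$ is not the identity inclusion, the matrix $(\varphi(a_{ij}))$ is negative definite. It has minimality $t$ if all entries are $<t$. An edge matrix (Gram matrix of a fundamental edge chamber with two finite vertices) is a hyperbolic fundamental matrix indexed by a set $P$ with $|P|=n+1$, nondegenerate of signature $(1,n)$, with two distinguished indices $e_1,e_2$ such that the principal submatrices on $P\setminus\{e_1\}$ and on $P\setminus\{e_2\}$ are negative definite. Its graph joins $e_i,e_j$ when $a_{ij}\ne0$; the hyperbolic connected component is the connected component containing $e_1,e_2$. $N(t)$ denotes a constant such that every V-arithmetic edge matrix of minimality $t$ whose ground field has degree $>N(t)$ has hyperbolic connected component with fewer than $4$ elements. All fields are regarded as subfields of $\mathbb R$. *)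

theory Defs
  imports Complex_Main "Jordan_Normal_Form.Char_Poly" "HOL-Library.Extended_Nat"
begin

text \<open>Conventions. A square real matrix of size N is a function
  a :: nat => nat => real, of which only the entries a i j with i, j < N matter;
  the index set is {0..<N}. For the 4x4 matrices, index k-1 stands for e_k.\<close>

definition cc :: "nat \<Rightarrow> real" where
  "cc n = 2 * cos (pi / real n)"

definition to_mat :: "nat \<Rightarrow> (nat \<Rightarrow> nat \<Rightarrow> real) \<Rightarrow> real mat" where
  "to_mat N a = mat N N (\<lambda>(i, j). a i j)"

definition num_pos_eig :: "nat \<Rightarrow> (nat \<Rightarrow> nat \<Rightarrow> real) \<Rightarrow> nat" where
  "num_pos_eig N a =
     (\<Sum>t\<in>{t. t > 0 \<and> poly (char_poly (to_mat N a)) t = 0}. order t (char_poly (to_mat N a)))"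

definition num_neg_eig :: "nat \<Rightarrow> (nat \<Rightarrow> nat \<Rightarrow> real) \<Rightarrow> nat" where
  "num_neg_eig N a =
     (\<Sum>t\<in>{t. t < 0 \<and> poly (char_poly (to_mat N a)) t = 0}. order t (char_poly (to_mat N a)))"

definition fundamental_matrix :: "nat \<Rightarrow> (nat \<Rightarrow> nat \<Rightarrow> real) \<Rightarrow> bool" where
  "fundamental_matrix N a \<longleftrightarrow>
     (\<forall>i<N. \<forall>j<N. a i j = a j i) \<and>
     (\<forall>i<N. a i i = -2) \<and>
     (\<forall>i<N. \<forall>j<N. i \<noteq> j \<longrightarrow> a i j \<ge> 0) \<and>
     (\<forall>i<N. \<forall>j<N. i \<noteq> j \<longrightarrow> a i j < 2 \<longrightarrow> (\<exists>m::nat. m \<ge> 2 \<and> a i j = 2 * cos (pi / real m)))"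

definition hyperbolic_fundamental :: "nat \<Rightarrow> (nat \<Rightarrow> nat \<Rightarrow> real) \<Rightarrow> bool" where
  "hyperbolic_fundamental N a \<longleftrightarrow> fundamental_matrix N a \<and> num_pos_eig N a = 1"

definition cyc_prod :: "(nat \<Rightarrow> nat \<Rightarrow> real) \<Rightarrow> nat list \<Rightarrow> real" where
  "cyc_prod a xs = (\<Prod>j<length xs. a (xs ! j) (xs ! ((j + 1) mod length xs)))"

definition cyclic_products :: "nat \<Rightarrow> (nat \<Rightarrow> nat \<Rightarrow> real) \<Rightarrow> real set" where
  "cyclic_products N a = {cyc_prod a xs | xs. xs \<noteq> [] \<and> set xs \<subseteq> {0..<N}}"

definition entries :: "nat \<Rightarrow> (nat \<Rightarrow> nat \<Rightarrow> real) \<Rightarrow> real set" where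
  "entries N a = {a i j | i j. i < N \<and> j < N}"

definition real_subfield :: "real set \<Rightarrow> bool" where
  "real_subfield F \<longleftrightarrow> 0 \<in> F \<and> 1 \<in> F \<and>
     (\<forall>x\<in>F. \<forall>y\<in>F. x + y \<in> F \<and> x - y \<in> F \<and> x * y \<in> F) \<and>
     (\<forall>x\<in>F. x \<noteq> 0 \<longrightarrow> inverse x \<in> F)"

definition gen_field :: "real set \<Rightarrow> real set" where
  "gen_field S = \<Inter>{F. real_subfield F \<and> S \<subseteq> F}"

definition ground_field :: "nat \<Rightarrow> (nat \<Rightarrow> nat \<Rightarrow> real) \<Rightarrow> real set" where
  "ground_field N a = gen_field (cyclic_products N a)"

definition Q_indep :: "real set \<Rightarrow> bool" where
  "Q_indep B \<longleftrightarrow> (\<forall>c :: real \<Rightarrow> rat. (\<Sum>b\<in>B. of_rat (c b) * b) = 0 \<longrightarrow> (\<forall>b\<in>B. c b = 0))"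

definition field_degree :: "real set \<Rightarrow> enat" where
  "field_degree K = Sup {enat (card B) | B. finite B \<and> B \<subseteq> K \<and> Q_indep B}"

definition algebraic_integer :: "'a :: field_char_0 \<Rightarrow> bool" where
  "algebraic_integer x \<longleftrightarrow> (\<exists>p :: int poly. lead_coeff p = 1 \<and> poly (map_poly of_int p) x = 0)"

definition complex_embedding :: "real set \<Rightarrow> (real \<Rightarrow> complex) \<Rightarrow> bool" where
  "complex_embedding F \<sigma> \<longleftrightarrow> \<sigma> 1 = 1 \<and>
     (\<forall>x\<in>F. \<forall>y\<in>F. \<sigma> (x + y) = \<sigma> x + \<sigma> y \<and> \<sigma> (x * y) = \<sigma> x * \<sigma> y)"

definition real_embedding :: "real set \<Rightarrow> (real \<Rightarrow> real) \<Rightarrow> bool" where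
  "real_embedding F \<phi> \<longleftrightarrow> \<phi> 1 = 1 \<and>
     (\<forall>x\<in>F. \<forall>y\<in>F. \<phi> (x + y) = \<phi> x + \<phi> y \<and> \<phi> (x * y) = \<phi> x * \<phi> y)"

definition totally_real_field :: "real set \<Rightarrow> bool" where
  "totally_real_field F \<longleftrightarrow> (\<forall>x\<in>F. algebraic x) \<and>
     (\<forall>\<sigma>. complex_embedding F \<sigma> \<longrightarrow> (\<forall>x\<in>F. \<sigma> x \<in> \<real>))"

definition totally_real_algebraic_integer :: "real \<Rightarrow> bool" where
  "totally_real_algebraic_integer u \<longleftrightarrow> algebraic_integer u \<and> totally_real_field (gen_field {u})"

definition neg_definite :: "nat \<Rightarrow> (nat \<Rightarrow> nat \<Rightarrow> real) \<Rightarrow> nat set \<Rightarrow> bool" where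
  "neg_definite N a I \<longleftrightarrow> (\<forall>x :: nat \<Rightarrow> real. (\<exists>i\<in>I. x i \<noteq> 0) \<longrightarrow>
      (\<Sum>i\<in>I. \<Sum>j\<in>I. x i * a i j * x j) < 0)"

definition V_arithmetic :: "nat \<Rightarrow> (nat \<Rightarrow> nat \<Rightarrow> real) \<Rightarrow> bool" where
  "V_arithmetic N a \<longleftrightarrow> hyperbolic_fundamental N a \<and>
     (\<forall>c\<in>cyclic_products N a. algebraic_integer c) \<and>
     totally_real_field (gen_field (entries N a)) \<and>
     (\<forall>\<phi>. real_embedding (gen_field (entries N a)) \<phi> \<longrightarrow>
        (\<exists>x\<in>ground_field N a. \<phi> x \<noteq> x) \<longrightarrow>
        neg_definite N (\<lambda>i j. \<phi> (a i j)) {0..<N})"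

definition minimality :: "nat \<Rightarrow> (nat \<Rightarrow> nat \<Rightarrow> real) \<Rightarrow> real \<Rightarrow> bool" where
  "minimality N a t \<longleftrightarrow> (\<forall>i<N. \<forall>j<N. a i j < t)"

definition edge_matrix :: "nat \<Rightarrow> (nat \<Rightarrow> nat \<Rightarrow> real) \<Rightarrow> nat \<Rightarrow> nat \<Rightarrow> bool" where
  "edge_matrix N a e1 e2 \<longleftrightarrow> hyperbolic_fundamental N a \<and> N \<ge> 1 \<and>
     num_pos_eig N a = 1 \<and> num_neg_eig N a = N - 1 \<and> det (to_mat N a) \<noteq> 0 \<and>
     e1 < N \<and> e2 < N \<and> e1 \<noteq> e2 \<and>
     neg_definite N a ({0..<N} - {e1}) \<and> neg_definite N a ({0..<N} - {e2})"

definition graph_edges :: "nat \<Rightarrow> (nat \<Rightarrow> nat \<Rightarrow> real) \<Rightarrow> (nat \<times> nat) set" where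
  "graph_edges N a = {(i, j). i < N \<and> j < N \<and> i \<noteq> j \<and> a i j \<noteq> 0}"

definition hyperbolic_component :: "nat \<Rightarrow> (nat \<Rightarrow> nat \<Rightarrow> real) \<Rightarrow> nat \<Rightarrow> nat \<Rightarrow> nat set" where
  "hyperbolic_component N a e1 e2 =
     {j. j < N \<and> (e1, j) \<in> (graph_edges N a)\<^sup>*} \<union> {j. j < N \<and> (e2, j) \<in> (graph_edges N a)\<^sup>*}"

definition sym4 :: "real \<Rightarrow> real \<Rightarrow> real \<Rightarrow> real \<Rightarrow> real \<Rightarrow> real \<Rightarrow> nat \<Rightarrow> nat \<Rightarrow> real" where
  "sym4 a12 a13 a14 a23 a24 a34 i j =
     (if i = j then -2
      else if {i, j} = {0, 1} then a12
      else if {i, j} = {0, 2} then a13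
      else if {i, j} = {0, 3} then a14
      else if {i, j} = {1, 2} then a23
      else if {i, j} = {1, 3} then a24
      else if {i, j} = {2, 3} then a34
      else 0)"

definition type1 :: "real \<Rightarrow> (nat \<Rightarrow> nat \<Rightarrow> real) \<Rightarrow> bool" where
  "type1 u A \<longleftrightarrow> (\<exists>s k r p :: nat.
     A = sym4 u (cc s) (cc r) (cc k) (cc p) 0 \<and>
     ((s = 3 \<and> k = 3 \<and> 3 \<le> p \<and> p \<le> r \<and> r \<le> 5) \<or>
      (s = 3 \<and> p = 3 \<and> 4 \<le> k \<and> k \<le> r \<and> r \<le> 5)))"

definition type2 :: "real \<Rightarrow> (nat \<Rightarrow> nat \<Rightarrow> real) \<Rightarrow> bool" where
  "type2 u A \<longleftrightarrow> (\<exists>s k p :: nat.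
     A = sym4 u (cc s) 0 (cc k) 0 (cc p) \<and>
     ((3 \<le> s \<and> s \<le> k \<and> k \<le> 5 \<and> p = 3) \<or>
      (s = 3 \<and> k = 3 \<and> p \<in> {4, 5})))"

definition type3 :: "real \<Rightarrow> (nat \<Rightarrow> nat \<Rightarrow> real) \<Rightarrow> bool" where
  "type3 u A \<longleftrightarrow> (\<exists>s k r :: nat.
     A = sym4 u 0 (cc s) (cc k) 0 (cc r) \<and>
     ((s, k, r) \<in> {(2,3,3), (2,3,4), (2,3,5), (2,4,3), (2,5,3)} \<or>
      (3 \<le> s \<and> s \<le> k \<and> k \<le> 5 \<and> r = 3) \<or>
      (s, k, r) \<in> {(3,3,4), (3,3,5)}))"

definition type4 :: "real \<Rightarrow> (nat \<Rightarrow> nat \<Rightarrow> real) \<Rightarrow> bool" where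
  "type4 u A \<longleftrightarrow> (\<exists>s k r :: nat.
     A = sym4 u (cc s) (cc r) (cc k) 0 0 \<and>
     k \<ge> 2 \<and> (s, r) \<in> {(3,3), (3,4), (3,5), (4,3), (5,3)})"

definition type5 :: "real \<Rightarrow> (nat \<Rightarrow> nat \<Rightarrow> real) \<Rightarrow> bool" where
  "type5 u A \<longleftrightarrow> (\<exists>s k :: nat.
     A = sym4 u (cc s) 0 0 (cc k) 0 \<and> 3 \<le> s \<and> s \<le> k)"

end

theory Submission
  imports Defs "HOL-Computational_Algebra.Fundamental_Theorem_Algebra"
begin

text \<open>
  An embedding of the field of entries which is nontrivial on the ground field makes the matrix negative
  definite, so suitable polynomials in the cyclic products take small values there. Such a polynomial is
  chosen, for each shape of a four-vertex subgraph, so that all its nontrivial conjugates are bounded by a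
  fixed \<open>\<rho> < 1\<close>; since the norm of a nonzero algebraic integer is at least one, its one large conjugate
  (bounded because the entries are less than 14) bounds the degree. For an edge matrix, a vertex set of size
  four around an entry with square greater than 3 always has one of these shapes; if there is no such entry,
  the hyperbolic component is defined over the field generated by the square roots of 2, 3 and 5, every embedding fixing
  that field is trivial on the ground field, and the degree is at most 8.
\<close>

text \<open>Negative definiteness is assumed for embeddings of the field \<open>E\<close> of all
  entries, while the degree concerns the possibly smaller field \<open>K\<close>. Norms are
  therefore taken over \<open>E\<close>; the embeddings trivial on \<open>K\<close> occur with a
  multiplicity, and this multiplicity cancels in the final inequality. A determinant condition alone
  only confines the nontrivial conjugates of some cyclic expression to an interval such as (0, 8/3)
  or to a plane region, where they may well exceed 1. Hence the auxiliary polynomials: integer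
  polynomials that are small on the region because their zeros sit at algebraic integers (or curves
  of them) whose conjugates stay in it, for example 0, 1, 2 and (3 \<plusminus> sqrt 5)/2. The
  admissible expressions are limited by integrality, which is known for cyclic products and not for
  single entries. The threshold 3 separates 2 cos (pi/m) with m at most 6, which lies in the field
  of sqrt 2, sqrt 3, sqrt 5, from m at least 7, where no fixed field is available.\<close>

section \<open>Algebraic integers\<close>

lemma algebraic_integer_iff: "algebraic_integer x \<longleftrightarrow> algebraic_int x"
  by (auto simp: algebraic_integer_def algebraic_int_altdef_ipoly)

text \<open>A finitely generated additive group of reals, given by generators. Integrality of
  \<open>z\<close> is detected by such a group that is nonzero and stable under multiplication by
  \<open>z\<close>.\<close>

definition int_span :: "nat \<Rightarrow> (nat \<Rightarrow> real) \<Rightarrow> real set" where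
  "int_span n v = {\<Sum>k<n. of_int (c k) * v k | c. True}"

lemma int_span_0: "0 \<in> int_span n v"
  unfolding int_span_def by (rule CollectI, rule exI[of _ "\<lambda>_. 0"]) simp

lemma int_span_add:
  assumes "x \<in> int_span n v" "y \<in> int_span n v" shows "x + y \<in> int_span n v"
proof -
  from assms obtain c d where "x = (\<Sum>k<n. of_int (c k) * v k)" "y = (\<Sum>k<n. of_int (d k) * v k)"
    by (auto simp: int_span_def)
  then have "x + y = (\<Sum>k<n. of_int (c k + d k) * v k)"
    by (simp add: sum.distrib distrib_right)
  then show ?thesis unfolding int_span_def by (intro CollectI exI[of _ "\<lambda>k. c k + d k"]) simp
qed

lemma int_span_scale:
  assumes "x \<in> int_span n v" shows "of_int z * x \<in> int_span n v"
proof -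
  from assms obtain c where "x = (\<Sum>k<n. of_int (c k) * v k)"
    by (auto simp: int_span_def)
  then have "of_int z * x = (\<Sum>k<n. of_int (z * c k) * v k)"
    by (simp add: sum_distrib_left mult_ac)
  then show ?thesis unfolding int_span_def by (intro CollectI exI[of _ "\<lambda>k. z * c k"]) simp
qed

lemma int_span_sum:
  assumes "\<And>i. i \<in> I \<Longrightarrow> x i \<in> int_span n v" shows "(\<Sum>i\<in>I. x i) \<in> int_span n v"
  using assms by (induction I rule: infinite_finite_induct) (auto intro: int_span_0 int_span_add)

lemma int_span_base: "k < n \<Longrightarrow> v k \<in> int_span n v"
  unfolding int_span_def by (rule CollectI, rule exI[of _ "\<lambda>j. if j = k then 1 else 0"])
    (simp add: if_distrib[of real_of_int] if_distrib[of "\<lambda>x. x * _"] cong: if_cong)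

lemma int_span_mult:
  assumes "\<And>k. k < n \<Longrightarrow> z * v k \<in> int_span n v" "x \<in> int_span n v"
  shows "z * x \<in> int_span n v"
proof -
  from assms obtain c where "x = (\<Sum>k<n. of_int (c k) * v k)"
    by (auto simp: int_span_def)
  then have "z * x = (\<Sum>k<n. of_int (c k) * (z * v k))"
    by (simp add: sum_distrib_left mult_ac)
  then show ?thesis using assms(1) by (auto intro!: int_span_sum int_span_scale)
qed

text \<open>The determinant trick: \<open>z\<close> is an eigenvalue of an integer matrix.\<close>

lemma algebraic_int_if_int_span:
  fixes z :: real
  assumes pres: "\<And>k. k < n \<Longrightarrow> z * v k \<in> int_span n v" and nz: "k0 < n" "v k0 \<noteq> 0"
  shows "algebraic_int z"
proof -
  have "\<forall>k. \<exists>c :: nat \<Rightarrow> int. k < n \<longrightarrow> z * v k = (\<Sum>j<n. of_int (c j) * v j)"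
    using pres by (fastforce simp: int_span_def)
  then obtain C :: "nat \<Rightarrow> nat \<Rightarrow> int" where
    C: "\<And>k. k < n \<Longrightarrow> z * v k = (\<Sum>j<n. of_int (C k j) * v j)" by metis
  define A :: "int mat" where "A = mat n n (\<lambda>(i, j). C i j)"
  have A: "A \<in> carrier_mat n n" by (simp add: A_def)
  let ?A = "map_mat real_of_int A"
  have "eigenvector ?A (vec n v) z"
    unfolding eigenvector_def
  proof (intro conjI)
    show "vec n v \<in> carrier_vec (dim_row ?A)" by (simp add: A_def)
    show "vec n v \<noteq> 0\<^sub>v (dim_row ?A)"
    proof
      assume "vec n v = 0\<^sub>v (dim_row ?A)"
      then have "vec n v $ k0 = 0\<^sub>v (dim_row ?A) $ k0" by simp
      with nz show False by (simp add: A_def)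
    qed
    show "?A *\<^sub>v vec n v = z \<cdot>\<^sub>v vec n v"
      by (rule eq_vecI) (auto simp: A_def scalar_prod_def C atLeast0LessThan intro!: sum.cong)
  qed
  then have "poly (char_poly ?A) z = 0"
    using eigenvalue_root_char_poly[of ?A n] A by (auto simp: eigenvalue_def)
  moreover have "char_poly ?A = map_poly of_int (char_poly A)"
    using of_int_hom.char_poly_hom[OF A] by simp
  moreover have "lead_coeff (char_poly A) = 1" using degree_monic_char_poly[OF A] by simp
  ultimately show ?thesis unfolding algebraic_int_altdef_ipoly by auto
qed

text \<open>The group generated by the products \<open>x ^ i * y ^ j\<close> with
  \<open>i < m\<close>, \<open>j < n\<close> is stable under multiplication by \<open>x\<close> and
  by \<open>y\<close>, hence by their sum and product. The monic equations rewrite the overflowing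
  powers \<open>x ^ m\<close> and \<open>y ^ n\<close>.\<close>

lemma algebraic_int_add_mult:
  fixes x y :: real
  assumes x: "algebraic_int x" and y: "algebraic_int y"
  shows "algebraic_int (x + y)" "algebraic_int (x * y)"
proof -
  obtain p :: "int poly" where p: "poly (map_poly of_int p) x = 0" "lead_coeff p = 1"
    using x by (auto simp: algebraic_int_altdef_ipoly)
  obtain q :: "int poly" where q: "poly (map_poly of_int q) y = 0" "lead_coeff q = 1"
    using y by (auto simp: algebraic_int_altdef_ipoly)
  define m n where "m = degree p" and "n = degree q"
  have pow: "w ^ degree f = (\<Sum>i<degree f. of_int (- coeff f i) * w ^ i)"
    if "poly (map_poly of_int f) w = 0" "lead_coeff f = 1" for f :: "int poly" and w :: real
  proof -
    have "0 = (\<Sum>i\<le>degree f. of_int (coeff f i) * w ^ i)"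
      using that(1) by (simp add: poly_altdef coeff_map_poly degree_map_poly)
    also have "\<dots> = (\<Sum>i<degree f. of_int (coeff f i) * w ^ i) + w ^ degree f"
      using that(2) by (simp flip: lessThan_Suc_atMost)
    finally show ?thesis by (simp add: sum_negf)
  qed
  have mpos: "m > 0"
    using p by (intro Nat.gr0I) (auto simp: m_def elim!: degree_eq_zeroE)
  have npos: "n > 0"
    using q by (intro Nat.gr0I) (auto simp: n_def elim!: degree_eq_zeroE)
  \<comment> \<open>The pair of exponents is coded in one index as quotient and remainder modulo
    \<open>n\<close>.\<close>
  define v where "v k = x ^ (k div n) * y ^ (k mod n)" for k
  have base: "x ^ i * y ^ j \<in> int_span (m * n) v" if "i < m" "j < n" for i j
  proof -
    have "i * n + j < Suc i * n" using that(2) by simp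
    also have "\<dots> \<le> m * n" using that(1) by (intro mult_le_mono1) simp
    finally have "i * n + j < m * n" .
    then have "v (i * n + j) \<in> int_span (m * n) v" by (rule int_span_base)
    then show ?thesis using that by (simp add: v_def)
  qed
  have px: "x * v k \<in> int_span (m * n) v" if "k < m * n" for k
  proof -
    let ?i = "k div n" and ?j = "k mod n"
    have ij: "?i < m" "?j < n" using that npos by (auto simp: less_mult_imp_div_less)
    show ?thesis
    proof (cases "Suc ?i < m")
      case True
      then show ?thesis using base[OF True ij(2)] by (simp add: v_def mult_ac)
    next
      case False
      then have "Suc ?i = m" using ij by simp
      then have "x * v k = y ^ ?j * x ^ m" by (simp add: v_def mult_ac flip: power_Suc)
      also have "\<dots> = (\<Sum>i<m. of_int (- coeff p i) * (x ^ i * y ^ ?j))"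
        using pow[OF p] by (simp add: m_def sum_distrib_left mult_ac)
      finally show ?thesis using base ij by (auto intro!: int_span_sum int_span_scale simp del: of_int_minus)
    qed
  qed
  have py: "y * v k \<in> int_span (m * n) v" if "k < m * n" for k
  proof -
    let ?i = "k div n" and ?j = "k mod n"
    have ij: "?i < m" "?j < n" using that npos by (auto simp: less_mult_imp_div_less)
    show ?thesis
    proof (cases "Suc ?j < n")
      case True
      then show ?thesis using base[OF ij(1) True] by (simp add: v_def mult_ac)
    next
      case False
      then have "Suc ?j = n" using ij by simp
      then have "y * v k = x ^ ?i * y ^ n" by (simp add: v_def mult_ac flip: power_Suc) 
      also have "\<dots> = (\<Sum>j<n. of_int (- coeff q j) * (x ^ ?i * y ^ j))"
        using pow[OF q] by (simp add: n_def sum_distrib_left mult_ac)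
      finally show ?thesis using base ij by (auto intro!: int_span_sum int_span_scale simp del: of_int_minus)
    qed
  qed
  have nz: "0 < m * n" "v 0 \<noteq> 0" using mpos npos by (auto simp: v_def)
  show "algebraic_int (x + y)"
    by (rule algebraic_int_if_int_span[where v = v, OF _ nz]) (auto simp: distrib_right intro!: int_span_add px py)
  show "algebraic_int (x * y)"
    by (rule algebraic_int_if_int_span[where v = v, OF _ nz])
       (auto simp: mult.assoc intro!: int_span_mult[OF px] py)
qed

lemma algebraic_int_diff: "algebraic_int x \<Longrightarrow> algebraic_int y \<Longrightarrow> algebraic_int (x - y :: real)"
  using algebraic_int_add_mult(1)[of x "- y"] by simp

lemma algebraic_int_power: "algebraic_int x \<Longrightarrow> algebraic_int (x ^ n :: real)"
  by (induction n) (auto intro: algebraic_int_add_mult)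

lemma algebraic_int_prod: "(\<And>i. i \<in> I \<Longrightarrow> algebraic_int (f i :: real)) \<Longrightarrow> algebraic_int (prod f I)"
  by (induction I rule: infinite_finite_induct) (auto intro: algebraic_int_add_mult)

section \<open>Real number fields and their embeddings\<close>

lemma real_subfieldD:
  assumes "real_subfield F"
  shows "0 \<in> F" "1 \<in> F" "x \<in> F \<Longrightarrow> y \<in> F \<Longrightarrow> x + y \<in> F" "x \<in> F \<Longrightarrow> y \<in> F \<Longrightarrow> x - y \<in> F"
    "x \<in> F \<Longrightarrow> y \<in> F \<Longrightarrow> x * y \<in> F" "x \<in> F \<Longrightarrow> inverse x \<in> F" "x \<in> F \<Longrightarrow> - x \<in> F"
    "x \<in> F \<Longrightarrow> y \<in> F \<Longrightarrow> x / y \<in> F" "x \<in> F \<Longrightarrow> x ^ n \<in> F"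
proof -
  note A = assms[unfolded real_subfield_def]
  show 0: "0 \<in> F" and 1: "1 \<in> F" using A by auto
  show "x \<in> F \<Longrightarrow> y \<in> F \<Longrightarrow> x + y \<in> F" "x \<in> F \<Longrightarrow> y \<in> F \<Longrightarrow> x - y \<in> F"
    and m: "\<And>x y. x \<in> F \<Longrightarrow> y \<in> F \<Longrightarrow> x * y \<in> F" using A by auto
  show i: "\<And>x. x \<in> F \<Longrightarrow> inverse x \<in> F" using A by (metis inverse_zero)
  show "x \<in> F \<Longrightarrow> - x \<in> F" using A 0 by (metis diff_0)
  show "x \<in> F \<Longrightarrow> y \<in> F \<Longrightarrow> x / y \<in> F" by (simp add: divide_inverse m i)
  show "x \<in> F \<Longrightarrow> x ^ n \<in> F" by (induction n) (auto intro: 1 m)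
qed

lemma real_subfield_sum:
  "real_subfield F \<Longrightarrow> (\<And>i. i \<in> I \<Longrightarrow> f i \<in> F) \<Longrightarrow> sum f I \<in> F"
  by (induction I rule: infinite_finite_induct) (auto intro: real_subfieldD)

lemma real_subfield_of_int: "real_subfield F \<Longrightarrow> of_int k \<in> F"
proof -
  assume F: "real_subfield F"
  have n: "real n \<in> F" for n by (induction n) (auto intro: real_subfieldD[OF F])
  show ?thesis by (cases k) (use n real_subfieldD(7)[OF F n] in \<open>auto simp del: of_nat_Suc\<close>)
qed

lemma real_subfield_Rats: "real_subfield \<rat>"
  by (auto simp: real_subfield_def)

lemma Rats_le_real_subfield: assumes "real_subfield F" shows "\<rat> \<subseteq> F"
proof
  fix x :: real assume "x \<in> \<rat>"
  then obtain a b where "x = of_int a / of_int b" by (elim Rats_cases') auto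
  then show "x \<in> F" using assms by (auto intro: real_subfieldD real_subfield_of_int)
qed

lemma gen_field_subfield: "real_subfield (gen_field S)"
  unfolding gen_field_def real_subfield_def by (auto simp: real_subfield_def)

lemma gen_field_incl: "S \<subseteq> gen_field S"
  by (auto simp: gen_field_def)

lemma gen_field_least: "real_subfield F \<Longrightarrow> S \<subseteq> F \<Longrightarrow> gen_field S \<subseteq> F"
  by (auto simp: gen_field_def)

lemma gen_field_mono: "S \<subseteq> gen_field T \<Longrightarrow> gen_field S \<subseteq> gen_field T"
  by (rule gen_field_least[OF gen_field_subfield])

text \<open>Subfields are sets and not types, so a polynomial over \<open>F\<close> is a real
  polynomial with a side condition. Every divisibility over \<open>F\<close> therefore has to name a
  cofactor that satisfies the condition as well.\<close>

definition poly_over :: "real set \<Rightarrow> real poly \<Rightarrow> bool" where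
  "poly_over F p \<longleftrightarrow> (\<forall>i. coeff p i \<in> F)"

lemma poly_over_intros:
  assumes "real_subfield F"
  shows "poly_over F 0" "c \<in> F \<Longrightarrow> poly_over F [:c:]" "poly_over F p \<Longrightarrow> poly_over F q \<Longrightarrow> poly_over F (p + q)"
    "poly_over F p \<Longrightarrow> poly_over F q \<Longrightarrow> poly_over F (p - q)"
    "poly_over F p \<Longrightarrow> poly_over F q \<Longrightarrow> poly_over F (p * q)"
    "c \<in> F \<Longrightarrow> poly_over F p \<Longrightarrow> poly_over F (Polynomial.smult c p)" "c \<in> F \<Longrightarrow> poly_over F (monom c n)"
    "c \<in> F \<Longrightarrow> poly_over F p \<Longrightarrow> poly_over F (pCons c p)" "poly_over F p \<Longrightarrow> poly_over F (pderiv p)"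
  using real_subfieldD[OF assms] real_subfield_of_int[OF assms, of "int _"]
  by (auto simp: poly_over_def coeff_pCons coeff_mult coeff_pderiv split: nat.splits
      intro!: real_subfield_sum[OF assms] simp flip: of_nat_Suc)

lemma poly_over_pcompose:
  assumes "real_subfield F" "poly_over F p" "poly_over F q" shows "poly_over F (pcompose p q)"
  using assms(2)
proof (induction p)
  case 0 then show ?case by simp
next
  case (pCons c p)
  have "coeff (pCons c p) 0 \<in> F" "\<forall>i. coeff (pCons c p) (Suc i) \<in> F"
    using pCons.prems unfolding poly_over_def by blast+
  then have "c \<in> F" "poly_over F p" by (simp_all add: poly_over_def)
  with pCons.IH show ?case
    by (auto simp: pcompose_pCons intro!: poly_over_intros[OF assms(1)] assms(3))
qed

lemma poly_over_mono: "poly_over F p \<Longrightarrow> F \<subseteq> G \<Longrightarrow> poly_over G p"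
  by (auto simp: poly_over_def)

lemma poly_over_eval: "real_subfield F \<Longrightarrow> poly_over F p \<Longrightarrow> x \<in> F \<Longrightarrow> poly p x \<in> F"
  by (auto simp: poly_altdef poly_over_def intro!: real_subfield_sum real_subfieldD)

text \<open>Cancelling the leading term uses only field operations of \<open>F\<close>; the gain
  over ordinary division of real polynomials is that quotient and remainder keep their coefficients
  in \<open>F\<close>.\<close>

lemma poly_over_division:
  assumes F: "real_subfield F" and q: "poly_over F q" "q \<noteq> 0" and p: "poly_over F p"
  shows "\<exists>a r. poly_over F a \<and> poly_over F r \<and> p = a * q + r \<and> (r = 0 \<or> degree r < degree q)"
  using p
proof (induction "degree p" arbitrary: p rule: less_induct)
  case (less p)
  show ?case
  proof (cases "p = 0 \<or> degree p < degree q")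
    case True
    then show ?thesis using less.prems by (intro exI[of _ 0] exI[of _ p]) (auto intro: poly_over_intros[OF F])
  next
    case False
    define s where "s = monom (lead_coeff p / lead_coeff q) (degree p - degree q)"
    have s: "poly_over F s"
      using less.prems q unfolding s_def by (intro poly_over_intros[OF F] real_subfieldD[OF F]) (auto simp: poly_over_def)
    define p' where "p' = p - s * q"
    have p': "poly_over F p'" unfolding p'_def by (intro poly_over_intros[OF F] less.prems s q)
    have ds: "s \<noteq> 0" "degree s = degree p - degree q" using False q by (auto simp: s_def degree_monom_eq monom_eq_0_iff)
    then have dsq: "degree (s * q) = degree p" using False q by (simp add: degree_mult_eq)
    have lc: "coeff (s * q) (degree p) = lead_coeff p"
    proof -
      have "coeff (s * q) (degree p) = lead_coeff (s * q)" using dsq by simp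
      also have "\<dots> = lead_coeff s * lead_coeff q" by (rule lead_coeff_mult)
      also have "lead_coeff s = lead_coeff p / lead_coeff q" using False q ds by (simp add: s_def degree_monom_eq)
      finally show ?thesis using q by simp
    qed
    have "p' = 0 \<or> degree p' < degree p"
    proof (cases "degree p = 0")
      case True
      have "coeff p' i = 0" for i
      proof (cases "i = 0")
        case True with lc \<open>degree p = 0\<close> show ?thesis by (simp add: p'_def)
      next
        case False
        then show ?thesis using \<open>degree p = 0\<close> dsq by (simp add: p'_def coeff_eq_0)
      qed
      then show ?thesis by (simp add: poly_eq_iff)
    next
      case False
      have "degree p' \<le> degree p" unfolding p'_def using dsq by (intro degree_diff_le) auto
      moreover have "coeff p' (degree p) = 0" using lc by (simp add: p'_def)
      ultimately show ?thesis using False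
        by (metis le_neq_implies_less leading_coeff_0_iff)
    qed
    then consider "p' = 0" | "degree p' < degree p" by blast
    then have "\<exists>a r. poly_over F a \<and> poly_over F r \<and> p' = a * q + r \<and> (r = 0 \<or> degree r < degree q)"
    proof cases
      case 1
      then show ?thesis by (intro exI[of _ 0] exI[of _ 0]) (auto intro: poly_over_intros[OF F])
    next
      case 2
      then show ?thesis using less.hyps p' by blast
    qed
    then obtain a r where "poly_over F a" "poly_over F r" "p' = a * q + r" "r = 0 \<or> degree r < degree q"
      by blast
    then show ?thesis
      by (intro exI[of _ "a + s"] exI[of _ r]) (auto simp: p'_def algebra_simps intro: poly_over_intros[OF F] s)
  qed
qed

section \<open>Minimal polynomials over a subfield of the reals\<close>

abbreviation cev :: "real poly \<Rightarrow> complex \<Rightarrow> complex" where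
  "cev p z \<equiv> poly (map_poly of_real p) z"

interpretation of_real_poly_hom: map_poly_inj_idom_hom "of_real :: real \<Rightarrow> complex" ..

lemma cev_hom [simp]:
  "cev (p + q) z = cev p z + cev q z" "cev (p - q) z = cev p z - cev q z" "cev (p * q) z = cev p z * cev q z"
  by (simp_all add: of_real_poly_hom.hom_mult of_real_poly_hom.hom_add of_real_poly_hom.hom_minus)

lemma cev_of_real [simp]: "cev p (of_real x) = of_real (poly p x)"
  by (simp add: of_real_hom.poly_map_poly)

lemma cev_pcompose: "cev (pcompose p q) z = cev p (cev q z)"
  by (induction p) (simp_all add: pcompose_pCons hom_distribs)

text \<open>A generator of the ideal of polynomials over \<open>F\<close> vanishing at
  \<open>z\<close>, unique up to a constant since no normalisation is imposed. The point is complex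
  because the conjugates of a real number need not be real.\<close>

definition is_minpoly :: "real set \<Rightarrow> real poly \<Rightarrow> complex \<Rightarrow> bool" where
  "is_minpoly F m z \<longleftrightarrow> poly_over F m \<and> m \<noteq> 0 \<and> cev m z = 0 \<and>
     (\<forall>g. poly_over F g \<and> cev g z = 0 \<longrightarrow> (\<exists>h. poly_over F h \<and> g = h * m))"

lemma minpoly_exists:
  assumes F: "real_subfield F" and p: "poly_over F p" "p \<noteq> 0" "cev p z = 0"
  shows "\<exists>m. is_minpoly F m z"
proof -
  define P where "P = (\<lambda>q. poly_over F q \<and> q \<noteq> 0 \<and> cev q z = 0)"
  obtain m where m: "P m" "\<And>q. P q \<Longrightarrow> degree m \<le> degree q"
    using ex_has_least_nat[of P p degree] p by (auto simp: P_def)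
  have "\<exists>h. poly_over F h \<and> g = h * m" if g: "poly_over F g" "cev g z = 0" for g
  proof -
    obtain a r where ar: "poly_over F a" "poly_over F r" "g = a * m + r" "r = 0 \<or> degree r < degree m"
      using poly_over_division[OF F _ _ g(1), of m] m(1) by (auto simp: P_def)
    have "cev r z = 0" using ar(3) g(2) m(1) by (simp add: P_def)
    then have "r \<noteq> 0 \<Longrightarrow> P r" using ar by (simp add: P_def)
    then have "r = 0" using ar(4) m(2)[of r] by fastforce
    with ar show ?thesis by auto
  qed
  then show ?thesis using m(1) by (auto simp: is_minpoly_def P_def)
qed

lemma is_unit_degree_0: "h * k = (1 :: real poly) \<Longrightarrow> degree h = 0 \<and> degree k = 0"
  by (metis add_is_0 degree_1 degree_mult_eq mult_zero_left mult_zero_right one_neq_zero)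

lemma minpoly_degree_pos: "is_minpoly F m z \<Longrightarrow> degree m > 0"
  by (rule ccontr) (auto simp: is_minpoly_def elim!: degree_eq_zeroE)

text \<open>This is irreducibility. Write \<open>m = k * h\<close> with \<open>h\<close> minimal for
  \<open>z'\<close>. If \<open>k\<close> vanished at \<open>z\<close>, then \<open>m\<close> would
  divide \<open>k\<close> and \<open>h\<close> would be constant; so \<open>h\<close> vanishes at
  \<open>z\<close>, and \<open>m\<close> divides \<open>h\<close>.\<close>

lemma minpoly_conj:
  assumes F: "real_subfield F" and m: "is_minpoly F m z" and z': "cev m z' = 0"
  shows "is_minpoly F m z'"
proof -
  have m': "poly_over F m" "m \<noteq> 0" "cev m z = 0" using m by (auto simp: is_minpoly_def)
  obtain h where h: "is_minpoly F h z'" using minpoly_exists[OF F m'(1,2) z'] by blast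
  obtain k where k: "poly_over F k" "m = k * h" using h m'(1) z' by (auto simp: is_minpoly_def)
  have "cev k z \<noteq> 0"
  proof
    assume "cev k z = 0"
    then obtain k' where "k = k' * m" using k m by (auto simp: is_minpoly_def)
    then have "m * 1 = m * (k' * h)" using k by (simp add: mult_ac)
    then have "k' * h = 1" using m'(2) mult_left_cancel by metis
    then show False using is_unit_degree_0[of k' h] minpoly_degree_pos[OF h] by simp
  qed
  then have "cev h z = 0" using m'(3) k(2) by auto
  then obtain l where l: "poly_over F l" "h = l * m" using h m by (auto simp: is_minpoly_def)
  show ?thesis unfolding is_minpoly_def
  proof (intro conjI allI impI)
    fix g assume "poly_over F g \<and> cev g z' = 0"
    then obtain a where "poly_over F a" "g = a * h" using h by (auto simp: is_minpoly_def)
    then show "\<exists>h. poly_over F h \<and> g = h * m"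
      using l by (intro exI[of _ "a * l"]) (auto intro: poly_over_intros[OF F])
  qed (use m' z' in auto)
qed

lemma minpoly_root_iff:
  assumes "real_subfield F" "is_minpoly F m z" "cev m z' = 0" "poly_over F g"
  shows "cev g z' = 0 \<longleftrightarrow> cev g z = 0"
  using minpoly_conj[OF assms(1-3)] assms unfolding is_minpoly_def by fastforce

text \<open>In characteristic zero the derivative is nonzero and of smaller degree, so
  \<open>m\<close> cannot divide it; as \<open>m\<close> is minimal for each of its roots, no root
  is multiple.\<close>

lemma minpoly_separable:
  assumes F: "real_subfield F" and m: "is_minpoly F m z"
  shows "card {z'. cev m z' = 0} = degree m"
proof -
  let ?c = "map_poly complex_of_real m"
  have m': "poly_over F m" "m \<noteq> 0" using m by (auto simp: is_minpoly_def)
  have "cev (pderiv m) z' \<noteq> 0" if "cev m z' = 0" for z'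
  proof
    assume *: "cev (pderiv m) z' = 0"
    have "is_minpoly F m z'" by (rule minpoly_conj[OF F m that])
    with * obtain h where h: "pderiv m = h * m"
      using poly_over_intros(9)[OF F m'(1)] by (auto simp: is_minpoly_def)
    have d: "degree m > 0" by (rule minpoly_degree_pos[OF m])
    then have "pderiv m \<noteq> 0" by (simp add: pderiv_eq_0_iff)
    then have "h \<noteq> 0" using h by auto
    then have "degree (pderiv m) = degree h + degree m" using h m' by (simp add: degree_mult_eq)
    then show False using d by (simp add: degree_pderiv)
  qed
  then have "rsquarefree ?c"
    by (auto simp: rsquarefree_roots of_real_hom.map_poly_pderiv)
  then have "?c = Polynomial.smult (lead_coeff ?c) (\<Prod>z|poly ?c z = 0. [:-z, 1:])"
    using complex_poly_decompose_rsquarefree by metis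
  moreover have "lead_coeff ?c \<noteq> 0" using m' by auto
  ultimately have "degree ?c = degree (\<Prod>z|poly ?c z = 0. [:-z, 1:])" by (metis degree_smult_eq)
  also have "\<dots> = (\<Sum>z|poly ?c z = 0. degree [:-z, 1:])" by (rule degree_prod_eq_sum_degree) simp
  also have "\<dots> = card {z. poly ?c z = 0}" by simp
  finally show ?thesis by (simp add: degree_map_poly)
qed

section \<open>Primitive elements and simple extensions\<close>

lemma algebraic_over_Rats:
  assumes "algebraic x" obtains p where "poly_over \<rat> p" "p \<noteq> 0" "poly p x = 0"
proof -
  from assms obtain p where "\<forall>i. coeff p i \<in> \<int>" "p \<noteq> 0" "poly p x = 0" by (auto simp: algebraic_def)
  moreover have "\<int> \<subseteq> (\<rat> :: real set)" by (auto elim!: Ints_cases)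
  ultimately show ?thesis using that[of p] by (auto simp: poly_over_def)
qed

lemma minpoly_real_exists:
  assumes "algebraic x" shows "\<exists>m. is_minpoly \<rat> m (of_real x)"
  using algebraic_over_Rats[OF assms] minpoly_exists[OF real_subfield_Rats, of _ "of_real x"] by (metis cev_of_real of_real_0)

text \<open>Over the field of \<theta> = x + c y, the minimal polynomial of \<open>y\<close> divides
  both \<open>g\<close> and \<open>f\<close> composed with \<theta> - c X. For all but finitely many
  \<open>c\<close> these two share only the root \<open>y\<close>, so by separability the minimal
  polynomial is linear and \<open>y\<close> lies in the field.\<close>

lemma primitive_element_two:
  assumes x: "algebraic x" and y: "algebraic y"
  shows "\<exists>c\<in>\<rat>. x \<in> gen_field {x + c * y} \<and> y \<in> gen_field {x + c * y}"
proof -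
  obtain f where f: "is_minpoly \<rat> f (of_real x)" using minpoly_real_exists[OF x] by blast
  obtain g where g: "is_minpoly \<rat> g (of_real y)" using minpoly_real_exists[OF y] by blast
  let ?X = "{z. cev f z = 0}" and ?Y = "{z. cev g z = 0}"
  have fin: "finite ?X" "finite ?Y" using f g by (auto simp: is_minpoly_def intro!: poly_roots_finite)
  \<comment> \<open>The values \<open>c\<close> for which x + c y = x' + c y' holds with conjugates
    x', y' and y' different from y. Pairs with y' = y contribute the value 0 of a division by zero,
    which is harmless.\<close>
  define Bad where "Bad = (\<lambda>(x', y'). (x' - of_real x) / (of_real y - y')) ` (?X \<times> ?Y)"
  have "finite Bad" using fin by (auto simp: Bad_def)
  moreover have "infinite (range (of_nat :: nat \<Rightarrow> complex))" by (rule range_inj_infinite) (simp add: inj_def)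
  ultimately have "\<not> range (of_nat :: nat \<Rightarrow> complex) \<subseteq> Bad" using finite_subset by blast
  then obtain n :: nat where n: "of_nat n \<notin> Bad" by blast
  define c where "c = real n"
  define \<theta> where "\<theta> = x + c * y"
  define F where "F = gen_field {\<theta>}"
  have F: "real_subfield F" unfolding F_def by (rule gen_field_subfield)
  have QF: "\<rat> \<subseteq> F" by (rule Rats_le_real_subfield[OF F])
  have th: "\<theta> \<in> F" using gen_field_incl[of "{\<theta>}"] by (auto simp: F_def)
  have cF: "c \<in> F" using QF by (auto simp: c_def)
  have gF: "poly_over F g" "g \<noteq> 0" using g QF by (auto simp: is_minpoly_def intro: poly_over_mono)
  obtain m where m: "is_minpoly F m (of_real y)"
    using minpoly_exists[OF F gF, of "of_real y"] g unfolding is_minpoly_def by blast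
  have "z = of_real y" if z: "cev m z = 0" for z
  proof (rule ccontr)
    assume ne: "z \<noteq> of_real y"
    have 1: "cev g z = 0" using minpoly_root_iff[OF F m z gF(1)] g by (auto simp: is_minpoly_def)
    let ?h = "pcompose f [:\<theta>, -c:]"
    have fF: "poly_over F f" using f QF by (auto simp: is_minpoly_def intro: poly_over_mono)
    have hF: "poly_over F ?h"
      using th cF by (intro poly_over_pcompose[OF F fF] poly_over_intros[OF F] real_subfieldD[OF F]) auto
    have "cev ?h (of_real y) = 0"
      using f by (simp only: cev_of_real) (auto simp: poly_pcompose \<theta>_def is_minpoly_def)
    then have "cev ?h z = 0" using minpoly_root_iff[OF F m z hF] by blast
    moreover have "cev [:\<theta>, - c:] z = of_real \<theta> - z * of_real c" by (simp add: hom_distribs)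
    ultimately have "cev f (of_real \<theta> - z * of_real c) = 0" using cev_pcompose[of f "[:\<theta>, - c:]" z] by simp
    with 1 have "(of_real \<theta> - z * of_real c - of_real x) / (of_real y - z) \<in> Bad" by (force simp: Bad_def)
    moreover have "(of_real \<theta> - z * of_real c - of_real x) / (of_real y - z) = (of_nat n :: complex)"
      using ne by (simp add: \<theta>_def c_def field_simps)
    ultimately show False using n by simp
  qed
  then have "{z. cev m z = 0} = {of_real y}" using m by (auto simp: is_minpoly_def)
  then have "degree m = 1" using minpoly_separable[OF F m] by simp
  then obtain a b where ab: "m = [:a, b:]" "b \<noteq> 0" by (rule degree1_coeffs) 
  then have "a \<in> F" "b \<in> F" using m unfolding is_minpoly_def poly_over_def
    by (metis coeff_pCons_0, metis coeff_pCons_0 coeff_pCons_Suc)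
  moreover have "poly m y = 0" using m by (simp add: is_minpoly_def)
  then have "a + y * b = 0" by (simp add: ab(1))
  then have "y = - (a / b)" using ab by (simp add: field_simps add_eq_0_iff)
  ultimately have yF: "y \<in> F" by (auto intro: real_subfieldD[OF F])
  moreover have "x = \<theta> - c * y" by (simp add: \<theta>_def)
  then have "x \<in> F" using th cF yF by (auto intro: real_subfieldD[OF F])
  ultimately show ?thesis unfolding F_def \<theta>_def by (intro bexI[of _ c]) (auto simp: c_def)
qed

lemma primitive_element:
  assumes "finite S" "\<And>x. x \<in> gen_field S \<Longrightarrow> algebraic x"
  shows "\<exists>\<theta>\<in>gen_field S. gen_field S = gen_field {\<theta>}"
  using assms
proof (induction S)
  case empty
  have "gen_field {} = gen_field {0}"
    using real_subfieldD(1)[OF gen_field_subfield, of "{}"] by (intro equalityI gen_field_mono) auto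
  then show ?case using real_subfieldD(1)[OF gen_field_subfield] by blast
next
  case (insert x S)
  let ?E = "gen_field (insert x S)"
  have SE: "gen_field S \<subseteq> ?E" using gen_field_incl[of "insert x S"] by (intro gen_field_mono) auto
  then obtain \<theta> where \<theta>: "\<theta> \<in> gen_field S" "gen_field S = gen_field {\<theta>}" using insert by blast
  have xE: "x \<in> ?E" "\<theta> \<in> ?E" using gen_field_incl[of "insert x S"] \<theta>(1) SE by auto
  obtain c where c: "c \<in> \<rat>" "x \<in> gen_field {x + c * \<theta>}" "\<theta> \<in> gen_field {x + c * \<theta>}"
    using primitive_element_two[of x \<theta>] insert.prems xE by blast
  have cE: "x + c * \<theta> \<in> ?E"
    using xE c(1) Rats_le_real_subfield[OF gen_field_subfield] by (blast intro: real_subfieldD[OF gen_field_subfield])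
  have "gen_field {\<theta>} \<subseteq> gen_field {x + c * \<theta>}" using c by (intro gen_field_mono) auto
  then have "insert x S \<subseteq> gen_field {x + c * \<theta>}" using c \<theta> gen_field_incl[of S] by auto
  then have "?E = gen_field {x + c * \<theta>}" using cE by (intro equalityI gen_field_mono) auto
  then show ?case using cE by blast
qed

text \<open>Only inverses need an argument: if the minimal polynomial of \<open>x\<close> is a + X
  q, then \<open>a\<close> is nonzero by minimality and 1/x = - q(x)/a is again a polynomial in
  \<theta>.\<close>

lemma simple_field_eq:
  assumes "\<And>x. x \<in> gen_field {\<theta>} \<Longrightarrow> algebraic x"
  shows "gen_field {\<theta>} = {poly g \<theta> | g. poly_over \<rat> g}"
proof
  let ?E = "gen_field {\<theta>}" and ?I = "{poly g \<theta> | g. poly_over \<rat> g}"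
  note Q = real_subfield_Rats
  have E: "real_subfield ?E" by (rule gen_field_subfield)
  show sub: "?I \<subseteq> ?E"
  proof
    fix x assume "x \<in> ?I"
    then obtain g where g: "x = poly g \<theta>" "poly_over \<rat> g" by blast
    then show "x \<in> ?E" using gen_field_incl[of "{\<theta>}"] Rats_le_real_subfield[OF E]
      by (auto intro!: poly_over_eval[OF E] intro: poly_over_mono)
  qed
  have inv: "inverse x \<in> ?I" if X: "x \<in> ?I" "x \<noteq> 0" for x
  proof -
    obtain g where g: "x = poly g \<theta>" "poly_over \<rat> g" using X(1) by blast
    have "algebraic x" using sub X assms by blast
    then obtain p where p: "is_minpoly \<rat> p (of_real x)" using minpoly_real_exists by blast
    obtain a q where aq: "p = pCons a q" by (cases p)
    have pQ: "poly_over \<rat> p" "p \<noteq> 0" "poly p x = 0" using p by (auto simp: is_minpoly_def)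
    then have "coeff p 0 \<in> \<rat>" "\<forall>i. coeff p (Suc i) \<in> \<rat>" unfolding poly_over_def by blast+
    then have a: "a \<in> \<rat>" and q: "poly_over \<rat> q" by (simp_all add: aq poly_over_def)
    have "a \<noteq> 0"
    proof
      assume "a = 0"
      then have "poly q x = 0" using pQ aq X by simp
      then obtain h where h: "q = h * p" using p q by (auto simp: is_minpoly_def)
      have "q \<noteq> 0" using pQ aq \<open>a = 0\<close> by auto
      then have "h \<noteq> 0" using h by auto
      then have "degree q = degree h + degree p" using h pQ by (simp add: degree_mult_eq)
      moreover have "degree p = Suc (degree q)" using aq \<open>q \<noteq> 0\<close> by simp
      ultimately show False by simp
    qed
    moreover have "a + x * poly q x = 0" using pQ aq by simp
    ultimately have "inverse x = (- inverse a) * poly q x" using X by (simp add: field_simps add_eq_0_iff)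
    also have "\<dots> = poly (Polynomial.smult (- inverse a) (pcompose q g)) \<theta>" by (simp add: poly_pcompose g)
    finally show ?thesis using a q g
      by (auto intro!: exI[of _ "Polynomial.smult (- inverse a) (pcompose q g)"] poly_over_intros[OF Q] poly_over_pcompose[OF Q])
  qed
  have "real_subfield ?I" unfolding real_subfield_def
  proof (intro conjI ballI impI)
    show "0 \<in> ?I" by (intro CollectI exI[of _ 0]) (auto intro: poly_over_intros[OF Q])
    show "1 \<in> ?I" by (intro CollectI exI[of _ "[:1:]"]) (auto intro: poly_over_intros[OF Q])
    fix x y assume "x \<in> ?I" "y \<in> ?I"
    then obtain g h where gh: "x = poly g \<theta>" "poly_over \<rat> g" "y = poly h \<theta>" "poly_over \<rat> h" by blast
    show "x + y \<in> ?I" using gh by (intro CollectI exI[of _ "g + h"]) (auto intro: poly_over_intros[OF Q])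
    show "x - y \<in> ?I" using gh by (intro CollectI exI[of _ "g - h"]) (auto intro: poly_over_intros[OF Q])
    show "x * y \<in> ?I" using gh by (intro CollectI exI[of _ "g * h"]) (auto intro: poly_over_intros[OF Q])
  qed (use inv in blast)
  moreover have "\<theta> \<in> ?I" by (intro CollectI exI[of _ "[:0, 1:]"]) (auto intro!: poly_over_intros[OF Q])
  ultimately show "?E \<subseteq> ?I" by (intro gen_field_least) auto
qed

section \<open>Norms and the real embeddings of a totally real field\<close>

lemma real_subfield_prod:
  "real_subfield F \<Longrightarrow> (\<And>i. i \<in> I \<Longrightarrow> f i \<in> F) \<Longrightarrow> prod f I \<in> F"
  by (induction I rule: infinite_finite_induct) (auto intro: real_subfieldD)

text \<open>The norm as a determinant: multiplication by \<open>g\<close> modulo \<open>f\<close>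
  has a rational matrix, and the Vandermonde matrix of the roots conjugates it to the diagonal
  matrix of the values of \<open>g\<close>.\<close>

lemma prod_roots_rational:
  assumes f: "poly_over \<rat> f" "f \<noteq> 0" and R: "finite R" "card R = degree f" "\<And>r. r \<in> R \<Longrightarrow> poly f r = 0"
    and g: "poly_over \<rat> g"
  shows "(\<Prod>r\<in>R. poly g r) \<in> \<rat>"
proof -
  define d where "d = degree f"
  obtain h where h: "bij_betw h {0..<d} R" using ex_bij_betw_nat_finite[OF R(1)] R(2) by (auto simp: d_def)
  have hR: "h i \<in> R" if "i < d" for i using h that by (auto simp: bij_betw_def)
  have "\<exists>r. poly_over \<rat> r \<and> (\<forall>i\<in>R. poly g i * i ^ j = (\<Sum>k<d. coeff r k * i ^ k))" for j
  proof -
    have gj: "poly_over \<rat> (g * monom 1 j)" using g by (intro poly_over_intros[OF real_subfield_Rats]) auto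
    obtain a r where ar: "poly_over \<rat> r" "g * monom 1 j = a * f + r" "r = 0 \<or> degree r < degree f"
      using poly_over_division[OF real_subfield_Rats f gj] by blast
    have "poly r x = (\<Sum>k<d. coeff r k * x ^ k)" for x
    proof (cases "r = 0")
      case False
      then have "degree r < d" using ar by (simp add: d_def)
      then show ?thesis unfolding poly_altdef by (intro sum.mono_neutral_left) (auto simp: coeff_eq_0)
    qed auto
    moreover have "poly g x * x ^ j = poly r x" if "x \<in> R" for x
      using arg_cong[OF ar(2), of "\<lambda>p. poly p x"] R(3)[OF that] by (simp add: poly_monom)
    ultimately show ?thesis using ar(1) by metis
  qed
  then obtain r where r: "\<And>j. poly_over \<rat> (r j)" "\<And>j x. x \<in> R \<Longrightarrow> poly g x * x ^ j = (\<Sum>k<d. coeff (r j) k * x ^ k)"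
    by metis
  \<comment> \<open>Column \<open>j\<close> of \<open>M\<close> holds the coefficients of the
    remainder of X^j g modulo \<open>f\<close>; evaluating these remainders at the roots gives
    \<open>V * M = D * V\<close>.\<close>
  define V where "V = mat d d (\<lambda>(i, k). h i ^ k)"
  define M where "M = mat d d (\<lambda>(k, j). coeff (r j) k)"
  define D where "D = mat d d (\<lambda>(i, j). if i = j then poly g (h i) else 0)"
  have carr: "V \<in> carrier_mat d d" "M \<in> carrier_mat d d" "D \<in> carrier_mat d d" by (auto simp: V_def M_def D_def)
  have "V * M = D * V"
  proof (rule eq_matI)
    fix i j assume "i < dim_row (D * V)" "j < dim_col (D * V)"
    then have ij: "i < d" "j < d" using carr by auto
    have "(V * M) $$ (i, j) = (\<Sum>k<d. coeff (r j) k * h i ^ k)"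
      using ij by (auto simp: V_def M_def scalar_prod_def atLeast0LessThan mult_ac)
    also have "\<dots> = poly g (h i) * h i ^ j" using r(2)[OF hR[OF ij(1)]] by simp
    also have "\<dots> = (D * V) $$ (i, j)"
      using ij by (auto simp: V_def D_def scalar_prod_def if_distrib[of "\<lambda>x. x * _"] cong: if_cong)
    finally show "(V * M) $$ (i, j) = (D * V) $$ (i, j)" .
  qed (use carr in auto)
  then have "det V * det M = det D * det V" using det_mult carr by metis
  \<comment> \<open>A kernel vector would be the coefficient list of a nonzero polynomial of degree
    below \<open>d\<close> with \<open>d\<close> roots.\<close>
  moreover have "det V \<noteq> 0"
  proof
    assume "det V = 0"
    then obtain v where v: "v \<in> carrier_vec d" "v \<noteq> 0\<^sub>v d" "V *\<^sub>v v = 0\<^sub>v d"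
      using det_0_iff_vec_prod_zero_field[OF carr(1)] by blast
    define q where "q = (\<Sum>k<d. monom (v $ k) k)"
    have cq: "coeff q k = (if k < d then v $ k else 0)" for k
      by (simp add: q_def coeff_sum if_distrib cong: if_cong)
    have root: "poly q x = 0" if "x \<in> R" for x
    proof -
      obtain i where i: "i < d" "x = h i" using h \<open>x \<in> R\<close> by (auto simp: bij_betw_def)
      have "poly q x = (V *\<^sub>v v) $ i"
        using i v(1) by (auto simp: q_def V_def poly_sum poly_monom scalar_prod_def atLeast0LessThan mult_ac)
      then show ?thesis using v(3) i by simp
    qed
    have "q = 0"
    proof (rule ccontr)
      assume q0: "q \<noteq> 0"
      have "card R \<le> card {x. poly q x = 0}"
        using root q0 by (intro card_mono poly_roots_finite) auto
      also have "\<dots> \<le> degree q" by (rule card_poly_roots_bound[OF q0])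
      also have "\<dots> < d"
      proof (rule ccontr)
        assume "\<not> degree q < d"
        then have "lead_coeff q = 0" by (simp add: cq)
        then show False using q0 by simp
      qed
      finally show False using R(2) by (simp add: d_def)
    qed
    then have "v $ k = 0" if "k < d" for k using cq[of k] that by simp
    then have "v = 0\<^sub>v d" using v(1) by (intro eq_vecI) auto
    with v(2) show False by simp
  qed
  ultimately have "det D = det M" by simp
  moreover have "det D = (\<Prod>i<d. poly g (h i))"
  proof -
    have "upper_triangular D" by (auto simp: D_def upper_triangular_def)
    then have "det D = prod_list (diag_mat D)" by (rule det_upper_triangular[OF _ carr(3)])
    also have "\<dots> = (\<Prod>i<d. poly g (h i))"
      by (simp add: diag_mat_def D_def prod.list_conv_set_nth atLeast0LessThan)
    finally show ?thesis .
  qed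
  moreover have "(\<Prod>i<d. poly g (h i)) = (\<Prod>r\<in>R. poly g r)"
    using prod.reindex_bij_betw[OF h, of "poly g"] by (simp add: atLeast0LessThan)
  moreover have "det M \<in> \<rat>"
  proof -
    have "M $$ (i, j) \<in> \<rat>" if "i < d" "j < d" for i j using that r(1) by (auto simp: M_def poly_over_def)
    then show ?thesis
      using permutes_in_image[of _ "{0..<d}"]
      by (subst det_def'[OF carr(2)]) (auto simp: sign_def intro!: real_subfield_sum[OF real_subfield_Rats] real_subfield_prod[OF real_subfield_Rats])
  qed
  ultimately show ?thesis by simp
qed

lemma real_rat_vector_space: "vector_space (\<lambda>(q::rat) (x::real). of_rat q * x)"
  unfolding vector_space_def
  by (simp add: distrib_left distrib_right of_rat_add of_rat_mult mult.assoc)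

text \<open>\<Phi> has one embedding for each root of the minimal polynomial of a primitive element
  \<theta>, all roots being real by total reality. The last property stands in for the tower
  formula: with [E:K] embeddings fixing \<open>K\<close>, it says that an independent set in
  \<open>K\<close> has at most [E:Q]/[E:K] elements.\<close>

theorem field_embeddings:
  assumes fin: "finite S" and tr: "totally_real_field (gen_field S)" and E_def: "E = gen_field S"
  obtains \<Phi> where "finite \<Phi>" "\<exists>\<phi>\<in>\<Phi>. \<forall>x\<in>E. \<phi> x = x" "\<And>\<phi>. \<phi> \<in> \<Phi> \<Longrightarrow> real_embedding E \<phi>"
    "\<And>x. x \<in> E \<Longrightarrow> algebraic_int x \<Longrightarrow> x \<noteq> 0 \<Longrightarrow> 1 \<le> (\<Prod>\<phi>\<in>\<Phi>. \<bar>\<phi> x\<bar>)"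
    "\<And>K B. K \<subseteq> E \<Longrightarrow> real_subfield K \<Longrightarrow> finite B \<Longrightarrow> B \<subseteq> K \<Longrightarrow> Q_indep B \<Longrightarrow>
       card B * card {\<phi>\<in>\<Phi>. \<forall>x\<in>K. \<phi> x = x} \<le> card \<Phi>"
proof -
  note Q = real_subfield_Rats
  have alg: "algebraic x" if "x \<in> E" for x using tr that by (auto simp: totally_real_field_def E_def)
  obtain \<theta> where \<theta>: "\<theta> \<in> E" "E = gen_field {\<theta>}" using primitive_element[OF fin] alg unfolding E_def by blast
  have Eeq: "E = {poly g \<theta> | g. poly_over \<rat> g}" unfolding \<theta>(2) by (rule simple_field_eq) (use alg \<theta>(2) in auto)
  obtain f where f: "is_minpoly \<rat> f (of_real \<theta>)" using minpoly_real_exists[OF alg[OF \<theta>(1)]] by blast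
  have f': "poly_over \<rat> f" "f \<noteq> 0" "poly f \<theta> = 0" using f by (auto simp: is_minpoly_def)
  \<comment> \<open>Elements of \<open>E\<close> are represented by rational polynomials in
    \<theta>, and conjugation means evaluating the representative at another root. The choice does
    not matter there, since two representatives differ by a polynomial vanishing at \<theta> and so
    at all its conjugates.\<close>
  define rep where "rep x = (SOME g. poly_over \<rat> g \<and> poly g \<theta> = x)" for x
  have rep: "poly_over \<rat> (rep x)" "poly (rep x) \<theta> = x" if "x \<in> E" for x
    using someI_ex[of "\<lambda>g. poly_over \<rat> g \<and> poly g \<theta> = x"] that by (auto simp: Eeq rep_def)
  have inE: "poly g \<theta> \<in> E" if "poly_over \<rat> g" for g using that by (auto simp: Eeq)
  have crep: "cev (rep (poly g \<theta>)) z = cev g z" if g: "poly_over \<rat> g" and z: "cev f z = 0" for g z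
  proof -
    have "poly_over \<rat> (rep (poly g \<theta>) - g)" using rep[OF inE[OF g]] g by (intro poly_over_intros[OF Q])
    then have "cev (rep (poly g \<theta>) - g) z = 0"
      using minpoly_root_iff[OF Q f z, of "rep (poly g \<theta>) - g"] rep[OF inE[OF g]] by (simp del: cev_hom)
    then show ?thesis by simp
  qed
  have one: "poly_over \<rat> [:1:]" by (intro poly_over_intros[OF Q]) auto
  have X: "poly_over \<rat> [:0, 1:]" by (intro poly_over_intros[OF Q]) auto
  \<comment> \<open>A root \<open>z\<close> defines a complex embedding sending \<theta> to
    \<open>z\<close>; total reality forces its values to be real.\<close>
  have realroot: "z \<in> \<real>" if z: "cev f z = 0" for z
  proof -
    have "complex_embedding E (\<lambda>x. cev (rep x) z)"
      unfolding complex_embedding_def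
    proof (intro conjI ballI)
      show "cev (rep 1) z = 1"
        using crep[OF one z] by simp
      fix x y assume xy: "x \<in> E" "y \<in> E"
      show "cev (rep (x + y)) z = cev (rep x) z + cev (rep y) z"
        using crep[of "rep x + rep y" z] rep xy z by (simp add: poly_over_intros[OF Q])
      show "cev (rep (x * y)) z = cev (rep x) z * cev (rep y) z"
        using crep[of "rep x * rep y" z] rep xy z by (simp add: poly_over_intros[OF Q])
    qed
    then have "cev (rep \<theta>) z \<in> \<real>" using tr \<theta>(1) by (auto simp: totally_real_field_def E_def)
    then show ?thesis using crep[OF X z] by simp
  qed
  define R where "R = {r. poly f r = 0}"
  have finR: "finite R" using f' by (auto simp: R_def intro: poly_roots_finite)
  have "{z. cev f z = 0} = of_real ` R"
  proof (intro equalityI subsetI)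
    fix z assume z: "z \<in> {z. cev f z = 0}"
    then obtain r where "z = of_real r" using realroot by (auto elim: Reals_cases)
    then show "z \<in> of_real ` R" using z by (auto simp: R_def)
  qed (auto simp: R_def)
  then have cardR: "card R = degree f"
    using minpoly_separable[OF Q f] by (simp add: card_image inj_on_def)
  define emb where "emb r x = poly (rep x) r" for r x
  have emb: "emb r (poly g \<theta>) = poly g r" if "poly_over \<rat> g" "r \<in> R" for r g
    using crep[of g "of_real r"] that by (simp add: R_def emb_def)
  have emb_\<theta>: "emb r \<theta> = r" if "r \<in> R" for r using emb[OF X that] by simp
  have inj: "inj_on emb R" using emb_\<theta> by (metis inj_onI)
  have \<theta>R: "\<theta> \<in> R" using f' by (simp add: R_def)
  have hom: "real_embedding E (emb r)" if r: "r \<in> R" for r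
    unfolding real_embedding_def
  proof (intro conjI ballI)
    show "emb r 1 = 1" using emb[OF one r] by simp
    fix x y assume xy: "x \<in> E" "y \<in> E"
    show "emb r (x + y) = emb r x + emb r y"
      using emb[of "rep x + rep y" r] rep xy r by (simp add: poly_over_intros[OF Q] emb_def)
    show "emb r (x * y) = emb r x * emb r y"
      using emb[of "rep x * rep y" r] rep xy r by (simp add: poly_over_intros[OF Q] emb_def)
  qed
  \<comment> \<open>The product of the conjugates is an algebraic integer and rational, hence an
    ordinary integer, and it is nonzero because a conjugate vanishes only if the element
    does.\<close>
  have norm: "1 \<le> (\<Prod>r\<in>R. \<bar>emb r x\<bar>)" if x: "x \<in> E" "algebraic_int x" "x \<noteq> 0" for x
  proof -
    obtain p :: "real poly" where p: "lead_coeff p = 1" "\<forall>i. coeff p i \<in> \<int>" "poly p x = 0"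
      using x(2) by (auto elim: algebraic_int.cases)
    have pQ: "poly_over \<rat> p" using p(2) Ints_subset_Rats by (auto simp: poly_over_def)
    have "algebraic_int (emb r x)" if r: "r \<in> R" for r
    proof -
      have "emb r (poly (pcompose p (rep x)) \<theta>) = poly (pcompose p (rep x)) r"
        using emb[OF poly_over_pcompose[OF Q pQ] r] rep(1)[OF x(1)] by blast
      then have "poly p (emb r x) = emb r 0" using p(3) rep[OF x(1)] by (simp add: poly_pcompose emb_def)
      also have "emb r 0 = 0" using emb[of 0 r] r by (auto intro: poly_over_intros[OF Q])
      finally show ?thesis using p by (intro algebraic_int.intros)
    qed
    then have "algebraic_int (\<Prod>r\<in>R. emb r x)" by (rule algebraic_int_prod)
    moreover have "(\<Prod>r\<in>R. emb r x) \<in> \<rat>"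
      unfolding emb_def using f' finR cardR rep[OF x(1)] by (intro prod_roots_rational[of f]) (auto simp: R_def)
    ultimately have "(\<Prod>r\<in>R. emb r x) \<in> \<int>" by (rule rational_algebraic_int_is_int)
    moreover have "(\<Prod>r\<in>R. emb r x) \<noteq> 0"
    proof
      assume "(\<Prod>r\<in>R. emb r x) = 0"
      then obtain r where r: "r \<in> R" "emb r x = 0" using finR by auto
      then have "cev (rep x) (of_real r) = 0" by (simp add: emb_def)
      then have "cev (rep x) (of_real \<theta>) = 0"
        using minpoly_root_iff[OF Q f _ rep(1)[OF x(1)], of "of_real r"] r by (simp add: R_def)
      then show False using rep x by simp
    qed
    ultimately have "1 \<le> \<bar>\<Prod>r\<in>R. emb r x\<bar>" by (rule Ints_nonzero_abs_ge1)
    then show ?thesis by (simp add: abs_prod)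
  qed
  \<comment> \<open>The elements \<open>b * \<theta> ^ j\<close>, with \<open>b\<close> in
    \<open>B\<close> and \<open>j\<close> below the number \<open>e\<close> of embeddings fixing
    \<open>K\<close>, are independent over the rationals. Since they lie in \<open>E\<close>, there
    are at most [E:Q] of them.\<close>
  have count: "card B * card {r\<in>R. \<forall>x\<in>K. emb r x = x} \<le> card R"
    if K: "K \<subseteq> E" "real_subfield K" and B: "finite B" "B \<subseteq> K" "Q_indep B" for K B
  proof -
    interpret V: vector_space "\<lambda>(q::rat) (x::real). of_rat q * x" by (rule real_rat_vector_space)
    define RK where "RK = {r\<in>R. \<forall>x\<in>K. emb r x = x}"
    define e where "e = card RK"
    define I where "I = B \<times> {..<e}"
    define F where "F = (\<lambda>(b, j). b * \<theta> ^ j)"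
    have finI: "finite I" using B by (simp add: I_def)
    have indep: "c i = 0" if s: "(\<Sum>i\<in>I. of_rat (c i) * F i) = 0" and i: "i \<in> I" for c :: "real \<times> nat \<Rightarrow> rat" and i
    proof -
      define \<kappa> where "\<kappa> j = (\<Sum>b\<in>B. of_rat (c (b, j)) * b)" for j
      have \<kappa>K: "\<kappa> j \<in> K" for j
        unfolding \<kappa>_def using B(2) Rats_le_real_subfield[OF K(2)]
        by (intro real_subfield_sum[OF K(2)] real_subfieldD[OF K(2)]) auto
      have "(\<Sum>i\<in>I. of_rat (c i) * F i) = (\<Sum>b\<in>B. \<Sum>j<e. of_rat (c (b, j)) * b * \<theta> ^ j)"
        by (simp add: I_def F_def sum.cartesian_product mult_ac split_def)
      also have "\<dots> = (\<Sum>j<e. \<kappa> j * \<theta> ^ j)"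
        by (subst sum.swap) (simp add: \<kappa>_def sum_distrib_right)
      finally have s': "(\<Sum>j<e. \<kappa> j * \<theta> ^ j) = 0" using s by simp
      \<comment> \<open>A relation is a polynomial \<open>H\<close> over \<open>K\<close> of degree
        below \<open>e\<close> vanishing at \<theta>. \<open>G\<close> lifts it to rational
        coefficients, so that it also vanishes at the conjugates; at a root whose embedding fixes
        \<open>K\<close>, \<open>G\<close> and \<open>H\<close> agree. Thus \<open>H\<close> has
        \<open>e\<close> roots and is zero.\<close>
      define G where "G = (\<Sum>j<e. rep (\<kappa> j) * monom 1 j)"
      have GQ: "poly_over \<rat> G" unfolding G_def
      proof (induction e)
        case (Suc e)
        then show ?case using rep(1)[of "\<kappa> e"] \<kappa>K K(1) by (auto intro!: poly_over_intros[OF Q])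
      qed (auto intro: poly_over_intros[OF Q])
      have "poly G \<theta> = 0" using s' rep(2) \<kappa>K K(1) by (simp add: G_def poly_sum poly_monom subset_iff)
      define H where "H = (\<Sum>j<e. monom (\<kappa> j) j)"
      have cH: "coeff H j = (if j < e then \<kappa> j else 0)" for j
        by (simp add: H_def coeff_sum if_distrib cong: if_cong)
      have root: "poly H r = 0" if "r \<in> RK" for r
      proof -
        have r: "r \<in> R" "\<And>x. x \<in> K \<Longrightarrow> poly (rep x) r = x" using that by (auto simp: RK_def emb_def)
        have "poly H r = poly G r" using r(2) \<kappa>K by (simp add: H_def G_def poly_sum poly_monom)
        also have "\<dots> = emb r (poly G \<theta>)" using emb[OF GQ r(1)] by simp
        also have "\<dots> = emb r (poly 0 \<theta>)" using \<open>poly G \<theta> = 0\<close> by simp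
        also have "\<dots> = 0" by (subst emb) (auto intro: poly_over_intros[OF Q] r)
        finally show ?thesis .
      qed
      have "H = 0"
      proof (rule ccontr)
        assume H0: "H \<noteq> 0"
        have "e \<le> card {x. poly H x = 0}" unfolding e_def
          using root H0 by (intro card_mono poly_roots_finite) auto
        also have "\<dots> \<le> degree H" by (rule card_poly_roots_bound[OF H0])
        also have "\<dots> < e"
        proof (rule ccontr)
          assume "\<not> degree H < e"
          then have "lead_coeff H = 0" by (simp add: cH)
          then show False using H0 by simp
        qed
        finally show False by simp
      qed
      obtain b j where bj: "i = (b, j)" "b \<in> B" "j < e" using i by (auto simp: I_def)
      have "\<kappa> j = 0" using cH[of j] bj \<open>H = 0\<close> by simp
      then show ?thesis using B(3) bj unfolding Q_indep_def \<kappa>_def by (auto dest: spec[of _ "\<lambda>b. c (b, j)"])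
    qed
    have injF: "inj_on F I"
    proof (rule inj_onI, rule ccontr)
      fix i j assume ij: "i \<in> I" "j \<in> I" "F i = F j" "i \<noteq> j"
      define c :: "real \<times> nat \<Rightarrow> rat" where "c k = (if k = i then 1 else if k = j then -1 else 0)" for k
      have "(\<Sum>k\<in>I. of_rat (c k) * F k) = (\<Sum>k\<in>{i, j}. of_rat (c k) * F k)"
        using ij finI by (intro sum.mono_neutral_right) (auto simp: c_def)
      also have "\<dots> = 0" using ij by (simp add: c_def)
      finally have "c i = 0" using indep ij(1) by blast
      then show False by (simp add: c_def)
    qed
    have "V.independent (F ` I)"
      unfolding V.dependent_finite[OF finite_imageI[OF finI]]
    proof safe
      fix u :: "real \<Rightarrow> rat" and a b
      assume *: "(\<Sum>v\<in>F ` I. of_rat (u v) * v) = 0" and "(a, b) \<in> I" "u (F (a, b)) \<noteq> 0"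
      then show False using indep[of "\<lambda>i. u (F i)"] by (auto simp: sum.reindex[OF injF])
    qed
    moreover have "F ` I \<subseteq> V.span ((\<lambda>k. \<theta> ^ k) ` {..<degree f})"
    proof
      fix x assume "x \<in> F ` I"
      then have "x \<in> E" using B(2) K(1) \<theta> gen_field_subfield[of "{\<theta>}"]
        by (auto simp: F_def I_def intro!: real_subfieldD)
      obtain a r where ar: "poly_over \<rat> r" "rep x = a * f + r" "r = 0 \<or> degree r < degree f"
        using poly_over_division[OF Q f'(1,2) rep(1)[OF \<open>x \<in> E\<close>]] by blast
      have "x = poly r \<theta>" using rep(2)[OF \<open>x \<in> E\<close>] ar(2) f'(3) by simp
      also have "\<dots> = (\<Sum>k\<le>degree r. coeff r k * \<theta> ^ k)" by (rule poly_altdef)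
      also have "\<dots> \<in> V.span ((\<lambda>k. \<theta> ^ k) ` {..<degree f})"
      proof (intro V.span_sum)
        fix k assume k: "k \<in> {..degree r}"
        obtain q where q: "coeff r k = of_rat q" using ar(1) unfolding poly_over_def by (metis Rats_cases)
        show "coeff r k * \<theta> ^ k \<in> V.span ((\<lambda>k. \<theta> ^ k) ` {..<degree f})"
        proof (cases "r = 0")
          case True then show ?thesis by (simp add: V.span_zero)
        next
          case False
          then have "\<theta> ^ k \<in> V.span ((\<lambda>k. \<theta> ^ k) ` {..<degree f})" using k ar(3) by (intro V.span_base) auto
          from V.span_scale[OF this, of q] q show ?thesis by simp
        qed
      qed
      finally show "x \<in> V.span ((\<lambda>k. \<theta> ^ k) ` {..<degree f})" .
    qed
    ultimately have "card (F ` I) \<le> card ((\<lambda>k. \<theta> ^ k) ` {..<degree f})"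
      using V.independent_span_bound by blast
    also have "\<dots> \<le> degree f" using card_image_le[of "{..<degree f}"] by simp
    finally have "card I \<le> degree f" using card_image[OF injF] by simp
    then show ?thesis by (simp add: I_def card_cartesian_product e_def RK_def cardR)
  qed
  show thesis
  proof (rule that[of "emb ` R"])
    show "finite (emb ` R)" using finR by simp
    show "\<exists>\<phi>\<in>emb ` R. \<forall>x\<in>E. \<phi> x = x" using \<theta>R rep by (auto simp: emb_def)
    show "real_embedding E \<phi>" if "\<phi> \<in> emb ` R" for \<phi> using hom that by blast
    show "1 \<le> (\<Prod>\<phi>\<in>emb ` R. \<bar>\<phi> x\<bar>)" if "x \<in> E" "algebraic_int x" "x \<noteq> 0" for x
      using norm[OF that] by (simp add: prod.reindex[OF inj])
    fix K B assume KB: "K \<subseteq> E" "real_subfield K" "finite B" "B \<subseteq> K" "Q_indep B"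
    have "{\<phi> \<in> emb ` R. \<forall>x\<in>K. \<phi> x = x} = emb ` {r\<in>R. \<forall>x\<in>K. emb r x = x}" by auto
    moreover have "inj_on emb {r\<in>R. \<forall>x\<in>K. emb r x = x}" using inj by (rule inj_on_subset) auto
    ultimately show "card B * card {\<phi> \<in> emb ` R. \<forall>x\<in>K. \<phi> x = x} \<le> card (emb ` R)"
      using count[OF KB] by (simp add: card_image inj)
  qed
qed

section \<open>V-arithmetic matrices\<close>

lemma real_embeddingD:
  assumes E: "real_subfield E" and \<phi>: "real_embedding E \<phi>"
  shows "\<phi> 0 = 0" "\<phi> 1 = 1" "x \<in> E \<Longrightarrow> y \<in> E \<Longrightarrow> \<phi> (x + y) = \<phi> x + \<phi> y"
    "x \<in> E \<Longrightarrow> y \<in> E \<Longrightarrow> \<phi> (x * y) = \<phi> x * \<phi> y" "x \<in> E \<Longrightarrow> \<phi> (- x) = - \<phi> x"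
    "x \<in> E \<Longrightarrow> y \<in> E \<Longrightarrow> \<phi> (x - y) = \<phi> x - \<phi> y" "x \<in> E \<Longrightarrow> \<phi> (x ^ n) = \<phi> x ^ n"
    "x \<in> E \<Longrightarrow> \<phi> x = 0 \<longleftrightarrow> x = 0" "\<phi> (numeral k) = numeral k"
proof -
  note S = real_subfieldD[OF E]
  have add: "\<phi> (x + y) = \<phi> x + \<phi> y" if "x \<in> E" "y \<in> E" for x y
    using \<phi> that by (simp add: real_embedding_def)
  have mult: "\<phi> (x * y) = \<phi> x * \<phi> y" if "x \<in> E" "y \<in> E" for x y
    using \<phi> that by (simp add: real_embedding_def)
  show 0: "\<phi> 0 = 0" using add[OF S(1) S(1)] by simp
  show 1: "\<phi> 1 = 1" using \<phi> by (simp add: real_embedding_def)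
  show "x \<in> E \<Longrightarrow> y \<in> E \<Longrightarrow> \<phi> (x + y) = \<phi> x + \<phi> y" "x \<in> E \<Longrightarrow> y \<in> E \<Longrightarrow> \<phi> (x * y) = \<phi> x * \<phi> y"
    by (fact add mult)+
  have neg: "\<phi> (- x) = - \<phi> x" if "x \<in> E" for x using add[OF that S(7)[OF that]] 0 by simp
  then show "x \<in> E \<Longrightarrow> \<phi> (- x) = - \<phi> x" .
  show "x \<in> E \<Longrightarrow> y \<in> E \<Longrightarrow> \<phi> (x - y) = \<phi> x - \<phi> y" using add[of x "- y"] neg[of y] S(7)[of y] by simp
  show "x \<in> E \<Longrightarrow> \<phi> (x ^ n) = \<phi> x ^ n" by (induction n) (auto simp: 1 mult S)
  show "x \<in> E \<Longrightarrow> \<phi> x = 0 \<longleftrightarrow> x = 0"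
    using mult[of x "inverse x"] S(6)[of x] 0 1 by (cases "x = 0") auto
  have nat: "\<phi> (real n) = real n" for n
    using real_subfield_of_int[OF E, of "int _"] by (induction n) (auto simp: 0 1 add S)
  show "\<phi> (numeral k) = numeral k" using nat[of "numeral k"] by simp
qed

section \<open>Determinant inequalities from negative definiteness\<close>

lemma neg_definite_subset:
  assumes "neg_definite N b T" "S \<subseteq> T" "finite T"
  shows "neg_definite N b S"
  unfolding neg_definite_def
proof (intro allI impI)
  fix x :: "nat \<Rightarrow> real" assume x: "\<exists>i\<in>S. x i \<noteq> 0"
  define y where "y i = (if i \<in> S then x i else 0)" for i
  have "\<exists>i\<in>T. y i \<noteq> 0" using x assms(2) by (auto simp: y_def)
  then have "(\<Sum>i\<in>T. \<Sum>j\<in>T. y i * b i j * y j) < 0"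
    using assms(1)[unfolded neg_definite_def, THEN spec, of y] by simp
  also have "(\<Sum>i\<in>T. \<Sum>j\<in>T. y i * b i j * y j) = (\<Sum>i\<in>S. \<Sum>j\<in>T. y i * b i j * y j)"
    using assms by (intro sum.mono_neutral_right) (auto simp: y_def)
  also have "\<dots> = (\<Sum>i\<in>S. \<Sum>j\<in>S. x i * b i j * x j)"
    using assms by (intro sum.cong refl sum.mono_neutral_cong_right) (auto simp: y_def)
  finally show "(\<Sum>i\<in>S. \<Sum>j\<in>S. x i * b i j * x j) < 0" .
qed

text \<open>Stated for an arbitrary function on a vertex set, so as to serve both the given matrix
  and its conjugates under embeddings.\<close>

definition gram_like :: "(nat \<Rightarrow> nat \<Rightarrow> real) \<Rightarrow> nat set \<Rightarrow> bool" where
  "gram_like b S \<longleftrightarrow> (\<forall>i\<in>S. b i i = -2) \<and> (\<forall>i\<in>S. \<forall>j\<in>S. b i j = b j i)"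

lemma gram_like_subset:
  assumes "gram_like b T" "S \<subseteq> T" shows "gram_like b S"
  unfolding gram_like_def
proof (intro conjI ballI)
  fix i assume "i \<in> S"
  then show "b i i = -2" using assms unfolding gram_like_def by blast
next
  fix i j assume "i \<in> S" "j \<in> S"
  then have "i \<in> T" "j \<in> T" using assms(2) by auto
  then show "b i j = b j i" using assms(1)[unfolded gram_like_def, THEN conjunct2] by simp
qed

lemma gram_like_at:
  "gram_like b S \<Longrightarrow> i \<in> S \<Longrightarrow> b i i = -2" "gram_like b S \<Longrightarrow> i \<in> S \<Longrightarrow> j \<in> S \<Longrightarrow> b i j = b j i"
  unfolding gram_like_def by blast+

text \<open>Half the form evaluated at the vector (x, y, z, w). The determinant inequalities for
  four vertices come from inserting a suitable vector here, usually a multiple of a column of the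
  adjugate.\<close>

lemma neg4:
  assumes n: "neg_definite N b {i, j, k, l}" and g: "gram_like b {i, j, k, l}" and d: "distinct [i, j, k, l]"
    and nz: "x \<noteq> 0 \<or> y \<noteq> 0 \<or> z \<noteq> 0 \<or> w \<noteq> 0"
  shows "b i j * x * y + b i k * x * z + b i l * x * w + b j k * y * z + b j l * y * w + b k l * z * w
    < x ^ 2 + y ^ 2 + z ^ 2 + w ^ 2"
proof -
  define v where "v m = (if m = i then x else if m = j then y else if m = k then z else w)" for m
  have v: "v i = x" "v j = y" "v k = z" "v l = w" using d by (auto simp: v_def)
  then have "\<exists>m\<in>{i, j, k, l}. v m \<noteq> 0" using nz by auto
  then have "(\<Sum>m\<in>{i, j, k, l}. \<Sum>n\<in>{i, j, k, l}. v m * b m n * v n) < 0"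
    using n unfolding neg_definite_def by blast
  also have "(\<Sum>m\<in>{i, j, k, l}. \<Sum>n\<in>{i, j, k, l}. v m * b m n * v n) =
    x * b i i * x + x * b i j * y + x * b i k * z + x * b i l * w + (y * b j i * x + y * b j j * y + y * b j k * z + y * b j l * w)
    + (z * b k i * x + z * b k j * y + z * b k k * z + z * b k l * w) + (w * b l i * x + w * b l j * y + w * b l k * z + w * b l l * w)"
    using d by (simp add: v)
  finally show ?thesis
    unfolding gram_like_at(1)[OF g, of i, simplified] gram_like_at(1)[OF g, of j, simplified]
      gram_like_at(1)[OF g, of k, simplified] gram_like_at(1)[OF g, of l, simplified]
      gram_like_at(2)[OF g, of j i, simplified] gram_like_at(2)[OF g, of k i, simplified]
      gram_like_at(2)[OF g, of l i, simplified] gram_like_at(2)[OF g, of k j, simplified]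
      gram_like_at(2)[OF g, of l j, simplified] gram_like_at(2)[OF g, of l k, simplified]
    by (simp add: power2_eq_square algebra_simps)
qed

lemma neg3:
  assumes n: "neg_definite N b {i, j, k}" and g: "gram_like b {i, j, k}" and d: "distinct [i, j, k]"
    and nz: "x \<noteq> 0 \<or> y \<noteq> 0 \<or> z \<noteq> 0"
  shows "b i j * x * y + b i k * x * z + b j k * y * z < x ^ 2 + y ^ 2 + z ^ 2"
proof -
  define v where "v m = (if m = i then x else if m = j then y else z)" for m
  have v: "v i = x" "v j = y" "v k = z" using d by (auto simp: v_def)
  then have "\<exists>m\<in>{i, j, k}. v m \<noteq> 0" using nz by auto
  then have "(\<Sum>m\<in>{i, j, k}. \<Sum>n\<in>{i, j, k}. v m * b m n * v n) < 0"
    using n unfolding neg_definite_def by blast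
  also have "(\<Sum>m\<in>{i, j, k}. \<Sum>n\<in>{i, j, k}. v m * b m n * v n) =
    x * b i i * x + x * b i j * y + x * b i k * z + (y * b j i * x + y * b j j * y + y * b j k * z)
    + (z * b k i * x + z * b k j * y + z * b k k * z)"
    using d by (simp add: v)
  finally show ?thesis
    unfolding gram_like_at(1)[OF g, of i, simplified] gram_like_at(1)[OF g, of j, simplified]
      gram_like_at(1)[OF g, of k, simplified] gram_like_at(2)[OF g, of j i, simplified]
      gram_like_at(2)[OF g, of k i, simplified] gram_like_at(2)[OF g, of k j, simplified]
    by (simp add: power2_eq_square algebra_simps)
qed

lemma neg2:
  assumes n: "neg_definite N b {i, j}" and g: "gram_like b {i, j}" and d: "i \<noteq> j"
  shows "(b i j) ^ 2 < 4"
proof -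
  define p where "p = b i j"
  define v where "v m = (if m = i then 1 else p / 2)" for m
  have v: "v i = 1" "v j = p / 2" using d by (auto simp: v_def)
  then have "\<exists>m\<in>{i, j}. v m \<noteq> 0" by auto
  then have "(\<Sum>m\<in>{i, j}. \<Sum>n\<in>{i, j}. v m * b m n * v n) < 0"
    using n unfolding neg_definite_def by blast
  moreover have "b i i = -2" "b j j = -2" "b j i = p" "b i j = p"
    using gram_like_at(1)[OF g, of i] gram_like_at(1)[OF g, of j] gram_like_at(2)[OF g, of j i] by (simp_all add: p_def)
  ultimately show ?thesis using d v by (simp add: power2_eq_square)
qed

text \<open>The test vector (2x + pq, 2q + px, 4 - p^2) is the last column of the adjugate, so the
  form there is the determinant times the positive minor 4 - p^2.\<close>

lemma neg3_det:
  assumes n: "neg_definite N b {i, j, k}" and g: "gram_like b {i, j, k}" and d: "distinct [i, j, k]"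
  shows "(b i j)^2 + (b j k)^2 + (b i k)^2 + b i j * b j k * b i k < 4"
proof -
  define p q x where "p = b i j" and "q = b j k" and "x = b i k"
  have "neg_definite N b {i, j}" by (rule neg_definite_subset[OF n]) auto
  moreover have "gram_like b {i, j}" by (rule gram_like_subset[OF g]) simp
  ultimately have "p ^ 2 < 4" using neg2[of N b i j] d by (simp add: p_def)
  then have pos: "4 - p ^ 2 > 0" by simp
  have "p * (2 * x + p * q) * (2 * q + p * x) + x * (2 * x + p * q) * (4 - p ^ 2) + q * (2 * q + p * x) * (4 - p ^ 2)
      < (2 * x + p * q) ^ 2 + (2 * q + p * x) ^ 2 + (4 - p ^ 2) ^ 2"
    using neg3[OF n g d, of "2 * x + p * q" "2 * q + p * x" "4 - p ^ 2"] pos by (simp add: p_def q_def x_def)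
  moreover have "(2 * x + p * q) ^ 2 + (2 * q + p * x) ^ 2 + (4 - p ^ 2) ^ 2
      - (p * (2 * x + p * q) * (2 * q + p * x) + x * (2 * x + p * q) * (4 - p ^ 2) + q * (2 * q + p * x) * (4 - p ^ 2))
      = (4 - p ^ 2) * (4 - (p ^ 2 + q ^ 2 + x ^ 2 + p * q * x))" by (simp add: power2_eq_square algebra_simps)
  ultimately have "0 < (4 - p ^ 2) * (4 - (p ^ 2 + q ^ 2 + x ^ 2 + p * q * x))" by linarith
  then show ?thesis using pos by (simp add: zero_less_mult_iff p_def q_def x_def)
qed

section \<open>The ground field, its integers and the norm argument\<close>

locale v_arithmetic =
  fixes N :: nat and a :: "nat \<Rightarrow> nat \<Rightarrow> real"
  assumes V: "V_arithmetic N a"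
begin

definition E where "E = gen_field (entries N a)"
definition K where "K = ground_field N a"

definition nontriv :: "(real \<Rightarrow> real) \<Rightarrow> bool" where
  "nontriv \<phi> \<longleftrightarrow> real_embedding E \<phi> \<and> (\<exists>x\<in>K. \<phi> x \<noteq> x)"

text \<open>The ring of integers of the ground field, from which every auxiliary element is
  taken.\<close>

definition OK :: "real set" where "OK = {x\<in>K. algebraic_int x}"

lemma E_subfield: "real_subfield E" and K_subfield: "real_subfield K"
  by (simp_all add: E_def K_def ground_field_def gen_field_subfield)

lemma entry_E: "i < N \<Longrightarrow> j < N \<Longrightarrow> a i j \<in> E"
  using gen_field_incl[of "entries N a"] by (auto simp: E_def entries_def)

lemma K_sub_E: "K \<subseteq> E"
proof -
  have "cyc_prod a xs \<in> E" if "xs \<noteq> []" "set xs \<subseteq> {0..<N}" for xs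
    unfolding cyc_prod_def
  proof (rule real_subfield_prod[OF E_subfield])
    fix j assume "j \<in> {..<length xs}"
    then have "xs ! j \<in> set xs" "xs ! ((j + 1) mod length xs) \<in> set xs"
      using that(1) by (auto intro!: nth_mem)
    then show "a (xs ! j) (xs ! ((j + 1) mod length xs)) \<in> E" using that(2) by (auto intro!: entry_E)
  qed
  then show ?thesis unfolding K_def ground_field_def
    by (intro gen_field_least[OF E_subfield]) (auto simp: cyclic_products_def)
qed

lemma cyc_OK:
  assumes "xs \<noteq> []" "set xs \<subseteq> {0..<N}" shows "cyc_prod a xs \<in> OK"
proof -
  have "cyc_prod a xs \<in> cyclic_products N a" using assms by (auto simp: cyclic_products_def)
  then show ?thesis using V gen_field_incl[of "cyclic_products N a"]
    by (auto simp: OK_def K_def ground_field_def V_arithmetic_def algebraic_integer_iff)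
qed

lemma fund: "fundamental_matrix N a"
  using V by (simp add: V_arithmetic_def hyperbolic_fundamental_def)

lemma symm: "i < N \<Longrightarrow> j < N \<Longrightarrow> a i j = a j i"
  using fund[unfolded fundamental_matrix_def, THEN conjunct1] by simp

lemma diag: "i < N \<Longrightarrow> a i i = -2"
  using fund[unfolded fundamental_matrix_def, THEN conjunct2, THEN conjunct1] by simp

lemma gram_like: assumes "S \<subseteq> {0..<N}" shows "gram_like a S"
  unfolding gram_like_def
proof (intro conjI ballI)
  fix i j assume "i \<in> S" "j \<in> S"
  then show "a i j = a j i" using assms by (intro symm) auto
qed (use assms diag in auto)

lemma OK_intros:
  "x \<in> OK \<Longrightarrow> y \<in> OK \<Longrightarrow> x + y \<in> OK" "x \<in> OK \<Longrightarrow> y \<in> OK \<Longrightarrow> x - y \<in> OK"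
  "x \<in> OK \<Longrightarrow> y \<in> OK \<Longrightarrow> x * y \<in> OK" "x \<in> OK \<Longrightarrow> x ^ n \<in> OK" "1 \<in> OK" "numeral k \<in> OK" "x \<in> OK \<Longrightarrow> - x \<in> OK"
  using real_subfieldD(3-5)[OF K_subfield, of x y] real_subfieldD(2)[OF K_subfield] real_subfieldD(7)[OF K_subfield, of x] real_subfieldD(9)[OF K_subfield, of x n] real_subfield_of_int[OF K_subfield, of "numeral k"]
  by (simp_all add: OK_def algebraic_int_add_mult algebraic_int_diff algebraic_int_power int_imp_algebraic_int)

lemma OK_square: assumes "i < N" "j < N" shows "(a i j)^2 \<in> OK"
proof -
  have "cyc_prod a [i, j] = a i j * a j i" by (simp add: cyc_prod_def lessThan_Suc mult.commute)
  then show ?thesis using cyc_OK[of "[i, j]"] assms symm[OF assms(2,1)] by (simp add: power2_eq_square)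
qed

lemma OK_triangle: assumes "i < N" "j < N" "k < N" shows "a i j * a j k * a i k \<in> OK"
proof -
  have "cyc_prod a [i, j, k] = a i j * a j k * a k i" by (simp add: cyc_prod_def lessThan_Suc mult_ac)
  then show ?thesis using cyc_OK[of "[i, j, k]"] assms symm[OF assms(3,1)] by simp
qed

lemma OK_quadrangle: assumes "i < N" "j < N" "k < N" "l < N" shows "a i j * a j k * a k l * a i l \<in> OK"
proof -
  have "cyc_prod a [i, j, k, l] = a i j * a j k * a k l * a l i" by (simp add: cyc_prod_def lessThan_Suc mult_ac)
  then show ?thesis using cyc_OK[of "[i, j, k, l]"] assms symm[OF assms(4,1)] by simp
qed

lemma nontriv_hom:
  assumes "nontriv \<phi>" shows "real_embedding E \<phi>"
  using assms by (simp add: nontriv_def)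

lemmas nontriv_simps = real_embeddingD[OF E_subfield nontriv_hom]

lemma nontriv_neg:
  assumes "nontriv \<phi>" shows "neg_definite N (\<lambda>i j. \<phi> (a i j)) {0..<N}"
  using V[unfolded V_arithmetic_def, THEN conjunct2, THEN conjunct2, THEN conjunct2] assms
  unfolding nontriv_def E_def K_def by blast

lemma nontriv_gram:
  assumes "nontriv \<phi>" "S \<subseteq> {0..<N}" shows "gram_like (\<lambda>i j. \<phi> (a i j)) S"
proof -
  have "\<phi> (- 2) = - \<phi> 2" using nontriv_simps(5)[OF assms(1)] real_subfield_of_int[OF E_subfield, of 2] by simp
  then have "\<phi> (- 2) = - 2" using nontriv_simps(9)[OF assms(1)] by simp
  then show ?thesis using gram_like_at[OF gram_like[OF assms(2)]] unfolding gram_like_def by metis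
qed

lemma nontriv_neg_sub:
  assumes "nontriv \<phi>" "S \<subseteq> {0..<N}" shows "neg_definite N (\<lambda>i j. \<phi> (a i j)) S"
  by (rule neg_definite_subset[OF nontriv_neg[OF assms(1)] assms(2)]) simp

lemma embeddings:
  obtains \<Phi> where "finite \<Phi>" "\<exists>\<phi>\<in>\<Phi>. \<forall>x\<in>K. \<phi> x = x" "\<And>\<phi>. \<phi> \<in> \<Phi> \<Longrightarrow> real_embedding E \<phi>"
    "\<And>x. x \<in> E \<Longrightarrow> algebraic_int x \<Longrightarrow> x \<noteq> 0 \<Longrightarrow> 1 \<le> (\<Prod>\<phi>\<in>\<Phi>. \<bar>\<phi> x\<bar>)"
    "\<And>B. finite B \<Longrightarrow> B \<subseteq> K \<Longrightarrow> Q_indep B \<Longrightarrow> card B * card {\<phi>\<in>\<Phi>. \<forall>x\<in>K. \<phi> x = x} \<le> card \<Phi>"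
proof -
  have fin: "finite (entries N a)"
  proof -
    have "entries N a = (\<lambda>(i, j). a i j) ` ({..<N} \<times> {..<N})" by (auto simp: entries_def)
    then show ?thesis by simp
  qed
  have tr: "totally_real_field (gen_field (entries N a))" using V by (simp add: V_arithmetic_def)
  obtain \<Phi> where \<Phi>: "finite \<Phi>" "\<exists>\<phi>\<in>\<Phi>. \<forall>x\<in>E. \<phi> x = x" "\<And>\<phi>. \<phi> \<in> \<Phi> \<Longrightarrow> real_embedding E \<phi>"
    "\<And>x. x \<in> E \<Longrightarrow> algebraic_int x \<Longrightarrow> x \<noteq> 0 \<Longrightarrow> 1 \<le> (\<Prod>\<phi>\<in>\<Phi>. \<bar>\<phi> x\<bar>)"
    "\<And>K B. K \<subseteq> E \<Longrightarrow> real_subfield K \<Longrightarrow> finite B \<Longrightarrow> B \<subseteq> K \<Longrightarrow> Q_indep B \<Longrightarrow>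
       card B * card {\<phi>\<in>\<Phi>. \<forall>x\<in>K. \<phi> x = x} \<le> card \<Phi>"
    by (rule field_embeddings[OF fin tr E_def]) (rule that)
  show thesis
  proof (rule that[OF \<Phi>(1) _ \<Phi>(3) \<Phi>(4) \<Phi>(5)[OF K_sub_E K_subfield]])
    show "\<exists>\<phi>\<in>\<Phi>. \<forall>x\<in>K. \<phi> x = x" using \<Phi>(2) K_sub_E by blast
  qed
qed

text \<open>The trivial embeddings contribute at most \<open>M\<close> each to the norm of \<open>x\<close>, the others at most \<open>\<rho>\<close>;
  the norm is at least one, so the former cannot be too rare.\<close>

lemma degree_bound:
  assumes x: "x \<in> OK" "x \<noteq> 0" "\<bar>x\<bar> \<le> M" and \<phi>: "\<And>\<phi>. nontriv \<phi> \<Longrightarrow> \<bar>\<phi> x\<bar> \<le> \<rho>"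
    and \<rho>: "0 < \<rho>" "\<rho> \<le> 1" "M * \<rho> ^ n < 1"
  shows "field_degree K \<le> enat n"
  unfolding field_degree_def
proof (rule Sup_least, safe)
  fix B assume B: "finite B" "B \<subseteq> K" "Q_indep B"
  obtain \<Phi> where \<Phi>: "finite \<Phi>" "\<exists>\<phi>\<in>\<Phi>. \<forall>x\<in>K. \<phi> x = x" "\<And>\<phi>. \<phi> \<in> \<Phi> \<Longrightarrow> real_embedding E \<phi>"
    "\<And>x. x \<in> E \<Longrightarrow> algebraic_int x \<Longrightarrow> x \<noteq> 0 \<Longrightarrow> 1 \<le> (\<Prod>\<phi>\<in>\<Phi>. \<bar>\<phi> x\<bar>)"
    "\<And>B. finite B \<Longrightarrow> B \<subseteq> K \<Longrightarrow> Q_indep B \<Longrightarrow> card B * card {\<phi>\<in>\<Phi>. \<forall>x\<in>K. \<phi> x = x} \<le> card \<Phi>"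
    by (rule embeddings) (rule that)
  define T where "T = {\<phi>\<in>\<Phi>. \<forall>x\<in>K. \<phi> x = x}"
  have T: "finite T" "T \<subseteq> \<Phi>" using \<Phi>(1) by (simp_all add: T_def)
  have e: "card T > 0" using \<Phi>(1,2) by (auto simp: T_def card_gt_0_iff)
  have xE: "x \<in> E" "x \<in> K" "algebraic_int x" using x(1) K_sub_E unfolding OK_def by blast+
  have M0: "0 < M" using x(2,3) by linarith
  have "1 \<le> (\<Prod>\<phi>\<in>\<Phi>. \<bar>\<phi> x\<bar>)" by (rule \<Phi>(4)[OF xE(1,3) x(2)])
  also have "\<dots> = (\<Prod>\<phi>\<in>\<Phi> - T. \<bar>\<phi> x\<bar>) * (\<Prod>\<phi>\<in>T. \<bar>\<phi> x\<bar>)" by (rule prod.subset_diff[OF T(2) \<Phi>(1)])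
  also have "\<dots> \<le> (\<Prod>\<phi>\<in>\<Phi> - T. \<rho>) * (\<Prod>\<phi>\<in>T. M)"
  proof (intro mult_mono prod_mono prod_nonneg conjI)
    fix \<psi> assume "\<psi> \<in> \<Phi> - T"
    then show "\<bar>\<psi> x\<bar> \<le> \<rho>" using \<Phi>(3) by (intro \<phi>) (auto simp: T_def nontriv_def)
  next
    fix \<psi> assume "\<psi> \<in> T"
    then show "\<bar>\<psi> x\<bar> \<le> M" using x(3) xE(2) by (simp add: T_def)
  qed (use \<rho>(1) in simp_all)
  also have "\<dots> = \<rho> ^ (card \<Phi> - card T) * M ^ card T" using T by (simp add: card_Diff_subset)
  finally have 1: "1 \<le> \<rho> ^ (card \<Phi> - card T) * M ^ card T" .
  show "enat (card B) \<le> enat n"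
  proof (rule ccontr)
    assume "\<not> enat (card B) \<le> enat n"
    then have "Suc n \<le> card B" by simp
    \<comment> \<open>More than \<open>n\<close> independent elements give at least \<open>n\<close>
      nontrivial embeddings for each trivial one, so the norm is at most (M \<rho>^n)^|T|, which is
      less than 1.\<close>
    then have "Suc n * card T \<le> card B * card T" by (rule mult_le_mono1)
    also have "\<dots> \<le> card \<Phi>" using \<Phi>(5)[OF B] by (simp add: T_def)
    finally have "n * card T \<le> card \<Phi> - card T" by simp
    then have "\<rho> ^ (card \<Phi> - card T) \<le> \<rho> ^ (n * card T)" using \<rho> by (intro power_decreasing) auto
    then have "\<rho> ^ (card \<Phi> - card T) * M ^ card T \<le> (M * \<rho> ^ n) ^ card T"
      using M0 by (simp add: power_mult power_mult_distrib mult.commute)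
    also have "\<dots> < 1" using \<rho> M0 e by (intro power_less_one_iff[THEN iffD2]) auto
    finally show False using 1 by simp
  qed
qed

end

section \<open>Auxiliary functions\<close>

text \<open>The maxima of the auxiliary functions are certified by \<open>t \<le> exp (t - 1)\<close>, applied to each factor
  rescaled by its (approximate) value at the maximum.\<close>

lemma tangent_power: "0 \<le> m * l \<Longrightarrow> (m * l) ^ e \<le> exp (real e * (m * l - 1))" for m l :: real
proof -
  assume "0 \<le> m * l"
  moreover have "m * l \<le> exp (m * l - 1)" using exp_ge_add_one_self[of "m * l - 1"] by simp
  ultimately have "(m * l) ^ e \<le> exp (m * l - 1) ^ e" by (intro power_mono) auto
  then show ?thesis by (simp add: exp_of_nat_mult)
qed

text \<open>For factors affine in one variable, the hypothesis \<open>s\<close> is a linear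
  inequality. With each multiplier close to the reciprocal of its factor at the maximum, its slope
  is the logarithmic derivative there, hence nearly 0, and \<open>C\<close> may be taken close to
  the reciprocal of the product of the multipliers.\<close>

lemma tangent_bound6:
  fixes l1 l2 l3 l4 l5 l6 m1 m2 m3 m4 m5 m6 C :: real
  assumes l: "0 \<le> l1" "0 \<le> l2" "0 \<le> l3" "0 \<le> l4" "0 \<le> l5" "0 \<le> l6"
    and m: "0 < m1" "0 < m2" "0 < m3" "0 < m4" "0 < m5" "0 < m6"
    and s: "real e1 * (m1 * l1 - 1) + real e2 * (m2 * l2 - 1) + real e3 * (m3 * l3 - 1) + real e4 * (m4 * l4 - 1)
      + real e5 * (m5 * l5 - 1) + real e6 * (m6 * l6 - 1) \<le> 0"
    and C: "1 \<le> C * (m1 ^ e1 * m2 ^ e2 * m3 ^ e3 * m4 ^ e4 * m5 ^ e5 * m6 ^ e6)"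
  shows "l1 ^ e1 * l2 ^ e2 * l3 ^ e3 * l4 ^ e4 * l5 ^ e5 * l6 ^ e6 \<le> C"
proof -
  let ?m = "m1 ^ e1 * m2 ^ e2 * m3 ^ e3 * m4 ^ e4 * m5 ^ e5 * m6 ^ e6"
  let ?l = "l1 ^ e1 * l2 ^ e2 * l3 ^ e3 * l4 ^ e4 * l5 ^ e5 * l6 ^ e6"
  have "?m * ?l = (m1 * l1) ^ e1 * (m2 * l2) ^ e2 * (m3 * l3) ^ e3 * (m4 * l4) ^ e4 * (m5 * l5) ^ e5 * (m6 * l6) ^ e6"
    by (simp add: power_mult_distrib)
  also have "\<dots> \<le> exp (real e1 * (m1 * l1 - 1)) * exp (real e2 * (m2 * l2 - 1)) * exp (real e3 * (m3 * l3 - 1))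
      * exp (real e4 * (m4 * l4 - 1)) * exp (real e5 * (m5 * l5 - 1)) * exp (real e6 * (m6 * l6 - 1))"
    using l m by (intro mult_mono tangent_power mult_nonneg_nonneg zero_le_power) auto
  also have "\<dots> = exp (real e1 * (m1 * l1 - 1) + real e2 * (m2 * l2 - 1) + real e3 * (m3 * l3 - 1) + real e4 * (m4 * l4 - 1)
      + real e5 * (m5 * l5 - 1) + real e6 * (m6 * l6 - 1))"
    by (simp only: exp_add)
  also have "\<dots> \<le> 1" using s by simp
  finally have 1: "?m * ?l \<le> 1" .
  have mpos: "0 < ?m" using m by simp
  have "?m * ?l \<le> ?m * C" using 1 C by (simp only: mult.commute[of ?m C])
  then show ?thesis using mpos by (rule mult_left_le_imp_le)
qed

lemma tangent_bound4:
  fixes l1 l2 l3 l4 m1 m2 m3 m4 C :: real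
  assumes "0 \<le> l1" "0 \<le> l2" "0 \<le> l3" "0 \<le> l4" "0 < m1" "0 < m2" "0 < m3" "0 < m4"
    "real e1 * (m1 * l1 - 1) + real e2 * (m2 * l2 - 1) + real e3 * (m3 * l3 - 1) + real e4 * (m4 * l4 - 1) \<le> 0"
    "1 \<le> C * (m1 ^ e1 * m2 ^ e2 * m3 ^ e3 * m4 ^ e4)"
  shows "l1 ^ e1 * l2 ^ e2 * l3 ^ e3 * l4 ^ e4 \<le> C"
  using tangent_bound6[of l1 l2 l3 l4 0 0 m1 m2 m3 m4 1 1 e1 e2 e3 e4 0 0 C] assms by simp

lemma tangent_bound3:
  fixes l1 l2 l3 m1 m2 m3 C :: real
  assumes "0 \<le> l1" "0 \<le> l2" "0 \<le> l3" "0 < m1" "0 < m2" "0 < m3"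
    "real e1 * (m1 * l1 - 1) + real e2 * (m2 * l2 - 1) + real e3 * (m3 * l3 - 1) \<le> 0"
    "1 \<le> C * (m1 ^ e1 * m2 ^ e2 * m3 ^ e3)"
  shows "l1 ^ e1 * l2 ^ e2 * l3 ^ e3 \<le> C"
  using tangent_bound6[of l1 l2 l3 0 0 0 m1 m2 m3 1 1 1 e1 e2 e3 0 0 0 C] assms by simp

text \<open>The value 4/27 is reached both at the interior maximum 1/3 and at the right end 4/3;
  this is what singles out the interval.\<close>

lemma aux_4_3:
  fixes p :: real assumes "0 < p" "p < 4/3" shows "\<bar>p * (1 - p) ^ 2\<bar> \<le> 4/27"
proof -
  have "0 \<le> (4/3 - p) * (p - 1/3) ^ 2" using assms by (intro mult_nonneg_nonneg) auto
  also have "\<dots> = 4/27 - p * (1 - p) ^ 2" by (simp add: power2_eq_square algebra_simps)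
  finally show ?thesis using assms by (simp add: abs_mult)
qed


text \<open>The zeros 0, 1, 2 and (3 \<plusminus> sqrt 5)/2 are squares of numbers 2 cos (k pi/m)
  with m at most 5, together with their conjugates, and all lie below 8/3.\<close>

lemma aux_8_3:
  fixes w :: real assumes w: "0 < w" "w < 8/3"
  shows "\<bar>w * (w - 1) * (w - 2) ^ 2 * (w ^ 2 - 3 * w + 1)\<bar> \<le> 7/25"
proof -
  define q where "q = w ^ 2 - 3 * w + 1"
  have X: "\<bar>w * (w - 1) * (w - 2) ^ 2 * (w ^ 2 - 3 * w + 1)\<bar> = w * \<bar>w - 1\<bar> * \<bar>w - 2\<bar> ^ 2 * \<bar>q\<bar>" using w by (simp add: abs_mult q_def)
  have mono: ?thesis if "\<bar>q\<bar> \<le> t" "w * \<bar>w - 1\<bar> * \<bar>w - 2\<bar> ^ 2 * t \<le> 7/25" for t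
  proof -
    have "w * \<bar>w - 1\<bar> * \<bar>w - 2\<bar> ^ 2 * \<bar>q\<bar> \<le> w * \<bar>w - 1\<bar> * \<bar>w - 2\<bar> ^ 2 * t" using that w by (intro mult_left_mono) auto
    then show ?thesis unfolding X using that by linarith
  qed
  \<comment> \<open>191/500 and 1309/500 approximate the roots of \<open>q\<close>; their sum is
    exactly 3, so only the constant term is off.\<close>
  have e: "(w - 191/500) * (1309/500 - w) = - q - 19/250000" by (simp add: q_def power2_eq_square field_simps)
  \<comment> \<open>Between its roots -q is concave and lies below its tangent at \<open>v\<close>.
    Each use takes \<open>v\<close> near the maximum of the whole product, which turns the quadratic
    factor into an affine one.\<close>
  have qneg: "\<bar>q\<bar> \<le> (3 - 2 * v) * w + v * v - 1" if "191/500 \<le> w" "w \<le> 1309/500" for v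
  proof -
    have "0 \<le> (w - 191/500) * (1309/500 - w)" using that by simp
    then have "q \<le> 0" using e by linarith
    moreover have "0 \<le> (w - v) ^ 2" by simp
    then have "- q \<le> (3 - 2 * v) * w + v * v - 1" by (simp add: q_def power2_eq_square algebra_simps)
    ultimately show ?thesis by linarith
  qed
  consider "w \<le> 191/500" | "191/500 \<le> w" "w \<le> 1" | "1 \<le> w" "w \<le> 2" | "2 \<le> w" "w \<le> 1309/500" | "1309/500 \<le> w"
    by linarith
  then show ?thesis
  proof cases
    case 1
    \<comment> \<open>Here \<open>q\<close> is convex and lies below its chord. The surplus 1/1000
      covers the sliver between the true root and 191/500, where \<open>q\<close> is slightly
      negative.\<close>
    have "0 \<le> w * (191/500 - w)" using 1 w by simp
    moreover have "q = 1 - 1309/500 * w - w * (191/500 - w)" by (simp add: q_def power2_eq_square field_simps)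
    moreover have "(w - 191/500) * (1309/500 - w) \<le> 0" using 1 w by (intro mult_nonpos_nonneg) auto
    ultimately have t: "\<bar>q\<bar> \<le> 1001/1000 - 1309/500 * w" using e 1 by linarith
    \<comment> \<open>The multipliers are rounded reciprocals of the four factors at the maximum,
      near w = 0.15; the other cases are set up alike.\<close>
    have "w ^ 1 * (1 - w) ^ 1 * (2 - w) ^ 2 * (1001/1000 - 1309/500 * w) ^ 1 \<le> 7/25"
      by (rule tangent_bound4[of _ _ _ _ "659/100" "59/50" "27/50" "33/20"], (use 1 w in linarith)+, use 1 w in \<open>simp add: field_simps\<close>, simp add: power_divide)
    moreover have "\<bar>w - 1\<bar> = 1 - w" "\<bar>w - 2\<bar> = 2 - w" using 1 w by auto
    ultimately show ?thesis using mono[OF t] by simp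
  next
    case 2
    have "191/500 \<le> w" "w \<le> 1309/500" using 2 by linarith+
    from qneg[OF this, of "2/3"] have t: "\<bar>q\<bar> \<le> 5/3 * w - 5/9" by simp
    have "w ^ 1 * (1 - w) ^ 1 * (2 - w) ^ 2 * (5/3 * w - 5/9) ^ 1 \<le> 7/25"
      by (rule tangent_bound4[of _ _ _ _ "3/2" "3" "3/4" "9/5"], (use 2 w in linarith)+, use 2 w in \<open>simp add: field_simps\<close>, simp add: power_divide)
    moreover have "\<bar>w - 1\<bar> = 1 - w" "\<bar>w - 2\<bar> = 2 - w" using 2 w by auto
    ultimately show ?thesis using mono[OF t] by simp
  next
    case 3
    have "191/500 \<le> w" "w \<le> 1309/500" using 3 by linarith+
    from qneg[OF this, of "7/5"] have t: "\<bar>q\<bar> \<le> 24/25 + 1/5 * w" by simp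
    have "w ^ 1 * (w - 1) ^ 1 * (2 - w) ^ 2 * (24/25 + 1/5 * w) ^ 1 \<le> 7/25"
      by (rule tangent_bound4[of _ _ _ _ "71/100" "62/25" "167/100" "4/5"], (use 3 w in linarith)+, use 3 w in \<open>simp add: field_simps\<close>, simp add: power_divide)
    moreover have "\<bar>w - 1\<bar> = w - 1" "\<bar>w - 2\<bar> = 2 - w" using 3 w by auto
    ultimately show ?thesis using mono[OF t] by simp
  next
    case 4
    have "191/500 \<le> w" "w \<le> 1309/500" using 4 by linarith+
    from qneg[OF this, of "49/20"] have t: "\<bar>q\<bar> \<le> 2001/400 - 19/10 * w" by simp
    have "w ^ 1 * (w - 1) ^ 1 * (w - 2) ^ 2 * (2001/400 - 19/10 * w) ^ 1 \<le> 7/25"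
      by (rule tangent_bound4[of _ _ _ _ "41/100" "69/100" "11/5" "29/10"], (use 4 w in linarith)+, use 4 w in \<open>simp add: field_simps\<close>, simp add: power_divide)
    moreover have "\<bar>w - 1\<bar> = w - 1" "\<bar>w - 2\<bar> = w - 2" using 4 w by auto
    ultimately show ?thesis using mono[OF t] by simp
  next
    case 5
    have "(w - 1309/500) * (w - 191/500) \<le> (1/20) * (23/10)" using 5 w by (intro mult_mono) auto
    moreover have "0 \<le> (w - 1309/500) * (w - 191/500)" using 5 by simp
    moreover have "(w - 1309/500) * (w - 191/500) = q + 19/250000" by (simp add: q_def power2_eq_square field_simps)
    ultimately have t: "\<bar>q\<bar> \<le> 3/25" by linarith
    have "w * \<bar>w - 1\<bar> * \<bar>w - 2\<bar> ^ 2 * (3/25) \<le> (8/3) * (5/3) * (2/3) ^ 2 * (3/25)"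
      using 5 w by (intro mult_mono power_mono) auto
    then show ?thesis using mono[OF t] by (simp add: power2_eq_square)
  qed
qed

text \<open>Rational enclosures of (5 \<plusminus> sqrt 5)/2, that is of 4 - r^2 for r = 2 cos
  (pi/5) and for its conjugate.\<close>

lemma golden_interval:
  fixes b :: real assumes "b ^ 2 - 5 * b + 5 = 0"
  shows "1381/1000 \<le> b \<and> b \<le> 1383/1000 \<or> 3617/1000 \<le> b \<and> b \<le> 3619/1000"
proof -
  have e: "(b - 1381/1000) * (b - 3619/1000) = - (2161 / 10^6)" "(b - 1383/1000) * (b - 3617/1000) = 2311 / 10^6"
    using assms by (simp_all add: power2_eq_square algebra_simps)
  show ?thesis
  proof (cases "b < 5/2")
    case True
    have "\<not> b < 1381/1000"
    proof
      assume "b < 1381/1000"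
      then have "0 < (1381/1000 - b) * (3619/1000 - b)" by simp
      then show False using e(1) by (simp add: algebra_simps)
    qed
    moreover have "\<not> 1383/1000 < b"
    proof
      assume "1383/1000 < b"
      then have "0 < (b - 1383/1000) * (3617/1000 - b)" using True by simp
      then show False using e(2) by (simp add: algebra_simps)
    qed
    ultimately show ?thesis by linarith
  next
    case False
    have "\<not> 3619/1000 < b"
    proof
      assume "3619/1000 < b"
      then have "0 < (b - 1381/1000) * (b - 3619/1000)" by simp
      then show False using e(1) by (simp add: algebra_simps)
    qed
    moreover have "\<not> b < 3617/1000"
    proof
      assume "b < 3617/1000"
      then have "0 < (b - 1383/1000) * (3617/1000 - b)" using False by simp
      then show False using e(2) by (simp add: algebra_simps)
    qed
    ultimately show ?thesis by linarith
  qed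
qed

text \<open>3 - b is a unit, about 1.618 or -0.618. The cubic in \<open>x\<close> alone is bounded
  by about 0.105 for the small value of \<open>b\<close> and by about 1.89 for the large one; the
  cube of the unit brings both bounds below 9/20.\<close>

lemma aux_golden:
  fixes x b :: real assumes b: "b ^ 2 - 5 * b + 5 = 0" and x: "0 < x" "x < 4 * b / 5"
  shows "\<bar>x * (x - 1) * (x - b + 1) * (3 - b) ^ 3\<bar> \<le> 9/20"
proof -
  have quad: "s * t \<le> ((s + t) / 2) ^ 2" for s t :: real
    using sum_squares_bound[of s t] by (simp add: power2_eq_square field_simps)
  have X: "\<bar>x * (x - 1) * (x - b + 1) * (3 - b) ^ 3\<bar> = \<bar>x * (x - 1) * (x - b + 1)\<bar> * \<bar>3 - b\<bar> ^ 3"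
    by (simp add: abs_mult power_abs)
  consider "1381/1000 \<le> b" "b \<le> 1383/1000" | "3617/1000 \<le> b" "b \<le> 3619/1000"
    using golden_interval[OF b] by blast
  then show ?thesis
  proof cases
    case 1
    have "\<bar>x * (x - 1) * (x - b + 1)\<bar> \<le> 105/1000"
    proof -
      consider "x \<le> 1/2" | "1/2 \<le> x" "x \<le> 1" | "1 \<le> x" by linarith
      then show ?thesis
      proof cases
        case 11: 1
        have "x * (1 - x) \<le> (1/2) ^ 2" using quad[of x "1 - x"] by simp
        moreover have "\<bar>x - b + 1\<bar> \<le> 383/1000" using 11 1 x by linarith
        ultimately have "(x * (1 - x)) * \<bar>x - b + 1\<bar> \<le> (1/2) ^ 2 * (383/1000)" using 11 x by (intro mult_mono) (linarith | simp)+
        then show ?thesis using 11 x by (simp add: abs_mult power2_eq_square)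
      next
        case 12: 2
        have "(1 - x) * (x - 381/1000) \<le> (619/2000) ^ 2" using quad[of "1 - x" "x - 381/1000"] by simp
        then have "x * ((1 - x) * (x - 381/1000)) \<le> 1 * (619/2000) ^ 2" using 12 by (intro mult_mono) (linarith | simp)+
        moreover have "(1 - x) * \<bar>x - b + 1\<bar> \<le> (1 - x) * (x - 381/1000)" using 12 1 by (intro mult_left_mono) (linarith | simp)+
        then have "x * ((1 - x) * \<bar>x - b + 1\<bar>) \<le> x * ((1 - x) * (x - 381/1000))" by (rule mult_left_mono) (use x in simp)
        ultimately have "x * ((1 - x) * \<bar>x - b + 1\<bar>) \<le> 105/1000" by (simp add: power2_eq_square)
        then show ?thesis using 12 x by (simp add: abs_mult mult.assoc)
      next
        case 13: 3
        have "x * (x - 1) * \<bar>x - b + 1\<bar> \<le> (1107/1000) * (107/1000) * (726/1000)" using 13 1 x by (intro mult_mono) (linarith | simp)+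
        then show ?thesis using 13 x by (simp add: abs_mult)
      qed
    qed
    moreover have "\<bar>3 - b\<bar> ^ 3 \<le> (1619/1000) ^ 3" using 1 by (intro power_mono) auto
    ultimately have "\<bar>x * (x - 1) * (x - b + 1)\<bar> * \<bar>3 - b\<bar> ^ 3 \<le> (105/1000) * (1619/1000) ^ 3" by (intro mult_mono) (linarith | simp)+
    then show ?thesis unfolding X by (simp add: power3_eq_cube)
  next
    case 2
    have "\<bar>x * (x - 1) * (x - b + 1)\<bar> \<le> 189/100"
    proof -
      consider "x \<le> 1" | "1 \<le> x" "x \<le> b - 1" | "b - 1 \<le> x" by linarith
      then show ?thesis
      proof cases
        case 11: 1
        have "x * (1 - x) \<le> (1/2) ^ 2" using quad[of x "1 - x"] by simp
        moreover have "\<bar>x - b + 1\<bar> \<le> 3" using 11 2 x by linarith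
        ultimately have "(x * (1 - x)) * \<bar>x - b + 1\<bar> \<le> (1/2) ^ 2 * 3" using 11 x by (intro mult_mono) (linarith | simp)+
        then show ?thesis using 11 x by (simp add: abs_mult power2_eq_square)
      next
        case 12: 2
        have "(x - 1) * (b - 1 - x) \<le> ((b - 2) / 2) ^ 2" using quad[of "x - 1" "b - 1 - x"] by simp
        also have "\<dots> \<le> (81/100) ^ 2" using 2 by (intro power_mono) auto
        finally have "x * ((x - 1) * (b - 1 - x)) \<le> (262/100) * (81/100) ^ 2" using 12 2 x by (intro mult_mono) (linarith | simp)+
        moreover have "\<bar>x * (x - 1) * (x - b + 1)\<bar> = x * ((x - 1) * (b - 1 - x))"
          using 12 x by (simp add: abs_mult abs_of_nonpos)
        moreover have "(262/100) * (81/100) ^ 2 \<le> (189/100 :: real)" by (simp add: power2_eq_square)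
        ultimately show ?thesis by linarith
      next
        case 13: 3
        have "x * (x - 1) * (x - b + 1) \<le> (29/10) * (19/10) * (283/1000)" using 13 2 x by (intro mult_mono) (linarith | simp)+
        then show ?thesis using 13 2 x by (simp add: abs_mult)
      qed
    qed
    moreover have "\<bar>3 - b\<bar> ^ 3 \<le> (619/1000) ^ 3" using 2 by (intro power_mono) auto
    ultimately have "\<bar>x * (x - 1) * (x - b + 1)\<bar> * \<bar>3 - b\<bar> ^ 3 \<le> (189/100) * (619/1000) ^ 3" by (intro mult_mono) (linarith | simp)+
    then show ?thesis unfolding X by (simp add: power3_eq_cube)
  qed
qed


lemma aux_strip_1d:
  fixes x :: real assumes x: "0 < x" "x < 3"
  shows "x ^ 6 * \<bar>x - 1\<bar> ^ 6 * \<bar>x - 2\<bar> ^ 2 * (3 - x) ^ 9 \<le> 16/5"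
proof -
  consider "x \<le> 1" | "1 \<le> x" "x \<le> 2" | "2 \<le> x" by linarith
  then show ?thesis
  proof cases
    case 1
    have "x ^ 6 * (1 - x) ^ 6 * (2 - x) ^ 2 * (3 - x) ^ 9 \<le> 16/5"
      by (rule tangent_bound4[of _ _ _ _ "247/100" "42/25" "63/100" "19/50"], (use 1 x in linarith)+, use 1 x in \<open>simp add: field_simps\<close>, simp add: power_divide)
    moreover have "\<bar>x - 1\<bar> = 1 - x" "\<bar>x - 2\<bar> = 2 - x" using 1 x by auto
    ultimately show ?thesis by simp
  next
    case 2
    have "x ^ 6 * (x - 1) ^ 6 * (2 - x) ^ 2 * (3 - x) ^ 9 \<le> 16/5"
      by (rule tangent_bound4[of _ _ _ _ "3/5" "3/2" "59/20" "3/4"], (use 2 x in linarith)+, use 2 x in \<open>simp add: field_simps\<close>, simp add: power_divide)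
    moreover have "\<bar>x - 1\<bar> = x - 1" "\<bar>x - 2\<bar> = 2 - x" using 2 x by auto
    ultimately show ?thesis by simp
  next
    case 3
    have "x ^ 6 * (x - 1) ^ 6 * (x - 2) ^ 2 * (3 - x) ^ 9 \<le> 16/5"
      by (rule tangent_bound4[of _ _ _ _ "43/100" "3/4" "309/100" "37/25"], (use 3 x in linarith)+, use 3 x in \<open>simp add: field_simps\<close>, simp add: power_divide)
    moreover have "\<bar>x - 1\<bar> = x - 1" "\<bar>x - 2\<bar> = x - 2" using 3 x by auto
    ultimately show ?thesis by simp
  qed
qed

text \<open>For fixed \<open>x\<close> the two factors containing \<open>c\<close> are maximised
  separately, which leaves the one-variable function of \<open>aux_strip_1d\<close>. The exponents 3
  and 6 make the maximum on the boundary 4x = 3c agree with the interior one, 64/19683 times (3 -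
  x)^9.\<close>

lemma aux_strip:
  fixes x c :: real assumes x: "0 < x" "4 * x < 3 * c" and c: "c < 4"
  shows "\<bar>x ^ 6 * (4 - c) ^ 3 * (x - 1) ^ 6 * (x - c + 1) ^ 6 * (x - 2) ^ 2\<bar> \<le> 16/5 * (64/19683)"
proof -
  define s where "s = 3 - x"
  have s: "0 < s" using x c by (simp add: s_def)
  have "(4 - c) ^ 3 * \<bar>x - c + 1\<bar> ^ 6 \<le> 64/19683 * s ^ 9"
  proof (cases "c \<le> x + 1")
    case True
    \<comment> \<open>The constraint 4x < 3c gives 4 - c < 4s/3 and x - c + 1 < s/3.\<close>
    have "(4 - c) ^ 3 * \<bar>x - c + 1\<bar> ^ 6 \<le> (4 * s / 3) ^ 3 * (s / 3) ^ 6"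
      using True x c by (intro mult_mono power_mono) (auto simp: s_def)
    also have "\<dots> = 64/19683 * s ^ 9" by (simp add: power_mult_distrib power_divide flip: power_add)
    finally show ?thesis .
  next
    case False
    \<comment> \<open>Weighted arithmetic-geometric mean for (4 - c) + (c - x - 1) = s, with maximum
      at 4 - c = s/3; the third factor is a dummy.\<close>
    have "(4 - c) ^ 3 * (c - x - 1) ^ 6 * 1 ^ 0 \<le> 64/19683 * s ^ 9"
    proof (rule tangent_bound3[of _ _ _ "3 / s" "3 / (2 * s)" 1])
      have "real 3 * (3 / s * (4 - c) - 1) + real 6 * (3 / (2 * s) * (c - x - 1) - 1) + real 0 * (1 * 1 - 1) =
        9 * ((4 - c) + (c - x - 1)) / s - 9" using s by (simp add: field_simps)
      also have "(4 - c) + (c - x - 1) = s" by (simp add: s_def)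
      also have "9 * s / s - 9 = 0" using s by simp
      finally show "real 3 * (3 / s * (4 - c) - 1) + real 6 * (3 / (2 * s) * (c - x - 1) - 1) + real 0 * (1 * 1 - 1) \<le> 0" by simp
      show "1 \<le> 64/19683 * s ^ 9 * ((3 / s) ^ 3 * (3 / (2 * s)) ^ 6 * 1 ^ 0)"
        using s by (simp add: power_divide power_mult_distrib field_simps flip: power_add)
    qed (use False c s in auto)
    moreover have "\<bar>x - c + 1\<bar> = c - x - 1" using False by auto
    ultimately show ?thesis by simp
  qed
  then have "((4 - c) ^ 3 * \<bar>x - c + 1\<bar> ^ 6) * (x ^ 6 * \<bar>x - 1\<bar> ^ 6 * \<bar>x - 2\<bar> ^ 2)
      \<le> (64/19683 * s ^ 9) * (x ^ 6 * \<bar>x - 1\<bar> ^ 6 * \<bar>x - 2\<bar> ^ 2)"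
    using x by (intro mult_right_mono) auto
  also have "\<dots> = 64/19683 * (x ^ 6 * \<bar>x - 1\<bar> ^ 6 * \<bar>x - 2\<bar> ^ 2 * (3 - x) ^ 9)" by (simp add: s_def)
  also have "\<dots> \<le> 64/19683 * (16/5)" using aux_strip_1d[of x] x c by (intro mult_left_mono) auto
  finally show ?thesis using x c by (simp add: abs_mult power_abs mult_ac)
qed


lemma aux_ratio:
  fixes x :: real assumes x: "0 < x" "x < 1/4"
  shows "x ^ 29 * (1 - 4 * x) ^ 6 * \<bar>1 - 5 * x\<bar> ^ 5 \<le> 622 / 10 ^ 32"
proof (cases "x \<le> 1/5")
  case True
  have "x ^ 29 * (1 - 4 * x) ^ 6 * (1 - 5 * x) ^ 5 \<le> 622 / 10 ^ 32"
    by (rule tangent_bound3[of _ _ _ "6333/1000" "339/125" "4743/1000"], (use True x in linarith)+, use True x in \<open>simp add: field_simps\<close>, simp add: power_divide)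
  moreover have "\<bar>1 - 5 * x\<bar> = 1 - 5 * x" using True by auto
  ultimately show ?thesis by simp
next
  case False
  have "x ^ 29 * (1 - 4 * x) ^ 6 * (5 * x - 1) ^ 5 \<le> 622 / 10 ^ 32"
    by (rule tangent_bound3[of _ _ _ "2177/500" "12287/1000" "1349/200"], (use False x in linarith)+, use False x in \<open>simp add: field_simps\<close>, simp add: power_divide)
  moreover have "\<bar>1 - 5 * x\<bar> = 5 * x - 1" using False by auto
  ultimately show ?thesis by simp
qed

lemma aux_single:
  fixes b :: real assumes b: "0 < b" "b < 4"
  shows "b ^ 40 * \<bar>(4 - b) ^ 14 * (b - 3) ^ 15 * (b - 2) ^ 11 * (b ^ 2 - 5 * b + 5) ^ 10\<bar> \<le> 377 * 10 ^ 9"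
proof -
  define q where "q = b ^ 2 - 5 * b + 5"
  have X: "b ^ 40 * \<bar>(4 - b) ^ 14 * (b - 3) ^ 15 * (b - 2) ^ 11 * (b ^ 2 - 5 * b + 5) ^ 10\<bar> =
    b ^ 40 * (4 - b) ^ 14 * \<bar>b - 3\<bar> ^ 15 * \<bar>b - 2\<bar> ^ 11 * \<bar>q\<bar> ^ 10" using b by (simp add: abs_mult power_abs q_def)
  \<comment> \<open>To have only affine factors, |q| is replaced by a product of two of them, whose
    zeros are the roots (5 \<plusminus> sqrt 5)/2 rounded away from the interval at hand.\<close>
  have mono: ?thesis if "\<bar>q\<bar> \<le> s * t"
    "b ^ 40 * (4 - b) ^ 14 * \<bar>b - 3\<bar> ^ 15 * \<bar>b - 2\<bar> ^ 11 * s ^ 10 * t ^ 10 \<le> 377 * 10 ^ 9" for s t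
  proof -
    have "b ^ 40 * (4 - b) ^ 14 * \<bar>b - 3\<bar> ^ 15 * \<bar>b - 2\<bar> ^ 11 * \<bar>q\<bar> ^ 10
      \<le> b ^ 40 * (4 - b) ^ 14 * \<bar>b - 3\<bar> ^ 15 * \<bar>b - 2\<bar> ^ 11 * (s * t) ^ 10"
      using that b by (intro mult_left_mono power_mono) auto
    also have "\<dots> = b ^ 40 * (4 - b) ^ 14 * \<bar>b - 3\<bar> ^ 15 * \<bar>b - 2\<bar> ^ 11 * s ^ 10 * t ^ 10"
      by (simp add: power_mult_distrib)
    finally show ?thesis unfolding X using that(2) by linarith
  qed
  consider "b \<le> 691/500" | "691/500 \<le> b" "b \<le> 2" | "2 \<le> b" "b \<le> 3" | "3 \<le> b" "b \<le> 1809/500" | "1809/500 \<le> b"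
    by linarith
  then show ?thesis
  proof cases
    case 1
    have "0 \<le> (691/500 - b) * (1809/500 - b)" using 1 b by (intro mult_nonneg_nonneg) auto
    moreover have "(1383/1000 - b) * (36181/10000 - b) = q + (38323/10000000) + (-11/10000) * b" by (simp add: q_def power2_eq_square field_simps)
    moreover have "(691/500 - b) * (1809/500 - b) = q + (19/250000)" by (simp add: q_def power2_eq_square field_simps)
    ultimately have t: "\<bar>q\<bar> \<le> (1383/1000 - b) * (36181/10000 - b)" using 1 b by linarith
    have "b ^ 40 * (4 - b) ^ 14 * (3 - b) ^ 15 * (2 - b) ^ 11 * (1383/1000 - b) ^ 10 * (36181/10000 - b) ^ 10 \<le> 377 * 10 ^ 9"
      by (rule tangent_bound6[of _ _ _ _ _ _ "1129/1000" "321/1000" "473/1000" "112/125" "2007/1000" "183/500"], (use 1 b in linarith)+, use 1 b in \<open>simp add: field_simps\<close>, simp add: power_divide)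
    moreover have "\<bar>b - 3\<bar> = 3 - b" "\<bar>b - 2\<bar> = 2 - b" using 1 b by auto
    ultimately show ?thesis using mono[OF t] by simp
  next
    case 2
    have "0 \<le> (b - 691/500) * (1809/500 - b)" using 2 b by (intro mult_nonneg_nonneg) auto
    moreover have "(b - 1381/1000) * (36181/10000 - b) = - q + (34039/10000000) + (-9/10000) * b" by (simp add: q_def power2_eq_square field_simps)
    moreover have "(b - 691/500) * (1809/500 - b) = - q + (-19/250000)" by (simp add: q_def power2_eq_square field_simps)
    ultimately have t: "\<bar>q\<bar> \<le> (b - 1381/1000) * (36181/10000 - b)" using 2 b by linarith
    have "b ^ 40 * (4 - b) ^ 14 * (3 - b) ^ 15 * (2 - b) ^ 11 * (b - 1381/1000) ^ 10 * (36181/10000 - b) ^ 10 \<le> 377 * 10 ^ 9"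
      by (rule tangent_bound6[of _ _ _ _ _ _ "59/100" "43/100" "19/25" "157/50" "333/100" "13/25"], (use 2 b in linarith)+, use 2 b in \<open>simp add: field_simps\<close>, simp add: power_divide)
    moreover have "\<bar>b - 3\<bar> = 3 - b" "\<bar>b - 2\<bar> = 2 - b" using 2 b by auto
    ultimately show ?thesis using mono[OF t] by simp
  next
    case 3
    have "0 \<le> (b - 691/500) * (1809/500 - b)" using 3 b by (intro mult_nonneg_nonneg) auto
    moreover have "(b - 1381/1000) * (36181/10000 - b) = - q + (34039/10000000) + (-9/10000) * b" by (simp add: q_def power2_eq_square field_simps)
    moreover have "(b - 691/500) * (1809/500 - b) = - q + (-19/250000)" by (simp add: q_def power2_eq_square field_simps)
    ultimately have t: "\<bar>q\<bar> \<le> (b - 1381/1000) * (36181/10000 - b)" using 3 b by linarith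
    have "b ^ 40 * (4 - b) ^ 14 * (3 - b) ^ 15 * (b - 2) ^ 11 * (b - 1381/1000) ^ 10 * (36181/10000 - b) ^ 10 \<le> 377 * 10 ^ 9"
      by (rule tangent_bound6[of _ _ _ _ _ _ "401/1000" "331/500" "1959/1000" "51/25" "901/1000" "443/500"], (use 3 b in linarith)+, use 3 b in \<open>simp add: field_simps\<close>, simp add: power_divide)
    moreover have "\<bar>b - 3\<bar> = 3 - b" "\<bar>b - 2\<bar> = b - 2" using 3 b by auto
    ultimately show ?thesis using mono[OF t] by simp
  next
    case 4
    have "0 \<le> (b - 691/500) * (1809/500 - b)" using 4 b by (intro mult_nonneg_nonneg) auto
    moreover have "(b - 1381/1000) * (36181/10000 - b) = - q + (34039/10000000) + (-9/10000) * b" by (simp add: q_def power2_eq_square field_simps)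
    moreover have "(b - 691/500) * (1809/500 - b) = - q + (-19/250000)" by (simp add: q_def power2_eq_square field_simps)
    ultimately have t: "\<bar>q\<bar> \<le> (b - 1381/1000) * (36181/10000 - b)" using 4 b by linarith
    have "b ^ 40 * (4 - b) ^ 14 * (b - 3) ^ 15 * (b - 2) ^ 11 * (b - 1381/1000) ^ 10 * (36181/10000 - b) ^ 10 \<le> 377 * 10 ^ 9"
      by (rule tangent_bound6[of _ _ _ _ _ _ "29/100" "161/100" "263/100" "18/25" "1/2" "417/100"], (use 4 b in linarith)+, use 4 b in \<open>simp add: field_simps\<close>, simp add: power_divide)
    moreover have "\<bar>b - 3\<bar> = b - 3" "\<bar>b - 2\<bar> = b - 2" using 4 b by auto
    ultimately show ?thesis using mono[OF t] by simp
  next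
    case 5
    have "0 \<le> (b - 691/500) * (b - 1809/500)" using 5 b by (intro mult_nonneg_nonneg) auto
    moreover have "(b - 1381/1000) * (b - 3617/1000) = q + (-4923/1000000) + (1/500) * b" by (simp add: q_def power2_eq_square field_simps)
    moreover have "(b - 691/500) * (b - 1809/500) = q + (19/250000)" by (simp add: q_def power2_eq_square field_simps)
    ultimately have t: "\<bar>q\<bar> \<le> (b - 1381/1000) * (b - 3617/1000)" using 5 b by linarith
    have "b ^ 40 * (4 - b) ^ 14 * (b - 3) ^ 15 * (b - 2) ^ 11 * (b - 1381/1000) ^ 10 * (b - 3617/1000) ^ 10 \<le> 377 * 10 ^ 9"
      by (rule tangent_bound6[of _ _ _ _ _ _ "13/50" "603/100" "6/5" "27/50" "41/100" "23/5"], (use 5 b in linarith)+, use 5 b in \<open>simp add: field_simps\<close>, simp add: power_divide)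
    moreover have "\<bar>b - 3\<bar> = b - 3" "\<bar>b - 2\<bar> = b - 2" using 5 b by auto
    ultimately show ?thesis using mono[OF t] by simp
  qed
qed

text \<open>The zeros 4, 3, 2 and (5 \<plusminus> sqrt 5)/2 are the values 4 - r^2 for r = 2 cos
  (pi/m), m = 2, 3, 4, 5, and their conjugates.\<close>

definition aux_factor :: "real \<Rightarrow> real" where
  "aux_factor b = (4 - b) ^ 14 * (b - 3) ^ 15 * (b - 2) ^ 11 * (b ^ 2 - 5 * b + 5) ^ 10"

text \<open>The first three factors are homogeneous of degree 40 in \<open>x\<close> and
  \<open>b * c\<close>. In the ratio y = x/(bc) the function splits into a function of
  \<open>y\<close> and the powers b^40, c^40, so three one-variable bounds suffice.\<close>

lemma aux_product:
  fixes x b c :: real assumes x: "0 < x" "4 * x < b * c" and b: "0 < b" "b < 4" and c: "0 < c" "c < 4"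
  shows "\<bar>x ^ 29 * (b * c - 4 * x) ^ 6 * (b * c - 5 * x) ^ 5 * aux_factor b * aux_factor c\<bar> \<le> 622 / 10 ^ 32 * (377 * 10 ^ 9) ^ 2"
proof -
  define y where "y = x / (b * c)"
  have xy: "x = y * (b * c)" using b c by (simp add: y_def)
  have y: "0 < y" "y < 1/4" using x b c by (simp_all add: y_def field_simps)
  have "x ^ 29 * (b * c - 4 * x) ^ 6 * \<bar>b * c - 5 * x\<bar> ^ 5 = (y ^ 29 * (1 - 4 * y) ^ 6 * \<bar>1 - 5 * y\<bar> ^ 5) * b ^ 40 * c ^ 40"
  proof -
    have "b * c - 4 * x = (b * c) * (1 - 4 * y)" "b * c - 5 * x = (b * c) * (1 - 5 * y)"
      by (simp_all add: xy algebra_simps)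
    then have "x ^ 29 * (b * c - 4 * x) ^ 6 * \<bar>b * c - 5 * x\<bar> ^ 5 =
        (y * (b * c)) ^ 29 * ((b * c) * (1 - 4 * y)) ^ 6 * ((b * c) * \<bar>1 - 5 * y\<bar>) ^ 5"
      using b c by (simp add: xy abs_mult)
    also have "\<dots> = (y ^ 29 * (1 - 4 * y) ^ 6 * \<bar>1 - 5 * y\<bar> ^ 5) * ((b * c) ^ 29 * (b * c) ^ 6 * (b * c) ^ 5)"
      by (simp only: power_mult_distrib mult_ac)
    also have "(b * c) ^ 29 * (b * c) ^ 6 * (b * c) ^ 5 = b ^ 40 * c ^ 40"
      by (simp only: power_mult_distrib[symmetric] power_add[symmetric]) simp
    finally show ?thesis by simp
  qed
  then have "\<bar>x ^ 29 * (b * c - 4 * x) ^ 6 * (b * c - 5 * x) ^ 5 * aux_factor b * aux_factor c\<bar> =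
      (y ^ 29 * (1 - 4 * y) ^ 6 * \<bar>1 - 5 * y\<bar> ^ 5) * ((b ^ 40 * \<bar>aux_factor b\<bar>) * (c ^ 40 * \<bar>aux_factor c\<bar>))"
    using x by (simp add: abs_mult power_abs mult_ac)
  also have "\<dots> \<le> 622 / 10 ^ 32 * ((377 * 10 ^ 9) * (377 * 10 ^ 9))"
    unfolding aux_factor_def using y b c
    by (intro mult_mono aux_ratio aux_single mult_nonneg_nonneg) auto
  finally show ?thesis by (simp only: power2_eq_square)
qed

section \<open>Degree bounds for four-vertex configurations\<close>

context v_arithmetic begin

section \<open>Degree bounds from auxiliary polynomials\<close>

lemma OK_E: "x \<in> OK \<Longrightarrow> x \<in> E"
  using K_sub_E by (auto simp: OK_def)

lemma phi_simps:
  assumes "nontriv \<phi>"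
  shows "x \<in> E \<Longrightarrow> y \<in> E \<Longrightarrow> \<phi> (x + y) = \<phi> x + \<phi> y" "x \<in> E \<Longrightarrow> y \<in> E \<Longrightarrow> \<phi> (x - y) = \<phi> x - \<phi> y"
    "x \<in> E \<Longrightarrow> y \<in> E \<Longrightarrow> \<phi> (x * y) = \<phi> x * \<phi> y" "x \<in> E \<Longrightarrow> \<phi> (x ^ n) = \<phi> x ^ n" "\<phi> 1 = 1" "\<phi> 0 = 0"
    "\<phi> (numeral k) = numeral k" "x \<in> E \<Longrightarrow> \<phi> (- x) = - \<phi> x"
  using nontriv_simps[OF assms] by auto

lemma E_intros:
  "x \<in> E \<Longrightarrow> y \<in> E \<Longrightarrow> x + y \<in> E" "x \<in> E \<Longrightarrow> y \<in> E \<Longrightarrow> x - y \<in> E"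
  "x \<in> E \<Longrightarrow> y \<in> E \<Longrightarrow> x * y \<in> E" "x \<in> E \<Longrightarrow> x ^ n \<in> E" "1 \<in> E" "numeral k \<in> E" "x \<in> E \<Longrightarrow> - x \<in> E"
  using real_subfieldD(3-5)[OF E_subfield, of x y] real_subfieldD(2)[OF E_subfield] real_subfieldD(7)[OF E_subfield, of x]
    real_subfieldD(9)[OF E_subfield, of x n] real_subfield_of_int[OF E_subfield, of "numeral k"] by auto

lemma deg_4_3:
  assumes p: "p \<in> OK" "p \<noteq> 0" "p \<noteq> 1" "\<bar>p\<bar> \<le> 200000"
    and \<phi>: "\<And>\<phi>. nontriv \<phi> \<Longrightarrow> 0 < \<phi> p \<and> \<phi> p < 4/3"
  shows "field_degree K \<le> enat 23"
proof (rule degree_bound[of "p * (1 - p) ^ 2" "200000 * 200001 ^ 2" "4/27"])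
  show "p * (1 - p) ^ 2 \<in> OK" using p by (intro OK_intros)
  show "p * (1 - p) ^ 2 \<noteq> 0" using p by simp
  have "\<bar>p\<bar> * \<bar>1 - p\<bar> ^ 2 \<le> 200000 * 200001 ^ 2" using p by (intro mult_mono power_mono) auto
  then show "\<bar>p * (1 - p) ^ 2\<bar> \<le> 200000 * 200001 ^ 2" by (simp add: abs_mult)
  fix \<psi> assume \<psi>: "nontriv \<psi>"
  have "\<psi> (p * (1 - p) ^ 2) = \<psi> p * (1 - \<psi> p) ^ 2"
    by (simp add: phi_simps[OF \<psi>] E_intros OK_E[OF p(1)])
  then show "\<bar>\<psi> (p * (1 - p) ^ 2)\<bar> \<le> 4/27" using aux_4_3[of "\<psi> p"] \<phi>[OF \<psi>] by simp
qed (simp_all add: power_divide)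

lemma deg_8_3:
  assumes w: "w \<in> OK" and nz: "w * (w - 1) * (w - 2) ^ 2 * (w ^ 2 - 3 * w + 1) \<noteq> 0"
    and M: "\<bar>w * (w - 1) * (w - 2) ^ 2 * (w ^ 2 - 3 * w + 1)\<bar> \<le> M" "M * (7/25) ^ n < 1"
    and \<phi>: "\<And>\<phi>. nontriv \<phi> \<Longrightarrow> 0 < \<phi> w \<and> \<phi> w < 8/3"
  shows "field_degree K \<le> enat n"
proof (rule degree_bound[OF _ nz M(1) _ _ _ M(2)])
  show "w * (w - 1) * (w - 2) ^ 2 * (w ^ 2 - 3 * w + 1) \<in> OK" using w by (intro OK_intros)
  fix \<psi> assume \<psi>: "nontriv \<psi>"
  have "\<psi> (w * (w - 1) * (w - 2) ^ 2 * (w ^ 2 - 3 * w + 1)) =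
      \<psi> w * (\<psi> w - 1) * (\<psi> w - 2) ^ 2 * (\<psi> w ^ 2 - 3 * \<psi> w + 1)"
    by (simp add: phi_simps[OF \<psi>] E_intros OK_E[OF w])
  then show "\<bar>\<psi> (w * (w - 1) * (w - 2) ^ 2 * (w ^ 2 - 3 * w + 1))\<bar> \<le> 7/25"
    using aux_8_3[of "\<psi> w"] \<phi>[OF \<psi>] by simp
qed simp_all

text \<open>At the identity \<open>b\<close> is the smaller of the two roots, so the unit 3 - b
  costs less than 1.619 in each of its three factors.\<close>

lemma deg_golden:
  assumes x: "x \<in> OK" "b \<in> OK" "b ^ 2 - 5 * b + 5 = 0" and nz: "x \<noteq> 0" "x \<noteq> 1" "x \<noteq> b - 1"
    and M: "\<bar>x\<bar> \<le> 196" "\<bar>x - 1\<bar> \<le> 196" "\<bar>x - b + 1\<bar> \<le> 196" "1 < b" "b < 2"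
    and \<phi>: "\<And>\<phi>. nontriv \<phi> \<Longrightarrow> 0 < \<phi> x \<and> \<phi> x < 4 * \<phi> b / 5"
  shows "field_degree K \<le> enat 23"
proof (rule degree_bound[of "x * (x - 1) * (x - b + 1) * (3 - b) ^ 3" "196 ^ 3 * (1619/1000) ^ 3" "9/20"])
  show "x * (x - 1) * (x - b + 1) * (3 - b) ^ 3 \<in> OK" using x by (intro OK_intros)
  show "x * (x - 1) * (x - b + 1) * (3 - b) ^ 3 \<noteq> 0" using nz M by auto
  have "\<bar>x\<bar> * \<bar>x - 1\<bar> * \<bar>x - b + 1\<bar> * \<bar>3 - b\<bar> ^ 3 \<le> 196 * 196 * 196 * (1619/1000) ^ 3"
    using M golden_interval[OF x(3)] by (intro mult_mono power_mono) auto
  then show "\<bar>x * (x - 1) * (x - b + 1) * (3 - b) ^ 3\<bar> \<le> 196 ^ 3 * (1619/1000) ^ 3"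
    by (simp add: abs_mult power_abs)
  fix \<psi> assume \<psi>: "nontriv \<psi>"
  note s = phi_simps[OF \<psi>] E_intros OK_E[OF x(1)] OK_E[OF x(2)]
  have "\<psi> (x * (x - 1) * (x - b + 1) * (3 - b) ^ 3) = \<psi> x * (\<psi> x - 1) * (\<psi> x - \<psi> b + 1) * (3 - \<psi> b) ^ 3"
    by (simp add: s)
  moreover have "\<psi> (b ^ 2 - 5 * b + 5) = \<psi> b ^ 2 - 5 * \<psi> b + 5" by (simp add: s)
  then have "\<psi> b ^ 2 - 5 * \<psi> b + 5 = 0" using x(3) phi_simps(6)[OF \<psi>] by simp
  ultimately show "\<bar>\<psi> (x * (x - 1) * (x - b + 1) * (3 - b) ^ 3)\<bar> \<le> 9/20"
    using aux_golden[of "\<psi> b" "\<psi> x"] \<phi>[OF \<psi>] by simp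
qed (simp_all add: power_divide)

text \<open>From x at least 3 and 0 < c < 4, no factor of the auxiliary polynomial vanishes at the
  identity.\<close>

lemma deg_strip:
  assumes x: "x \<in> OK" "c \<in> OK" and M: "3 \<le> x" "x \<le> 225" "0 < c" "c < 4"
    and \<phi>: "\<And>\<phi>. nontriv \<phi> \<Longrightarrow> 0 < \<phi> x \<and> \<phi> c < 4 \<and> 4 * \<phi> x < 3 * \<phi> c"
  shows "field_degree K \<le> enat 25"
proof (rule degree_bound[of "x ^ 6 * (4 - c) ^ 3 * (x - 1) ^ 6 * (x - c + 1) ^ 6 * (x - 2) ^ 2"
      "225 ^ 6 * 4 ^ 3 * 225 ^ 6 * 226 ^ 6 * 225 ^ 2" "16/5 * (64/19683)"])
  show "x ^ 6 * (4 - c) ^ 3 * (x - 1) ^ 6 * (x - c + 1) ^ 6 * (x - 2) ^ 2 \<in> OK" using x by (intro OK_intros)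
  show "x ^ 6 * (4 - c) ^ 3 * (x - 1) ^ 6 * (x - c + 1) ^ 6 * (x - 2) ^ 2 \<noteq> 0" using M by auto
  have "\<bar>x\<bar> ^ 6 * \<bar>4 - c\<bar> ^ 3 * \<bar>x - 1\<bar> ^ 6 * \<bar>x - c + 1\<bar> ^ 6 * \<bar>x - 2\<bar> ^ 2 \<le> 225 ^ 6 * 4 ^ 3 * 225 ^ 6 * 226 ^ 6 * 225 ^ 2"
    using M by (intro mult_mono power_mono) auto
  then show "\<bar>x ^ 6 * (4 - c) ^ 3 * (x - 1) ^ 6 * (x - c + 1) ^ 6 * (x - 2) ^ 2\<bar> \<le> 225 ^ 6 * 4 ^ 3 * 225 ^ 6 * 226 ^ 6 * 225 ^ 2"
    by (simp add: abs_mult power_abs)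
  fix \<psi> assume \<psi>: "nontriv \<psi>"
  have "\<psi> (x ^ 6 * (4 - c) ^ 3 * (x - 1) ^ 6 * (x - c + 1) ^ 6 * (x - 2) ^ 2) =
      \<psi> x ^ 6 * (4 - \<psi> c) ^ 3 * (\<psi> x - 1) ^ 6 * (\<psi> x - \<psi> c + 1) ^ 6 * (\<psi> x - 2) ^ 2"
    by (simp add: phi_simps[OF \<psi>] E_intros OK_E[OF x(1)] OK_E[OF x(2)])
  then show "\<bar>\<psi> (x ^ 6 * (4 - c) ^ 3 * (x - 1) ^ 6 * (x - c + 1) ^ 6 * (x - 2) ^ 2)\<bar> \<le> 16/5 * (64/19683)"
    using aux_strip[of "\<psi> x" "\<psi> c"] \<phi>[OF \<psi>] by (simp only:)
qed (simp_all add: power_divide)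

lemma aux_factor_OK: "b \<in> OK \<Longrightarrow> aux_factor b \<in> OK"
  unfolding aux_factor_def by (intro OK_intros)

lemma aux_factor_phi: "nontriv \<phi> \<Longrightarrow> b \<in> OK \<Longrightarrow> \<phi> (aux_factor b) = aux_factor (\<phi> b)"
  unfolding aux_factor_def by (simp add: phi_simps E_intros OK_E)

text \<open>Used at the identity only, where \<open>b\<close> is 4 - r^2 for an entry
  \<open>r\<close> with square at least 3.\<close>

lemma aux_factor_bound:
  assumes "0 < b" "b \<le> 1" shows "aux_factor b \<noteq> 0" "\<bar>aux_factor b\<bar> \<le> 4 ^ 14 * 3 ^ 15 * 2 ^ 11 * 5 ^ 10"
proof -
  have "b * b \<le> 1 * b" using assms by (intro mult_right_mono) auto
  moreover have "0 < b * b" using assms by simp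
  ultimately have q: "0 < b ^ 2 - 5 * b + 5" "b ^ 2 - 5 * b + 5 \<le> 5"
    unfolding power2_eq_square using assms by linarith+
  show "aux_factor b \<noteq> 0" using assms q(1) by (auto simp: aux_factor_def)
  have "\<bar>4 - b\<bar> ^ 14 * \<bar>b - 3\<bar> ^ 15 * \<bar>b - 2\<bar> ^ 11 * \<bar>b ^ 2 - 5 * b + 5\<bar> ^ 10 \<le> 4 ^ 14 * 3 ^ 15 * 2 ^ 11 * 5 ^ 10"
    using assms q by (intro mult_mono power_mono) auto
  then show "\<bar>aux_factor b\<bar> \<le> 4 ^ 14 * 3 ^ 15 * 2 ^ 11 * 5 ^ 10" by (simp add: aux_factor_def abs_mult power_abs)
qed

lemma deg_product:
  assumes x: "x \<in> OK" "b \<in> OK" "c \<in> OK" and M: "1 \<le> x" "x \<le> 196" "0 < b" "b \<le> 1" "0 < c" "c \<le> 1"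
    and \<phi>: "\<And>\<phi>. nontriv \<phi> \<Longrightarrow> 0 < \<phi> x \<and> 0 < \<phi> b \<and> \<phi> b < 4 \<and> 0 < \<phi> c \<and> \<phi> c < 4 \<and> 4 * \<phi> x < \<phi> b * \<phi> c"
  shows "field_degree K \<le> enat 25"
proof (rule degree_bound[of "x ^ 29 * (b * c - 4 * x) ^ 6 * (b * c - 5 * x) ^ 5 * aux_factor b * aux_factor c"
      "196 ^ 29 * 784 ^ 6 * 980 ^ 5 * (4 ^ 14 * 3 ^ 15 * 2 ^ 11 * 5 ^ 10) * (4 ^ 14 * 3 ^ 15 * 2 ^ 11 * 5 ^ 10)"
      "622 / 10 ^ 32 * (377 * 10 ^ 9) ^ 2"])
  let ?X = "x ^ 29 * (b * c - 4 * x) ^ 6 * (b * c - 5 * x) ^ 5 * aux_factor b * aux_factor c"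
  show "?X \<in> OK" using x by (intro OK_intros aux_factor_OK)
  have bc: "0 < b * c" "b * c \<le> 1" using M mult_mono[of b 1 c 1] by auto
  then show "?X \<noteq> 0" using M aux_factor_bound(1) by auto
  have "\<bar>x\<bar> ^ 29 * \<bar>b * c - 4 * x\<bar> ^ 6 * \<bar>b * c - 5 * x\<bar> ^ 5 * \<bar>aux_factor b\<bar> * \<bar>aux_factor c\<bar>
    \<le> 196 ^ 29 * 784 ^ 6 * 980 ^ 5 * (4 ^ 14 * 3 ^ 15 * 2 ^ 11 * 5 ^ 10) * (4 ^ 14 * 3 ^ 15 * 2 ^ 11 * 5 ^ 10)"
  proof -
    have "\<bar>b * c - 4 * x\<bar> \<le> 784" "\<bar>b * c - 5 * x\<bar> \<le> 980" using M bc by linarith+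
    then show ?thesis using M by (intro mult_mono power_mono aux_factor_bound) auto
  qed
  then show "\<bar>?X\<bar> \<le> 196 ^ 29 * 784 ^ 6 * 980 ^ 5 * (4 ^ 14 * 3 ^ 15 * 2 ^ 11 * 5 ^ 10) * (4 ^ 14 * 3 ^ 15 * 2 ^ 11 * 5 ^ 10)"
    by (simp only: abs_mult power_abs)
  fix \<psi> assume \<psi>: "nontriv \<psi>"
  have "\<psi> ?X = \<psi> x ^ 29 * (\<psi> b * \<psi> c - 4 * \<psi> x) ^ 6 * (\<psi> b * \<psi> c - 5 * \<psi> x) ^ 5 * aux_factor (\<psi> b) * aux_factor (\<psi> c)"
    using x by (simp add: phi_simps[OF \<psi>] E_intros OK_E aux_factor_OK aux_factor_phi[OF \<psi>])
  then show "\<bar>\<psi> ?X\<bar> \<le> 622 / 10 ^ 32 * (377 * 10 ^ 9) ^ 2"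
    using aux_product[of "\<psi> x" "\<psi> b" "\<psi> c"] \<phi>[OF \<psi>] by (simp only:)
qed (simp_all add: power_divide)

section \<open>Labels 4 and 5, stars, chains and paths\<close>

lemmas OK_ring = OK_intros(1-3,5-7)

text \<open>The product of \<open>w\<close> with its distance to the right end of its interval is at
  most a quarter of the squared length. For label 4 the interval is (0, 2); for label 5 its length
  depends on the embedding, and the unit r^2 compensates for that. At the identity the product is
  negative because \<open>w\<close> is at least 3, so it is neither 0 nor 1.\<close>

lemma label_bound:
  assumes ij: "i < N" "j < N" and r: "0 \<le> a i j" "a i j < 2" "(a i j) ^ 2 = 2 \<or> (a i j) ^ 2 = a i j + 1"
    and w: "w \<in> OK" "3 \<le> w" "w \<le> 256" and \<phi>: "\<And>\<phi>. nontriv \<phi> \<Longrightarrow> 0 < \<phi> w \<and> \<phi> w < 4 - \<phi> (a i j) ^ 2"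
  shows "field_degree K \<le> enat 23"
  using r(3)
proof
  assume r2: "(a i j) ^ 2 = 2"
  show ?thesis
  proof (rule deg_4_3[of "w * (2 - w)"])
    show "w * (2 - w) \<in> OK" using w by (intro OK_intros)
    have neg: "w * (2 - w) < 0" using w by (simp add: mult_less_0_iff)
    then show "w * (2 - w) \<noteq> 0" "w * (2 - w) \<noteq> 1" by auto
    have "\<bar>w\<bar> * \<bar>2 - w\<bar> \<le> 256 * 256" using w by (intro mult_mono) auto
    then show "\<bar>w * (2 - w)\<bar> \<le> 200000" by (simp add: abs_mult)
    fix \<psi> assume \<psi>: "nontriv \<psi>"
    have "\<psi> (a i j) ^ 2 = \<psi> ((a i j) ^ 2)" by (simp add: phi_simps[OF \<psi>] entry_E ij)
    then have "\<psi> (a i j) ^ 2 = 2" by (simp add: r2 phi_simps[OF \<psi>])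
    then have W: "0 < \<psi> w" "\<psi> w < 2" using \<phi>[OF \<psi>] by auto
    have e: "\<psi> (w * (2 - w)) = \<psi> w * (2 - \<psi> w)" by (simp add: phi_simps[OF \<psi>] E_intros OK_E[OF w(1)])
    have "0 \<le> (\<psi> w - 1) ^ 2" by simp
    then have "\<psi> w * (2 - \<psi> w) \<le> 1" by (simp add: power2_eq_square algebra_simps)
    then show "0 < \<psi> (w * (2 - w)) \<and> \<psi> (w * (2 - w)) < 4/3" unfolding e using W by (auto simp: mult_pos_pos)
  qed
next
  assume r2: "(a i j) ^ 2 = a i j + 1"
  define r where "r = a i j"
  have rE: "r \<in> E" "r ^ 2 \<in> OK" "0 \<le> r" "r < 2" "r ^ 2 = r + 1"
    using entry_E[OF ij] OK_square[OF ij] r r2 unfolding r_def by blast+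
  have r1: "1 < r"
  proof (rule ccontr)
    assume "\<not> 1 < r"
    then have "r * r \<le> 1 * r" using rE by (intro mult_right_mono) auto
    then show False using rE by (simp add: power2_eq_square)
  qed
  let ?p = "w * (4 - r ^ 2 - w) * r ^ 2"
  show ?thesis
  proof (rule deg_4_3[of ?p])
    show "?p \<in> OK" using w(1) rE(2) by (simp add: OK_ring)
    have "w * (4 - r ^ 2 - w) < 0" using w rE r1 by (intro mult_pos_neg) auto
    then have "?p < 0" by (rule mult_neg_pos) (use r1 in simp)
    then show "?p \<noteq> 0" "?p \<noteq> 1" by auto
    have "\<bar>w\<bar> * \<bar>4 - r ^ 2 - w\<bar> * \<bar>r ^ 2\<bar> \<le> 256 * 256 * 3" using w rE r1 by (intro mult_mono) auto
    then show "\<bar>?p\<bar> \<le> 200000" by (simp add: abs_mult)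
    fix \<psi> assume \<psi>: "nontriv \<psi>"
    define R where "R = \<psi> r"
    have "R ^ 2 = \<psi> (r ^ 2)" by (simp add: R_def phi_simps[OF \<psi>] rE(1))
    also have "\<dots> = R + 1" by (simp add: R_def rE(5) phi_simps[OF \<psi>] rE(1) E_intros)
    finally have R: "R ^ 2 = R + 1" .
    have W: "0 < \<psi> w" "\<psi> w < 4 - R ^ 2" using \<phi>[OF \<psi>] by (auto simp: R_def r_def)
    have e: "\<psi> ?p = \<psi> w * (4 - R ^ 2 - \<psi> w) * R ^ 2" by (simp add: R_def phi_simps[OF \<psi>] E_intros OK_E[OF w(1)] rE(1))
    have "R \<noteq> 0" using R by auto
    then have R0: "0 < R ^ 2" by simp
    have "0 \<le> ((4 - R ^ 2) - 2 * \<psi> w) ^ 2" by simp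
    then have "4 * (\<psi> w * (4 - R ^ 2 - \<psi> w)) \<le> (4 - R ^ 2) ^ 2" by (simp add: power2_eq_square algebra_simps)
    then have "4 * (\<psi> w * (4 - R ^ 2 - \<psi> w)) * R ^ 2 \<le> (4 - R ^ 2) ^ 2 * R ^ 2" using R0 by (intro mult_right_mono) auto
    \<comment> \<open>For both conjugates (4 - R^2) R = 2R - 1, a square root of 5. The element is
      thus at most 5/4, below 4/3.\<close>
    also have "(4 - R ^ 2) ^ 2 * R ^ 2 = 5"
    proof -
      have "(4 - R ^ 2) ^ 2 = (3 - R) ^ 2" using R by simp
      also have "\<dots> = 9 - 6 * R + R ^ 2" by (simp add: power2_eq_square algebra_simps)
      finally have "(4 - R ^ 2) ^ 2 = 10 - 5 * R" using R by simp
      then have "(4 - R ^ 2) ^ 2 * R ^ 2 = (10 - 5 * R) * (R + 1)" using R by simp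
      also have "\<dots> = 10 + 5 * R - 5 * R ^ 2" by (simp add: power2_eq_square algebra_simps)
      finally show ?thesis using R by simp
    qed
    finally show "0 < \<psi> ?p \<and> \<psi> ?p < 4/3" unfolding e using W R0 by (auto simp: mult_pos_pos)
  qed
qed

text \<open>Completing the square gives only semidefiniteness; strictness comes from nonvanishing,
  which embeddings preserve.\<close>

lemma quad_form_pos:
  fixes p q x :: real
  assumes "x ^ 2 < 4" "p ^ 2 + p * q * x + q ^ 2 \<noteq> 0" shows "0 < p ^ 2 + p * q * x + q ^ 2"
proof -
  have "4 * (p ^ 2 + p * q * x + q ^ 2) = (2 * p + q * x) ^ 2 + (4 - x ^ 2) * q ^ 2"
    by (simp add: power2_eq_square algebra_simps)
  also have "\<dots> \<ge> 0" using assms(1) by (intro add_nonneg_nonneg mult_nonneg_nonneg) auto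
  finally have "0 \<le> p ^ 2 + p * q * x + q ^ 2" by simp
  with assms(2) show ?thesis by (simp add: less_le)
qed

lemma quad_form_le:
  fixes p q x :: real
  assumes "0 \<le> p" "p < 14" "0 \<le> q" "q < 2" "0 \<le> x" "x < 2"
  shows "p ^ 2 + p * q * x + q ^ 2 \<le> 256"
proof -
  have "p ^ 2 \<le> 14 ^ 2" "q ^ 2 \<le> 2 ^ 2" using assms by (intro power_mono; simp)+
  moreover have "p * q * x \<le> 14 * 2 * 2" using assms by (intro mult_mono) auto
  ultimately show ?thesis by simp
qed

text \<open>The determinant condition of the triangle reads w < 4 - X^2, where X is the conjugate of
  the label \<open>a i k\<close>: precisely the interval of \<open>label_bound\<close>.\<close>

lemma triangle_label:
  assumes d: "distinct [i, j, k]" "i < N" "j < N" "k < N"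
    and r: "0 \<le> a i k" "a i k < 2" "(a i k) ^ 2 = 2 \<or> (a i k) ^ 2 = a i k + 1"
    and p: "0 \<le> a i j" "a i j < 14" "0 \<le> a j k" "a j k < 2"
    and w: "3 \<le> (a i j) ^ 2 + a i j * a j k * a i k + (a j k) ^ 2"
  shows "field_degree K \<le> enat 23"
proof (rule label_bound[OF d(2,4) r _ w])
  show "(a i j) ^ 2 + a i j * a j k * a i k + (a j k) ^ 2 \<in> OK"
    using d by (simp add: OK_ring OK_square OK_triangle)
  show "(a i j) ^ 2 + a i j * a j k * a i k + (a j k) ^ 2 \<le> 256" using quad_form_le r p by blast
  fix \<psi> assume \<psi>: "nontriv \<psi>"
  define P Q X where "P = \<psi> (a i j)" and "Q = \<psi> (a j k)" and "X = \<psi> (a i k)"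
  have sub: "{i, j, k} \<subseteq> {0..<N}" using d by auto
  have "P ^ 2 + Q ^ 2 + X ^ 2 + P * Q * X < 4"
    using neg3_det[OF nontriv_neg_sub[OF \<psi> sub] nontriv_gram[OF \<psi> sub] d(1)] by (simp add: P_def Q_def X_def)
  moreover have e: "\<psi> ((a i j) ^ 2 + a i j * a j k * a i k + (a j k) ^ 2) = P ^ 2 + P * Q * X + Q ^ 2"
    using d by (simp add: P_def Q_def X_def phi_simps[OF \<psi>] E_intros entry_E)
  moreover have "\<psi> ((a i j) ^ 2 + a i j * a j k * a i k + (a j k) ^ 2) \<noteq> 0"
    using nontriv_simps(8)[OF \<psi>, of "(a i j) ^ 2 + a i j * a j k * a i k + (a j k) ^ 2"] w d by (simp add: E_intros entry_E)
  moreover have "{i, k} \<subseteq> {0..<N}" using d by auto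
  then have "X ^ 2 < 4" using neg2[OF nontriv_neg_sub[OF \<psi>] nontriv_gram[OF \<psi>], of i k] d by (simp add: X_def)
  ultimately show "0 < \<psi> ((a i j) ^ 2 + a i j * a j k * a i k + (a j k) ^ 2) \<and>
      \<psi> ((a i j) ^ 2 + a i j * a j k * a i k + (a j k) ^ 2) < 4 - \<psi> (a i k) ^ 2"
    using quad_form_pos[of X P Q] unfolding e X_def[symmetric] by auto
qed

definition idx :: "nat \<Rightarrow> nat \<Rightarrow> nat \<Rightarrow> nat \<Rightarrow> bool" where
  "idx i j k l \<longleftrightarrow> distinct [i, j, k, l] \<and> i < N \<and> j < N \<and> k < N \<and> l < N"

lemma phi_neg4:
  assumes "nontriv \<phi>" "idx i j k l" "x \<noteq> 0 \<or> y \<noteq> 0 \<or> z \<noteq> 0 \<or> w \<noteq> 0"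
  shows "\<phi> (a i j) * x * y + \<phi> (a i k) * x * z + \<phi> (a i l) * x * w + \<phi> (a j k) * y * z + \<phi> (a j l) * y * w
    + \<phi> (a k l) * z * w < x ^ 2 + y ^ 2 + z ^ 2 + w ^ 2"
proof -
  have sub: "{i, j, k, l} \<subseteq> {0..<N}" using assms(2) by (auto simp: idx_def)
  show ?thesis
    by (rule neg4[OF nontriv_neg_sub[OF assms(1) sub] nontriv_gram[OF assms(1) sub] _ assms(3)])
       (use assms(2) in \<open>simp add: idx_def\<close>)
qed

lemma phi_sq_less_4:
  assumes "nontriv \<phi>" "i < N" "j < N" "i \<noteq> j" shows "\<phi> (a i j) ^ 2 < 4"
  using neg2[OF nontriv_neg_sub[OF assms(1)] nontriv_gram[OF assms(1)], of i j] assms by simp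

text \<open>Positivity of the determinant of a triangle i, j, k with \<open>l\<close> attached to
  \<open>i\<close>. For the given first coordinate, the remaining coordinates of the test vector are
  the stationary point of the form, so the vector is proportional to the adjugate column of
  \<open>i\<close>.\<close>

lemma star_form:
  assumes \<phi>: "nontriv \<phi>" and d: "idx i j k l" and z: "a j l = 0" "a k l = 0"
  shows "4 * (\<phi> (a i j) ^ 2 + \<phi> (a i j) * \<phi> (a i k) * \<phi> (a j k) + \<phi> (a i k) ^ 2) < (4 - \<phi> (a i l) ^ 2) * (4 - \<phi> (a j k) ^ 2)"
proof -
  define U X C R where "U = \<phi> (a i j)" and "X = \<phi> (a i k)" and "C = \<phi> (a j k)" and "R = \<phi> (a i l)"
  have C: "0 < 4 - C ^ 2" using phi_sq_less_4[OF \<phi>, of j k] d by (simp add: C_def idx_def)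
  have "U * (4 - C ^ 2) * (2 * U + X * C) + X * (4 - C ^ 2) * (2 * X + U * C) + R * (4 - C ^ 2) * (R * (4 - C ^ 2) / 2)
      + C * (2 * U + X * C) * (2 * X + U * C)
      < (4 - C ^ 2) ^ 2 + (2 * U + X * C) ^ 2 + (2 * X + U * C) ^ 2 + (R * (4 - C ^ 2) / 2) ^ 2"
    using phi_neg4[OF \<phi> d, of "4 - C ^ 2" "2 * U + X * C" "2 * X + U * C" "R * (4 - C ^ 2) / 2"] C z
    by (simp add: U_def X_def C_def R_def phi_simps[OF \<phi>])
  moreover have "(4 - C ^ 2) ^ 2 + (2 * U + X * C) ^ 2 + (2 * X + U * C) ^ 2 + (R * (4 - C ^ 2) / 2) ^ 2
      - (U * (4 - C ^ 2) * (2 * U + X * C) + X * (4 - C ^ 2) * (2 * X + U * C) + R * (4 - C ^ 2) * (R * (4 - C ^ 2) / 2)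
        + C * (2 * U + X * C) * (2 * X + U * C))
      = (4 - C ^ 2) * ((4 - R ^ 2) * (4 - C ^ 2) / 4 - (U ^ 2 + U * X * C + X ^ 2))"
    by (simp add: power2_eq_square field_simps)
  ultimately have "0 < (4 - C ^ 2) * ((4 - R ^ 2) * (4 - C ^ 2) / 4 - (U ^ 2 + U * X * C + X ^ 2))" by linarith
  then have "0 < (4 - R ^ 2) * (4 - C ^ 2) / 4 - (U ^ 2 + U * X * C + X ^ 2)" using C by (simp add: zero_less_mult_iff)
  then show ?thesis by (simp add: U_def X_def C_def R_def)
qed

lemma star_element:
  assumes d: "idx i j k l"
  defines "w \<equiv> (a i j) ^ 2 + a i j * a i k * a j k + (a i k) ^ 2"
  shows "w \<in> OK" "nontriv \<phi> \<Longrightarrow> \<phi> w = \<phi> (a i j) ^ 2 + \<phi> (a i j) * \<phi> (a i k) * \<phi> (a j k) + \<phi> (a i k) ^ 2"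
    "nontriv \<phi> \<Longrightarrow> w \<noteq> 0 \<Longrightarrow> 0 < \<phi> w"
proof -
  have n: "i < N" "j < N" "k < N" "j \<noteq> k" using d by (auto simp: idx_def)
  show wOK: "w \<in> OK"
  proof -
    have "a i j * a i k * a j k \<in> OK" using OK_triangle[OF n(1-3)] by (simp add: mult_ac)
    then show ?thesis unfolding w_def using n by (simp add: OK_ring OK_square)
  qed
  show e: "\<phi> w = \<phi> (a i j) ^ 2 + \<phi> (a i j) * \<phi> (a i k) * \<phi> (a j k) + \<phi> (a i k) ^ 2" if "nontriv \<phi>" for \<phi>
    using n that by (simp add: w_def phi_simps E_intros entry_E)
  assume \<phi>: "nontriv \<phi>" and "w \<noteq> 0"
  then have "\<phi> w \<noteq> 0" using nontriv_simps(8)[OF \<phi> OK_E[OF wOK]] by simp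
  then show "0 < \<phi> w" using quad_form_pos[OF phi_sq_less_4[OF \<phi> n(2,3,4)]] unfolding e[OF \<phi>] by blast
qed

lemma star_label:
  assumes d: "idx i j k l" and z: "a j l = 0" "a k l = 0"
    and r: "0 \<le> a i l" "a i l < 2" "(a i l) ^ 2 = 2 \<or> (a i l) ^ 2 = a i l + 1"
    and p: "0 \<le> a i j" "a i j < 14" "0 \<le> a i k" "a i k < 2" "0 \<le> a j k" "a j k < 2"
    and w: "3 \<le> (a i j) ^ 2 + a i j * a i k * a j k + (a i k) ^ 2"
  shows "field_degree K \<le> enat 23"
proof (rule label_bound[OF _ _ r star_element(1)[OF d] w])
  show "i < N" "l < N" using d by (auto simp: idx_def)
  show "(a i j) ^ 2 + a i j * a i k * a j k + (a i k) ^ 2 \<le> 256" using quad_form_le p by blast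
  fix \<psi> assume \<psi>: "nontriv \<psi>"
  let ?w = "(a i j) ^ 2 + a i j * a i k * a j k + (a i k) ^ 2"
  have pos: "0 < \<psi> ?w" using star_element(3)[OF d \<psi>] w by simp
  have il: "\<psi> (a i l) ^ 2 < 4" using phi_sq_less_4[OF \<psi>, of i l] d by (simp add: idx_def)
  have "4 * \<psi> ?w < (4 - \<psi> (a i l) ^ 2) * (4 - \<psi> (a j k) ^ 2)"
    using star_form[OF \<psi> d z] star_element(2)[OF d \<psi>] by simp
  also have "\<dots> \<le> (4 - \<psi> (a i l) ^ 2) * 4" using il by (intro mult_left_mono) auto
  finally show "0 < \<psi> ?w \<and> \<psi> ?w < 4 - \<psi> (a i l) ^ 2" using pos by simp
qed

text \<open>With both labels at \<open>i\<close> equal to 1, the star inequality becomes 4w < 3(4 -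
  C^2), the region of \<open>aux_strip\<close>.\<close>

lemma star_plain:
  assumes d: "idx i j k l" and z: "a j l = 0" "a k l = 0" "a i k = 1" "a i l = 1"
    and p: "0 \<le> a i j" "a i j < 14" "0 \<le> a j k" "a j k < 2"
    and w: "3 < (a i j) ^ 2 + a i j * a j k + 1"
  shows "field_degree K \<le> enat 25"
proof -
  let ?w = "(a i j) ^ 2 + a i j * a i k * a j k + (a i k) ^ 2"
  have n: "i < N" "j < N" "k < N" "l < N" "j \<noteq> k" using d by (auto simp: idx_def)
  have w': "3 < ?w" using w z by simp
  have \<phi>: "0 < \<psi> ?w" "4 * \<psi> ?w < 3 * (4 - \<psi> (a j k) ^ 2)" if "nontriv \<psi>" for \<psi>
    using star_element(2,3)[OF d that] star_form[OF that d z(1,2)] w' z by (simp_all add: phi_simps[OF that])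
  have c: "4 - (a j k) ^ 2 \<in> OK" using n by (simp add: OK_ring OK_square)
  have phic: "\<psi> (4 - (a j k) ^ 2) = 4 - \<psi> (a j k) ^ 2" if "nontriv \<psi>" for \<psi>
    using n by (simp add: phi_simps[OF that] E_intros entry_E)
  show ?thesis
  \<comment> \<open>The strip polynomial contains the factor 4 - c = (a j k)^2 and would vanish
    identically here. In this case the squared entry itself has its nontrivial conjugates in (0,
    2).\<close>
  proof (cases "a j k = 0")
    case True
    have "field_degree K \<le> enat 23"
    proof (rule deg_4_3[of "(a i j) ^ 2 * (2 - (a i j) ^ 2)"])
      have u2: "2 < (a i j) ^ 2" using w True by simp
      show "(a i j) ^ 2 * (2 - (a i j) ^ 2) \<in> OK" using n by (simp add: OK_ring OK_square)
      have "(a i j) ^ 2 * (2 - (a i j) ^ 2) < 0" using u2 by (intro mult_pos_neg) auto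
      then show "(a i j) ^ 2 * (2 - (a i j) ^ 2) \<noteq> 0" "(a i j) ^ 2 * (2 - (a i j) ^ 2) \<noteq> 1" by auto
      have "(a i j) ^ 2 \<le> 14 ^ 2" using p by (intro power_mono) auto
      then have "\<bar>(a i j) ^ 2\<bar> * \<bar>2 - (a i j) ^ 2\<bar> \<le> 196 * 196" using u2 by (intro mult_mono) auto
      then show "\<bar>(a i j) ^ 2 * (2 - (a i j) ^ 2)\<bar> \<le> 200000" by (simp add: abs_mult)
      fix \<psi> assume \<psi>: "nontriv \<psi>"
      define U where "U = \<psi> (a i j)"
      have "4 * (U ^ 2 + 1) < 3 * 4"
        using star_form[OF \<psi> d z(1,2)] z True by (simp add: U_def phi_simps[OF \<psi>])
      moreover have "U \<noteq> 0" using nontriv_simps(8)[OF \<psi> entry_E[OF n(1,2)]] u2 by (auto simp: U_def)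
      ultimately have U: "0 < U ^ 2" "U ^ 2 < 2" by auto
      have e: "\<psi> ((a i j) ^ 2 * (2 - (a i j) ^ 2)) = U ^ 2 * (2 - U ^ 2)"
        using n by (simp add: U_def phi_simps[OF \<psi>] E_intros entry_E)
      have "0 \<le> (U ^ 2 - 1) ^ 2" by simp
      then have "U ^ 2 * (2 - U ^ 2) \<le> 1" by (simp add: power2_eq_square algebra_simps)
      then show "0 < \<psi> ((a i j) ^ 2 * (2 - (a i j) ^ 2)) \<and> \<psi> ((a i j) ^ 2 * (2 - (a i j) ^ 2)) < 4/3"
        unfolding e using U by (auto simp: mult_pos_pos)
    qed
    then show ?thesis by (rule order_trans) simp
  next
    case False
    have sq: "0 < (a j k) ^ 2" "(a j k) ^ 2 < 4" using False p power_strict_mono[of "a j k" 2 2] by auto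
    show ?thesis
    proof (rule deg_strip[OF star_element(1)[OF d] c])
      show "3 \<le> ?w" using w' by simp
      have "(a i j) ^ 2 \<le> 14 ^ 2" using p by (intro power_mono) auto
      moreover have "a i j * a j k \<le> 14 * 2" using p by (intro mult_mono) auto
      ultimately show "?w \<le> 225" using z by simp
      show "0 < 4 - (a j k) ^ 2" "4 - (a j k) ^ 2 < 4" using sq by auto
      fix \<psi> assume \<psi>: "nontriv \<psi>"
      have "\<psi> (a j k) \<noteq> 0" using nontriv_simps(8)[OF \<psi> entry_E[OF n(2,3)]] False by simp
      then show "0 < \<psi> ?w \<and> \<psi> (4 - (a j k) ^ 2) < 4 \<and> 4 * \<psi> ?w < 3 * \<psi> (4 - (a j k) ^ 2)"
        using \<phi>[OF \<psi>] phic[OF \<psi>] by simp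
    qed
  qed
qed

text \<open>Positivity of the determinant of the path k - i - j - l; the test vector is proportional
  to the adjugate column of \<open>j\<close>.\<close>

lemma chain_form:
  assumes \<phi>: "nontriv \<phi>" and d: "idx i j k l" and z: "a i l = 0" "a j k = 0" "a k l = 0"
  shows "4 * \<phi> (a i j) ^ 2 < (4 - \<phi> (a i k) ^ 2) * (4 - \<phi> (a j l) ^ 2)"
proof -
  define U S C where "U = \<phi> (a i j)" and "S = \<phi> (a i k)" and "C = \<phi> (a j l)"
  have S: "0 < 4 - S ^ 2" using phi_sq_less_4[OF \<phi>, of i k] d by (simp add: S_def idx_def)
  have "U * (4 * U) * (2 * (4 - S ^ 2)) + S * (4 * U) * (2 * U * S) + C * (2 * (4 - S ^ 2)) * (C * (4 - S ^ 2))
      < (4 * U) ^ 2 + (2 * (4 - S ^ 2)) ^ 2 + (2 * U * S) ^ 2 + (C * (4 - S ^ 2)) ^ 2"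
    using phi_neg4[OF \<phi> d, of "4 * U" "2 * (4 - S ^ 2)" "2 * U * S" "C * (4 - S ^ 2)"] S z
    by (simp add: U_def S_def C_def phi_simps[OF \<phi>])
  moreover have "(4 * U) ^ 2 + (2 * (4 - S ^ 2)) ^ 2 + (2 * U * S) ^ 2 + (C * (4 - S ^ 2)) ^ 2
      - (U * (4 * U) * (2 * (4 - S ^ 2)) + S * (4 * U) * (2 * U * S) + C * (2 * (4 - S ^ 2)) * (C * (4 - S ^ 2)))
      = (4 - S ^ 2) * ((4 - S ^ 2) * (4 - C ^ 2) - 4 * U ^ 2)"
    by (simp add: power2_eq_square algebra_simps)
  ultimately have "0 < (4 - S ^ 2) * ((4 - S ^ 2) * (4 - C ^ 2) - 4 * U ^ 2)" by linarith
  then show ?thesis using S by (simp add: zero_less_mult_iff U_def S_def C_def)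
qed

lemma chain_plain:
  assumes d: "idx i j k l" and z: "a i l = 0" "a j k = 0" "a k l = 0" "a i k = 1"
    and p: "0 \<le> a i j" "a i j < 14" "0 < a j l" "a j l < 2" and u: "3 \<le> (a i j) ^ 2"
  shows "field_degree K \<le> enat 25"
proof (rule deg_strip[of "(a i j) ^ 2" "4 - (a j l) ^ 2"])
  have n: "i < N" "j < N" "k < N" "l < N" using d by (auto simp: idx_def)
  show "(a i j) ^ 2 \<in> OK" "4 - (a j l) ^ 2 \<in> OK" using n by (simp_all add: OK_ring OK_square)
  show "3 \<le> (a i j) ^ 2" by (rule u)
  have "(a i j) ^ 2 \<le> 14 ^ 2" using p by (intro power_mono) auto
  then show "(a i j) ^ 2 \<le> 225" by simp
  show "0 < 4 - (a j l) ^ 2" "4 - (a j l) ^ 2 < 4" using p power_strict_mono[of "a j l" 2 2] by auto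
  fix \<psi> assume \<psi>: "nontriv \<psi>"
  have e: "\<psi> ((a i j) ^ 2) = \<psi> (a i j) ^ 2" "\<psi> (4 - (a j l) ^ 2) = 4 - \<psi> (a j l) ^ 2"
    using n by (simp_all add: phi_simps[OF \<psi>] E_intros entry_E)
  have "\<psi> (a i j) \<noteq> 0" using nontriv_simps(8)[OF \<psi> entry_E[OF n(1,2)]] u by auto
  moreover have "\<psi> (a j l) \<noteq> 0" using nontriv_simps(8)[OF \<psi> entry_E[OF n(2,4)]] p by auto
  ultimately show "0 < \<psi> ((a i j) ^ 2) \<and> \<psi> (4 - (a j l) ^ 2) < 4 \<and> 4 * \<psi> ((a i j) ^ 2) < 3 * \<psi> (4 - (a j l) ^ 2)"
    unfolding e using chain_form[OF \<psi> d z(1-3)] z(4) by (simp add: phi_simps[OF \<psi>])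
qed

text \<open>Both end labels have m at least 6. The middle entry is only asked to be at least 1,
  since a chain between two such labels may have the middle label 3.\<close>

lemma chain_large:
  assumes d: "idx i j k l" and z: "a i l = 0" "a j k = 0" "a k l = 0"
    and p: "1 \<le> a i j" "a i j < 14" "0 \<le> a i k" "a i k < 2" "3 \<le> (a i k) ^ 2" "0 \<le> a j l" "a j l < 2" "3 \<le> (a j l) ^ 2"
  shows "field_degree K \<le> enat 25"
proof (rule deg_product[of "(a i j) ^ 2" "4 - (a i k) ^ 2" "4 - (a j l) ^ 2"])
  have n: "i < N" "j < N" "k < N" "l < N" "i \<noteq> k" "j \<noteq> l" using d by (auto simp: idx_def)
  show "(a i j) ^ 2 \<in> OK" "4 - (a j l) ^ 2 \<in> OK" "4 - (a i k) ^ 2 \<in> OK" using n by (simp_all add: OK_ring OK_square)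
  show "1 \<le> (a i j) ^ 2" using p by simp
  have "(a i j) ^ 2 \<le> 14 ^ 2" using p by (intro power_mono) auto
  then show "(a i j) ^ 2 \<le> 196" by simp
  show "0 < 4 - (a i k) ^ 2" "4 - (a i k) ^ 2 \<le> 1" "0 < 4 - (a j l) ^ 2" "4 - (a j l) ^ 2 \<le> 1"
    using p power_strict_mono[of "a j l" 2 2] power_strict_mono[of "a i k" 2 2] by auto
  fix \<psi> assume \<psi>: "nontriv \<psi>"
  have e: "\<psi> ((a i j) ^ 2) = \<psi> (a i j) ^ 2" "\<psi> (4 - (a j l) ^ 2) = 4 - \<psi> (a j l) ^ 2" "\<psi> (4 - (a i k) ^ 2) = 4 - \<psi> (a i k) ^ 2"
    using n by (simp_all add: phi_simps[OF \<psi>] E_intros entry_E)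
  have "\<psi> (a i j) \<noteq> 0" using nontriv_simps(8)[OF \<psi> entry_E[OF n(1,2)]] p by auto
  moreover have "\<psi> (a j l) \<noteq> 0" using nontriv_simps(8)[OF \<psi> entry_E[OF n(2,4)]] p by auto
  moreover have "\<psi> (a i k) \<noteq> 0" using nontriv_simps(8)[OF \<psi> entry_E[OF n(1,3)]] p by auto
  ultimately show "0 < \<psi> ((a i j) ^ 2) \<and> 0 < \<psi> (4 - (a i k) ^ 2) \<and> \<psi> (4 - (a i k) ^ 2) < 4 \<and>
      0 < \<psi> (4 - (a j l) ^ 2) \<and> \<psi> (4 - (a j l) ^ 2) < 4 \<and> 4 * \<psi> ((a i j) ^ 2) < \<psi> (4 - (a i k) ^ 2) * \<psi> (4 - (a j l) ^ 2)"
    unfolding e using chain_form[OF \<psi> d z(1-3)] phi_sq_less_4[OF \<psi> n(1,3,5)] phi_sq_less_4[OF \<psi> n(2,4,6)] by simp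
qed

text \<open>The numbers \<open>2 cos (\<pi>/m)\<close> with \<open>m = 3, 4, 5\<close>.\<close>

definition small_label :: "real \<Rightarrow> bool" where
  "small_label r \<longleftrightarrow> 0 \<le> r \<and> r < 2 \<and> (r = 1 \<or> r ^ 2 = 2 \<or> r ^ 2 = r + 1)"

lemma golden_base:
  assumes "i < N" "j < N" "0 \<le> a i j" "a i j < 2" "(a i j) ^ 2 = a i j + 1"
  defines "b \<equiv> 4 - (a i j) ^ 2"
  shows "b \<in> OK" "b ^ 2 - 5 * b + 5 = 0" "1 < b" "b < 2"
    "nontriv \<phi> \<Longrightarrow> \<phi> b = 4 - \<phi> (a i j) ^ 2" "nontriv \<phi> \<Longrightarrow> \<phi> (a i j) ^ 2 = \<phi> (a i j) + 1"
proof -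
  define r where "r = a i j"
  have r: "r ^ 2 = r + 1" "0 \<le> r" "r < 2" using assms by (auto simp: r_def)
  have b: "b = 3 - r" using assms(5) by (simp add: b_def r_def)
  show "b \<in> OK" unfolding b_def using assms(1,2) by (intro OK_ring OK_square)
  show "b ^ 2 - 5 * b + 5 = 0" using r(1) unfolding b by (simp add: power2_eq_square algebra_simps)
  have r1: "1 < r"
  proof (rule ccontr)
    assume "\<not> 1 < r"
    then have "r * r \<le> 1 * r" using r by (intro mult_right_mono) auto
    then show False using r by (simp add: power2_eq_square)
  qed
  then show "1 < b" "b < 2" using r by (auto simp: b)
  show "\<phi> b = 4 - \<phi> (a i j) ^ 2" if "nontriv \<phi>" for \<phi>
    unfolding b_def using assms(1,2) by (simp add: phi_simps[OF that] E_intros entry_E)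
  show "\<phi> (a i j) ^ 2 = \<phi> (a i j) + 1" if \<phi>: "nontriv \<phi>" for \<phi>
  proof -
    have "\<phi> (a i j) ^ 2 = \<phi> ((a i j) ^ 2)" using assms(1,2) by (simp add: phi_simps[OF \<phi>] entry_E)
    also have "\<dots> = \<phi> (a i j + 1)" using assms(5) by simp
    also have "\<dots> = \<phi> (a i j) + 1" using assms(1,2) by (simp add: phi_simps[OF \<phi>] E_intros entry_E)
    finally show ?thesis .
  qed
qed

lemma two_phi:
  assumes "i < N" "j < N" "(a i j) ^ 2 = 2" "nontriv \<phi>" shows "\<phi> (a i j) ^ 2 = 2"
proof -
  have "\<phi> (a i j) ^ 2 = \<phi> ((a i j) ^ 2)" using assms(1,2) by (simp add: phi_simps[OF assms(4)] entry_E)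
  then show ?thesis using assms(3) phi_simps(7)[OF assms(4)] by simp
qed

text \<open>The determinant of the path gives U^2 (4 - R^2) < 4 (3 - R^2). According to the last
  label, U^2 is below 8/3, 2 or 4b/5 with b = 4 - R^2: this is where these three regions come
  from.\<close>

lemma path_degree:
  assumes d: "idx i j k l" and z: "a i k = 0" "a i l = 0" "a j l = 0" "a j k = 1"
    and r: "small_label (a k l)" and u: "0 \<le> a i j" "a i j < 14" "3 < (a i j) ^ 2"
  shows "field_degree K \<le> enat 25"
proof -
  have n: "i < N" "j < N" "k < N" "l < N" "k \<noteq> l" using d by (auto simp: idx_def)
  have w: "(a i j) ^ 2 \<in> OK" using n by (intro OK_square)
  have u196: "(a i j) ^ 2 \<le> 196" using power_mono[of "a i j" 14 2] u by simp
  have sq: "\<psi> ((a i j) ^ 2) = \<psi> (a i j) ^ 2" if "nontriv \<psi>" for \<psi> using n by (simp add: phi_simps[OF that] entry_E)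
  have pos: "0 < \<psi> (a i j) ^ 2" if "nontriv \<psi>" for \<psi> using nontriv_simps(8)[OF that entry_E[OF n(1,2)]] u by auto
  have form: "\<psi> (a i j) ^ 2 * (4 - \<psi> (a k l) ^ 2) < 4 * (3 - \<psi> (a k l) ^ 2)" if \<psi>: "nontriv \<psi>" for \<psi>
  proof -
    define U R D where "U = \<psi> (a i j)" and "R = \<psi> (a k l)" and "D = 4 - R ^ 2"
    have D: "0 < D" using phi_sq_less_4[OF \<psi> n(3-5)] by (simp add: D_def R_def)
    have "U * (U * D / 2) * D + D * 2 + R * 2 * R < (U * D / 2) ^ 2 + D ^ 2 + 2 ^ 2 + R ^ 2"
      using phi_neg4[OF \<psi> d, of "U * D / 2" D 2 R] D z by (simp add: U_def R_def phi_simps[OF \<psi>])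
    moreover have "R ^ 2 = 4 - D" by (simp add: D_def)
    ultimately have "D * (U ^ 2 * D) < D * (4 * (D - 1))" by (simp add: power2_eq_square algebra_simps)
    then have "U ^ 2 * D < 4 * (D - 1)" using D by simp
    then show ?thesis by (simp add: U_def R_def D_def)
  qed
  consider "a k l = 1" | "(a k l) ^ 2 = 2" | "(a k l) ^ 2 = a k l + 1" "0 \<le> a k l" "a k l < 2"
    using r by (auto simp: small_label_def)
  then show ?thesis
  proof cases
    case 1
    define v where "v = (a i j) ^ 2"
    have v: "3 < v" "v \<le> 196" using u u196 by (auto simp: v_def)
    have q: "0 < v ^ 2 - 3 * v + 1" "v ^ 2 - 3 * v + 1 \<le> 196 ^ 2"
    proof -
      have "0 \<le> v * (v - 3)" using v by simp
      then show "0 < v ^ 2 - 3 * v + 1" by (simp add: power2_eq_square algebra_simps)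
      have "v * v \<le> 196 * 196" using v by (intro mult_mono) auto
      then show "v ^ 2 - 3 * v + 1 \<le> 196 ^ 2" using v by (simp add: power2_eq_square)
    qed
    show ?thesis
    proof (rule deg_8_3[OF w, of "196 ^ 6"], fold v_def)
      show "v * (v - 1) * (v - 2) ^ 2 * (v ^ 2 - 3 * v + 1) \<noteq> 0" using v q by auto
      have "\<bar>v\<bar> * \<bar>v - 1\<bar> * \<bar>v - 2\<bar> ^ 2 * \<bar>v ^ 2 - 3 * v + 1\<bar> \<le> 196 * 196 * 196 ^ 2 * 196 ^ 2"
        using v q by (intro mult_mono power_mono) auto
      then show "\<bar>v * (v - 1) * (v - 2) ^ 2 * (v ^ 2 - 3 * v + 1)\<bar> \<le> 196 ^ 6" by (simp add: abs_mult)
      fix \<psi> assume \<psi>: "nontriv \<psi>"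
      show "0 < \<psi> v \<and> \<psi> v < 8/3" unfolding v_def sq[OF \<psi>] using pos[OF \<psi>] form[OF \<psi>] 1 by (simp add: phi_simps[OF \<psi>])
    qed (simp add: power_divide)
  next
    case 2
    have "field_degree K \<le> enat 23"
    proof (rule deg_4_3[of "(a i j) ^ 2 * (2 - (a i j) ^ 2)"])
      show "(a i j) ^ 2 * (2 - (a i j) ^ 2) \<in> OK" using w by (simp add: OK_ring)
      have "(a i j) ^ 2 * (2 - (a i j) ^ 2) < 0" using u by (intro mult_pos_neg) auto
      then show "(a i j) ^ 2 * (2 - (a i j) ^ 2) \<noteq> 0" "(a i j) ^ 2 * (2 - (a i j) ^ 2) \<noteq> 1" by auto
      have "\<bar>(a i j) ^ 2\<bar> * \<bar>2 - (a i j) ^ 2\<bar> \<le> 196 * 196" using u u196 by (intro mult_mono) auto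
      then show "\<bar>(a i j) ^ 2 * (2 - (a i j) ^ 2)\<bar> \<le> 200000" by (simp add: abs_mult)
      fix \<psi> assume \<psi>: "nontriv \<psi>"
      define U where "U = \<psi> (a i j)"
      have U: "0 < U ^ 2" "U ^ 2 < 2" using pos[OF \<psi>] form[OF \<psi>] two_phi[OF n(3,4) 2 \<psi>] by (auto simp: U_def)
      have e: "\<psi> ((a i j) ^ 2 * (2 - (a i j) ^ 2)) = U ^ 2 * (2 - U ^ 2)"
        using n by (simp add: U_def phi_simps[OF \<psi>] E_intros entry_E)
      have "0 \<le> (U ^ 2 - 1) ^ 2" by simp
      then have "U ^ 2 * (2 - U ^ 2) \<le> 1" by (simp add: power2_eq_square algebra_simps)
      then show "0 < \<psi> ((a i j) ^ 2 * (2 - (a i j) ^ 2)) \<and> \<psi> ((a i j) ^ 2 * (2 - (a i j) ^ 2)) < 4/3"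
        unfolding e using U by (auto simp: mult_pos_pos)
    qed
    then show ?thesis by (rule order_trans) simp
  next
    case 3
    note b = golden_base[OF n(3,4) 3(2,3,1)]
    have "field_degree K \<le> enat 23"
    proof (rule deg_golden[OF w b(1,2)])
      show "(a i j) ^ 2 \<noteq> 0" "(a i j) ^ 2 \<noteq> 1" "(a i j) ^ 2 \<noteq> 4 - (a k l) ^ 2 - 1" using u b(4) by auto
      show "\<bar>(a i j) ^ 2\<bar> \<le> 196" "\<bar>(a i j) ^ 2 - 1\<bar> \<le> 196" "\<bar>(a i j) ^ 2 - (4 - (a k l) ^ 2) + 1\<bar> \<le> 196"
        using u u196 b(3,4) by auto
      fix \<psi> assume \<psi>: "nontriv \<psi>"
      define R where "R = \<psi> (a k l)"
      have R: "R ^ 2 = R + 1" "R ^ 2 < 4" using b(6)[OF \<psi>] phi_sq_less_4[OF \<psi> n(3-5)] by (auto simp: R_def)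
      have "\<psi> (a i j) ^ 2 * (3 - R) < 4 * (2 - R)" using form[OF \<psi>] R by (simp add: R_def)
      \<comment> \<open>With R^2 = R + 1 one has 5 (2 - R) = (3 - R)^2, so one factor 3 - R can be
        cancelled.\<close>
      also have "5 * (4 * (2 - R)) = 4 * (3 - R) * (3 - R)" using R by (simp add: power2_eq_square algebra_simps)
      then have "4 * (2 - R) = (4 * (3 - R) / 5) * (3 - R)" by simp
      finally have "\<psi> (a i j) ^ 2 < 4 * (3 - R) / 5" using R by (simp add: mult_less_cancel_right)
      then show "0 < \<psi> ((a i j) ^ 2) \<and> \<psi> ((a i j) ^ 2) < 4 * \<psi> (4 - (a k l) ^ 2) / 5"
        unfolding sq[OF \<psi>] b(5)[OF \<psi>] using pos[OF \<psi>] R by (simp add: R_def)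
    qed (use b in auto)
    then show ?thesis by (rule order_trans) simp
  qed
qed

section \<open>Configurations containing a triangle or a square\<close>

lemma interval_minus_2_0:
  assumes u: "u \<in> OK" "1 < u" "u < 14" and \<phi>: "\<And>\<phi>. nontriv \<phi> \<Longrightarrow> - 2 < \<phi> u \<and> \<phi> u < 0"
  shows "field_degree K \<le> enat 23"
proof (rule deg_4_3[of "- (u * (u + 2))"])
  show "- (u * (u + 2)) \<in> OK" using u by (intro OK_intros)
  have "0 < u * (u + 2)" using u by simp
  then show "- (u * (u + 2)) \<noteq> 0" "- (u * (u + 2)) \<noteq> 1" by auto
  have "\<bar>u\<bar> * \<bar>u + 2\<bar> \<le> 14 * 16" using u by (intro mult_mono) auto
  then show "\<bar>- (u * (u + 2))\<bar> \<le> 200000" by (simp add: abs_mult)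
  fix \<psi> assume \<psi>: "nontriv \<psi>"
  have e: "\<psi> (- (u * (u + 2))) = - \<psi> u * (\<psi> u + 2)" by (simp add: phi_simps[OF \<psi>] E_intros OK_E[OF u(1)])
  have "0 \<le> (\<psi> u + 1) ^ 2" by simp
  then have "- \<psi> u * (\<psi> u + 2) \<le> 1" by (simp add: power2_eq_square algebra_simps)
  moreover have "0 < - \<psi> u * (\<psi> u + 2)" using \<phi>[OF \<psi>] by (intro mult_pos_pos) auto
  ultimately show "0 < \<psi> (- (u * (u + 2))) \<and> \<psi> (- (u * (u + 2))) < 4/3" unfolding e by simp
qed

text \<open>The entry itself is a cyclic product, as the other two sides of a triangle are 1. The
  vectors (1, -1, 0, 0) and (1, 1, 1, 1) confine its conjugates to (-2, 0).\<close>

lemma double_triangle_degree: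
  assumes d: "idx i j k l" and z: "a i k = 1" "a j k = 1" "a i l = 1" "a j l = 1" "a k l = 0" and u: "1 < a i j" "a i j < 14"
  shows "field_degree K \<le> enat 23"
proof (rule interval_minus_2_0[OF _ u])
  show "a i j \<in> OK" using OK_triangle[of i j k] d z by (simp add: idx_def)
  fix \<psi> assume \<psi>: "nontriv \<psi>"
  show "- 2 < \<psi> (a i j) \<and> \<psi> (a i j) < 0"
    using phi_neg4[OF \<psi> d, of 1 "- 1" 0 0] phi_neg4[OF \<psi> d, of 1 1 1 1] z by (simp add: phi_simps[OF \<psi>])
qed

text \<open>The entry is again integral. Vectors symmetric in \<open>i\<close> and \<open>j\<close>
  show that u + 2 satisfies the inequality that u^2 satisfies for the path with the same last label,
  so the same three regions occur.\<close>

lemma tailed_triangle_degree: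
  assumes d: "idx i j k l" and z: "a i k = 1" "a j k = 1" "a i l = 0" "a j l = 0" and r: "small_label (a k l)"
    and u: "1 < a i j" "a i j < 14"
  shows "field_degree K \<le> enat 23"
proof -
  have n: "i < N" "j < N" "k < N" "l < N" "k \<noteq> l" using d by (auto simp: idx_def)
  have uOK: "a i j \<in> OK" using OK_triangle[of i j k] n z by simp
  have lo: "- 2 < \<psi> (a i j)" if "nontriv \<psi>" for \<psi>
    using phi_neg4[OF that d, of 1 "- 1" 0 0] by simp
  have hi: "\<psi> (a i j) * (4 - \<psi> (a k l) ^ 2) < 2 * (4 - \<psi> (a k l) ^ 2) - 4" if \<psi>: "nontriv \<psi>" for \<psi>
  proof -
    define U R D where "U = \<psi> (a i j)" and "R = \<psi> (a k l)" and "D = 4 - R ^ 2"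
    have D: "0 < D" using phi_sq_less_4[OF \<psi> n(3-5)] by (simp add: D_def R_def)
    have "U * D * D + D * 4 + D * 4 + R * 4 * (2 * R) < D ^ 2 + D ^ 2 + 4 ^ 2 + (2 * R) ^ 2"
      using phi_neg4[OF \<psi> d, of D D 4 "2 * R"] D z by (simp add: U_def R_def phi_simps[OF \<psi>])
    moreover have "R ^ 2 = 4 - D" by (simp add: D_def)
    ultimately have "D * (U * D) < D * (2 * D - 4)" by (simp add: power2_eq_square algebra_simps)
    then have "U * D < 2 * D - 4" using D by simp
    then show ?thesis by (simp add: U_def R_def D_def)
  qed
  have x: "a i j + 2 \<in> OK" using uOK by (intro OK_intros)
  have phix: "\<psi> (a i j + 2) = \<psi> (a i j) + 2" if "nontriv \<psi>" for \<psi>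
    using n by (simp add: phi_simps[OF that] E_intros entry_E)
  consider "a k l = 1" | "(a k l) ^ 2 = 2" | "(a k l) ^ 2 = a k l + 1" "0 \<le> a k l" "a k l < 2"
    using r by (auto simp: small_label_def)
  then show ?thesis
  proof cases
    case 1
    define v where "v = a i j + 2"
    have v: "3 < v" "v \<le> 16" using u by (auto simp: v_def)
    have q: "0 < v ^ 2 - 3 * v + 1" "v ^ 2 - 3 * v + 1 \<le> 256"
    proof -
      have "0 \<le> v * (v - 3)" using v by simp
      then show "0 < v ^ 2 - 3 * v + 1" by (simp add: power2_eq_square algebra_simps)
      have "v * v \<le> 16 * 16" using v by (intro mult_mono) auto
      then show "v ^ 2 - 3 * v + 1 \<le> 256" using v by (simp add: power2_eq_square)
    qed
    show ?thesis
    proof (rule deg_8_3[OF x, of "16 ^ 6"], fold v_def)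
      show "v * (v - 1) * (v - 2) ^ 2 * (v ^ 2 - 3 * v + 1) \<noteq> 0" using v q by auto
      have "\<bar>v\<bar> * \<bar>v - 1\<bar> * \<bar>v - 2\<bar> ^ 2 * \<bar>v ^ 2 - 3 * v + 1\<bar> \<le> 16 * 16 * 16 ^ 2 * 256"
        using v q by (intro mult_mono power_mono) auto
      then show "\<bar>v * (v - 1) * (v - 2) ^ 2 * (v ^ 2 - 3 * v + 1)\<bar> \<le> 16 ^ 6" by (simp add: abs_mult)
      fix \<psi> assume \<psi>: "nontriv \<psi>"
      show "0 < \<psi> v \<and> \<psi> v < 8/3" unfolding v_def phix[OF \<psi>] using lo[OF \<psi>] hi[OF \<psi>] 1 by (simp add: phi_simps[OF \<psi>])
    qed (simp add: power_divide)
  next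
    case 2
    show ?thesis
      by (rule interval_minus_2_0[OF uOK u]) (use lo hi two_phi[OF n(3,4) 2] in fastforce)
  next
    case 3
    note b = golden_base[OF n(3,4) 3(2,3,1)]
    show ?thesis
    proof (rule deg_golden[OF x b(1,2)])
      show "a i j + 2 \<noteq> 0" "a i j + 2 \<noteq> 1" "a i j + 2 \<noteq> 4 - (a k l) ^ 2 - 1" using u b(4) by auto
      show "\<bar>a i j + 2\<bar> \<le> 196" "\<bar>a i j + 2 - 1\<bar> \<le> 196" "\<bar>a i j + 2 - (4 - (a k l) ^ 2) + 1\<bar> \<le> 196"
        using u b(3,4) by auto
      fix \<psi> assume \<psi>: "nontriv \<psi>"
      define R where "R = \<psi> (a k l)"
      have R: "R ^ 2 = R + 1" "R ^ 2 < 4" using b(6)[OF \<psi>] phi_sq_less_4[OF \<psi> n(3-5)] by (auto simp: R_def)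
      have "(\<psi> (a i j) + 2) * (3 - R) < 4 * (2 - R)" using hi[OF \<psi>] R by (simp add: R_def algebra_simps)
      also have "5 * (4 * (2 - R)) = 4 * (3 - R) * (3 - R)" using R by (simp add: power2_eq_square algebra_simps)
      then have "4 * (2 - R) = (4 * (3 - R) / 5) * (3 - R)" by simp
      finally have "\<psi> (a i j) + 2 < 4 * (3 - R) / 5" using R by (simp add: mult_less_cancel_right)
      then show "0 < \<psi> (a i j + 2) \<and> \<psi> (a i j + 2) < 4 * \<psi> (4 - (a k l) ^ 2) / 5"
        unfolding phix[OF \<psi>] b(5)[OF \<psi>] using lo[OF \<psi>] R by (simp add: R_def)
    qed (use b in auto)
  qed
qed

text \<open>The reflection exchanging \<open>i\<close> with \<open>j\<close> and \<open>k\<close>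
  with \<open>l\<close> splits the form; a symmetric and an antisymmetric vector bound U from above
  and below. Integrality is known for \<open>a i j * a k l\<close>, so each label needs its own
  auxiliary element.\<close>

lemma square_degree:
  assumes d: "idx i j k l" and z: "a j k = 1" "a i l = 1" "a i k = 0" "a j l = 0" and r: "small_label (a k l)"
    and u: "3 < (a i j) ^ 2" "1 < a i j" "a i j < 14"
  shows "field_degree K \<le> enat 25"
proof -
  have n: "i < N" "j < N" "k < N" "l < N" "k \<noteq> l" using d by (auto simp: idx_def)
  have ur: "a i j * a k l \<in> OK" using OK_quadrangle[OF n(1-4)] z by simp
  have R4: "- 2 < \<psi> (a k l)" "\<psi> (a k l) < 2" if "nontriv \<psi>" for \<psi>
    using phi_sq_less_4[OF that n(3-5)] abs_less_iff[of "\<psi> (a k l)" 2] power2_less_imp_less[of "\<bar>\<psi> (a k l)\<bar>" 2] by auto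
  have hi: "\<psi> (a i j) * (2 - \<psi> (a k l)) < 2 * (2 - \<psi> (a k l)) - 1" if \<psi>: "nontriv \<psi>" for \<psi>
  proof -
    define U R s where "U = \<psi> (a i j)" and "R = \<psi> (a k l)" and "s = 2 - R"
    have s: "0 < s" using R4[OF \<psi>] by (simp add: s_def R_def)
    have "U * s * s + s + s + R < s ^ 2 + s ^ 2 + 1 + 1"
      using phi_neg4[OF \<psi> d, of s s 1 1] s z by (simp add: U_def R_def phi_simps[OF \<psi>])
    moreover have "R = 2 - s" by (simp add: s_def)
    ultimately have "s * (U * s) < s * (2 * s - 1)" by (simp add: power2_eq_square algebra_simps)
    then have "U * s < 2 * s - 1" using s by simp
    then show ?thesis by (simp add: U_def R_def s_def)
  qed
  have lo: "- \<psi> (a i j) * (2 + \<psi> (a k l)) < 2 * (2 + \<psi> (a k l)) - 1" if \<psi>: "nontriv \<psi>" for \<psi>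
  proof -
    define U R s where "U = \<psi> (a i j)" and "R = \<psi> (a k l)" and "s = 2 + R"
    have s: "0 < s" using R4[OF \<psi>] by (simp add: s_def R_def)
    have "- (U * s * s) + s + s - R < s ^ 2 + s ^ 2 + 1 + 1"
      using phi_neg4[OF \<psi> d, of s "- s" "- 1" 1] s z by (simp add: U_def R_def phi_simps[OF \<psi>])
    moreover have "R = s - 2" by (simp add: s_def)
    ultimately have "s * (- U * s) < s * (2 * s - 1)" by (simp add: power2_eq_square algebra_simps)
    then have "- U * s < 2 * s - 1" using s by (simp only: mult_less_cancel_left_pos)
    then show ?thesis by (simp add: U_def R_def s_def)
  qed
  consider "a k l = 1" | "(a k l) ^ 2 = 2" "0 \<le> a k l" "a k l < 2" | "(a k l) ^ 2 = a k l + 1" "0 \<le> a k l" "a k l < 2"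
    using r by (auto simp: small_label_def)
  then show ?thesis
  proof cases
    case 1
    \<comment> \<open>The bounds give -5/3 < U < 1, an interval of length 8/3.\<close>
    define v where "v = 1 - a i j"
    have x: "v \<in> OK" using ur 1 unfolding v_def by (intro OK_intros) simp
    have v: "v < 0" "- 13 < v" using u by (auto simp: v_def)
    have q: "0 < v ^ 2 - 3 * v + 1" "v ^ 2 - 3 * v + 1 \<le> 256"
    proof -
      show "0 < v ^ 2 - 3 * v + 1" using v zero_le_power2[of v] by linarith
      have "(- v) * (- v) \<le> 13 * 13" using v by (intro mult_mono) auto
      then show "v ^ 2 - 3 * v + 1 \<le> 256" using v by (simp add: power2_eq_square)
    qed
    show ?thesis
    proof (rule deg_8_3[OF x, of "16 ^ 6"])
      show "v * (v - 1) * (v - 2) ^ 2 * (v ^ 2 - 3 * v + 1) \<noteq> 0" using v q by auto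
      have "\<bar>v\<bar> * \<bar>v - 1\<bar> * \<bar>v - 2\<bar> ^ 2 * \<bar>v ^ 2 - 3 * v + 1\<bar> \<le> 16 * 16 * 16 ^ 2 * 256"
        using v q by (intro mult_mono power_mono) auto
      then show "\<bar>v * (v - 1) * (v - 2) ^ 2 * (v ^ 2 - 3 * v + 1)\<bar> \<le> 16 ^ 6" by (simp add: abs_mult)
      fix \<psi> assume \<psi>: "nontriv \<psi>"
      have "\<psi> v = 1 - \<psi> (a i j)" using n by (simp add: v_def phi_simps[OF \<psi>] E_intros entry_E)
      then show "0 < \<psi> v \<and> \<psi> v < 8/3" using lo[OF \<psi>] hi[OF \<psi>] 1 by (simp add: phi_simps[OF \<psi>])
    qed (simp add: power_divide)
  next
    case 2
    \<comment> \<open>Completing the square, 4v + 2 = (2u + r)^2, where |2U + R| < 2 under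
      nontrivial embeddings. The conjugates of \<open>v\<close> thus lie in (-1/2, 1/2), and
      \<open>v ^ 2\<close> has them positive.\<close>
    define v where "v = (a i j) ^ 2 + a i j * a k l"
    have x: "v \<in> OK" using ur n unfolding v_def by (simp add: OK_ring OK_square)
    have "(a i j) ^ 2 \<le> 14 ^ 2" using u by (intro power_mono) auto
    moreover have "a i j * a k l \<le> 14 * 2" "0 \<le> a i j * a k l" using u 2 mult_mono[of "a i j" 14 "a k l" 2] by auto
    ultimately have v: "3 < v" "v \<le> 224" using u unfolding v_def by auto
    have "field_degree K \<le> enat 23"
    proof (rule deg_4_3[of "v ^ 2"])
      show "v ^ 2 \<in> OK" using x by (intro OK_intros)
      have "3 ^ 2 < v ^ 2" using v by (intro power_strict_mono) auto
      then show "v ^ 2 \<noteq> 0" "v ^ 2 \<noteq> 1" by auto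
      have "v ^ 2 \<le> 224 ^ 2" using v by (intro power_mono) auto
      then show "\<bar>v ^ 2\<bar> \<le> 200000" by simp
      fix \<psi> assume \<psi>: "nontriv \<psi>"
      define U R where "U = \<psi> (a i j)" and "R = \<psi> (a k l)"
      have R: "R ^ 2 = 2" "- 2 < R" "R < 2" using two_phi[OF n(3,4) 2(1) \<psi>] R4[OF \<psi>] by (auto simp: R_def)
      \<comment> \<open>Multiplying by 2 + R clears the coefficient, as (2 + R)(2 - R) = 2.\<close>
      have "(2 + R) * (U * (2 - R)) < (2 + R) * (2 * (2 - R) - 1)" using hi[OF \<psi>] R by (intro mult_strict_left_mono) (auto simp: U_def R_def)
      moreover have RR: "R * R = 2" using R(1) by (simp add: power2_eq_square)
      moreover have "(2 + R) * (U * (2 - R)) = U * (4 - R * R)" "(2 + R) * (2 * (2 - R) - 1) = 6 - R - 2 * (R * R)"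
        by (simp_all add: algebra_simps)
      ultimately have h: "2 * U < 2 - R" by simp
      have "(2 - R) * (- U * (2 + R)) < (2 - R) * (2 * (2 + R) - 1)" using lo[OF \<psi>] R by (intro mult_strict_left_mono) (auto simp: U_def R_def)
      moreover have "(2 - R) * (- U * (2 + R)) = - U * (4 - R * R)" "(2 - R) * (2 * (2 + R) - 1) = 6 + R - 2 * (R * R)"
        by (simp_all add: algebra_simps)
      ultimately have "- U * (4 - R * R) < 6 + R - 2 * (R * R)" by (simp only:)
      then have l: "- 2 * U < 2 + R" unfolding RR by simp
      have e: "\<psi> v = U ^ 2 + U * R" using n by (simp add: v_def U_def R_def phi_simps[OF \<psi>] E_intros entry_E)
      have "\<bar>2 * U + R\<bar> < 2" using h l by linarith
      then have "(2 * U + R) ^ 2 < 2 ^ 2" using power_strict_mono[of "\<bar>2 * U + R\<bar>" 2 2] by simp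
      moreover have "(2 * U + R) ^ 2 = 4 * \<psi> v + 2" using RR by (simp add: e power2_eq_square algebra_simps)
      ultimately have "4 * \<psi> v + 2 < 4" by simp
      with \<open>(2 * U + R) ^ 2 = 4 * \<psi> v + 2\<close> have "\<bar>\<psi> v\<bar> < 1" using zero_le_power2[of "2 * U + R"] by linarith
      then have "\<psi> v ^ 2 < 1" using power_strict_mono[of "\<bar>\<psi> v\<bar>" 1 2] by simp
      moreover have "\<psi> v \<noteq> 0" using nontriv_simps(8)[OF \<psi> OK_E[OF x]] v by simp
      ultimately show "0 < \<psi> (v ^ 2) \<and> \<psi> (v ^ 2) < 4/3" by (simp add: phi_simps[OF \<psi>] OK_E[OF x])
    qed
    then show ?thesis by (rule order_trans) simp
  next
    case 3
    note b = golden_base[OF n(3,4) 3(2,3,1)]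
    define r where "r = a k l"
    have r: "r ^ 2 = r + 1" "1 < r" "r < 2" using 3 b(3,4) by (auto simp: r_def)
    have rOK: "r \<in> OK"
    proof -
      have "r ^ 2 - 1 \<in> OK" using OK_square[OF n(3,4)] unfolding r_def by (simp add: OK_ring)
      then show ?thesis using r by simp
    qed
    have uOK: "a i j \<in> OK"
    proof -
      \<comment> \<open>r (r - 1) = 1, so integrality passes from the product u r to u
        itself.\<close>
      have "a i j * r * (r - 1) \<in> OK" using ur rOK unfolding r_def by (simp add: OK_ring)
      moreover have "a i j * r * (r - 1) = a i j * (r ^ 2 - r)" by (simp add: power2_eq_square algebra_simps)
      ultimately show ?thesis using r by simp
    qed
    have x: "1 - r - a i j \<in> OK" using rOK uOK by (intro OK_intros)
    have bb: "4 - (a k l) ^ 2 = 3 - r" using r by (simp add: r_def)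
    have "field_degree K \<le> enat 23"
    proof (rule deg_golden[OF x b(1,2)])
      show "1 - r - a i j \<noteq> 0" "1 - r - a i j \<noteq> 1" "1 - r - a i j \<noteq> 4 - (a k l) ^ 2 - 1" unfolding bb using u r by auto
      show "\<bar>1 - r - a i j\<bar> \<le> 196" "\<bar>1 - r - a i j - 1\<bar> \<le> 196" "\<bar>1 - r - a i j - (4 - (a k l) ^ 2) + 1\<bar> \<le> 196"
        unfolding bb using u r by auto
      fix \<psi> assume \<psi>: "nontriv \<psi>"
      define U R where "U = \<psi> (a i j)" and "R = \<psi> (a k l)"
      have R: "R ^ 2 = R + 1" "- 2 < R" "R < 2" using b(6)[OF \<psi>] R4[OF \<psi>] by (auto simp: R_def)
      have e: "\<psi> (1 - r - a i j) = 1 - R - U" using n by (simp add: U_def R_def r_def phi_simps[OF \<psi>] E_intros entry_E)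
      have R1: "0 < 1 + R" 
      proof (rule ccontr)
        assume "\<not> 0 < 1 + R"
        then have "R ^ 2 \<le> 0" using R by simp
        then have "R = 0" by simp
        with R(1) show False by simp
      qed
      \<comment> \<open>The multipliers 1 + R and, below, 3 - R are chosen since (1 + R)(2 - R) = 1
        and (3 - R)(2 + R) = 5.\<close>
      have "(1 + R) * (U * (2 - R)) < (1 + R) * (2 * (2 - R) - 1)" using hi[OF \<psi>] R1 by (intro mult_strict_left_mono) (auto simp: U_def R_def)
      moreover have RR: "R * R = R + 1" using R(1) by (simp add: power2_eq_square)
      moreover have "(1 + R) * (U * (2 - R)) = U * (2 + R - R * R)" "(1 + R) * (2 * (2 - R) - 1) = 3 + R - 2 * (R * R)"
        by (simp_all add: algebra_simps)
      ultimately have h: "U < 1 - R" by simp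
      have "(3 - R) * (- U * (2 + R)) < (3 - R) * (2 * (2 + R) - 1)" using lo[OF \<psi>] R by (intro mult_strict_left_mono) (auto simp: U_def R_def)
      moreover have "(3 - R) * (- U * (2 + R)) = - U * (6 + R - R * R)" "(3 - R) * (2 * (2 + R) - 1) = 9 + 3 * R - 2 * (R * R)"
        by (simp_all add: algebra_simps)
      ultimately have "- U * (6 + R - R * R) < 9 + 3 * R - 2 * (R * R)" by (simp only: algebra_simps)
      then have "- U * 5 < 7 + R" unfolding RR by simp
      then have l: "1 - R - U < 4 * (3 - R) / 5" by simp
      show "0 < \<psi> (1 - r - a i j) \<and> \<psi> (1 - r - a i j) < 4 * \<psi> (4 - (a k l) ^ 2) / 5"
        unfolding e b(5)[OF \<psi>] using h l R(1) by (simp add: R_def)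
    qed (use b in auto)
    then show ?thesis by (rule order_trans) simp
  qed
qed

end

section \<open>The four-vertex types\<close>

lemma cc_simps: "cc 2 = 0" "cc 3 = 1" "(cc 4) ^ 2 = 2" "(cc 5) ^ 2 = cc 5 + 1"
proof -
  show "cc 2 = 0" "cc 3 = 1" by (simp_all add: cc_def cos_60)
  show "(cc 4) ^ 2 = 2" by (simp add: cc_def cos_45 power_divide)
  define C where "C = cos (pi / 5)"
  have C: "0 < C" unfolding C_def by (rule cos_gt_zero) auto
  \<comment> \<open>The angles 3 pi/5 and 2 pi/5 are supplementary; equating their cosines gives a
    cubic for cos (pi/5), from which the root -1 is split off.\<close>
  have "cos (3 * (pi / 5)) = - cos (pi - 3 * (pi / 5))" by (simp only: cos_pi_minus minus_minus)
  also have "pi - 3 * (pi / 5) = 2 * (pi / 5)" by simp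
  finally have "4 * C ^ 3 - 3 * C = - (2 * C ^ 2 - 1)"
    unfolding cos_treble_cos cos_double_cos C_def .
  then have "(C + 1) * (4 * C ^ 2 - 2 * C - 1) = 0" by (simp add: power2_eq_square power3_eq_cube algebra_simps)
  then have "4 * C ^ 2 = 2 * C + 1" using C by simp
  then show "(cc 5) ^ 2 = cc 5 + 1" by (simp add: cc_def C_def power_mult_distrib)
qed

lemma cc_bounds: assumes "2 \<le> n" shows "0 \<le> cc n" "cc n < 2"
proof -
  have "pi / real n \<le> pi / 2" using assms by (intro divide_left_mono) auto
  moreover have "0 < pi / real n" using assms by simp
  ultimately have n: "0 < pi / real n" "pi / real n \<le> pi / 2" by auto
  then show "0 \<le> cc n" unfolding cc_def using cos_ge_zero[of "pi / real n"] by simp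
  have "cos (pi / real n) < cos 0" using n pi_gt_zero by (intro cos_monotone_0_pi) linarith+
  then show "cc n < 2" by (simp add: cc_def)
qed

lemma cc_ge_6: assumes "6 \<le> n" shows "3 \<le> (cc n) ^ 2"
proof -
  have "pi / real n \<le> pi / 6" using assms by (intro divide_left_mono) auto
  moreover have "pi / 6 \<le> pi" by simp
  ultimately have "cos (pi / 6) \<le> cos (pi / real n)" by (intro cos_monotone_0_pi_le) auto
  then have "sqrt 3 \<le> cc n" by (simp add: cos_30 cc_def)
  then have "sqrt 3 ^ 2 \<le> (cc n) ^ 2" by (intro power_mono) auto
  then show ?thesis by simp
qed

text \<open>The numbers \<open>2 cos (\<pi>/m)\<close> with \<open>m = 4, 5\<close>; in a \<open>label\<close>, the last alternative is \<open>m \<ge> 6\<close>.\<close>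

definition mid_label :: "real \<Rightarrow> bool" where
  "mid_label r \<longleftrightarrow> 0 \<le> r \<and> r < 2 \<and> (r ^ 2 = 2 \<or> r ^ 2 = r + 1)"

definition label :: "real \<Rightarrow> bool" where
  "label r \<longleftrightarrow> r = 0 \<or> r = 1 \<or> mid_label r \<or> (0 \<le> r \<and> r < 2 \<and> 3 \<le> r ^ 2)"

lemma mid_label_cc: "n = 4 \<or> n = 5 \<Longrightarrow> mid_label (cc n)"
  using cc_simps cc_bounds[of n] by (auto simp: mid_label_def)

lemma label_cc: assumes "2 \<le> n" shows "label (cc n)"
proof -
  consider "n = 2" | "n = 3" | "n = 4 \<or> n = 5" | "6 \<le> n" using assms by linarith
  then show ?thesis
    by cases (use cc_simps(1,2) mid_label_cc cc_ge_6 cc_bounds[OF assms] in \<open>auto simp: label_def\<close>)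
qed

lemma label_bounds: assumes "label r" shows "0 \<le> r" "r < 2" "r \<noteq> 0 \<Longrightarrow> 1 \<le> r" "r \<noteq> 0 \<Longrightarrow> 1 \<le> r ^ 2"
proof -
  show b: "0 \<le> r" "r < 2" using assms by (auto simp: label_def mid_label_def)
  assume "r \<noteq> 0"
  then show "1 \<le> r ^ 2" using assms b by (auto simp: label_def mid_label_def)
  then show "1 \<le> r" using b by (simp add: power2_nonneg_ge_1_iff)
qed

lemma mid_label_less_3: assumes "mid_label r" shows "1 \<le> r" "r ^ 2 < 3" 
proof -
  show "r ^ 2 < 3" using assms by (auto simp: mid_label_def)
  show "1 \<le> r" by (rule label_bounds(3)) (use assms in \<open>auto simp: label_def mid_label_def\<close>)
qed

section \<open>Case analysis for a heavy edge among four vertices\<close>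

context v_arithmetic begin

lemma small_label_iff: "small_label r \<longleftrightarrow> r = 1 \<or> mid_label r"
  by (auto simp: small_label_def mid_label_def)

lemma entry_label:
  assumes "i < N" "j < N" "i \<noteq> j" "a i j < 2" shows "label (a i j)"
proof -
  obtain m where "2 \<le> m" "a i j = cc m"
    using fund[unfolded fundamental_matrix_def] assms unfolding cc_def by blast
  then show ?thesis using label_cc by simp
qed

lemma entry_nonneg: "i < N \<Longrightarrow> j < N \<Longrightarrow> i \<noteq> j \<Longrightarrow> 0 \<le> a i j"
  using fund[unfolded fundamental_matrix_def] by blast

lemma idx_symm:
  assumes "idx i j k l"
  shows "a j i = a i j" "a k i = a i k" "a l i = a i l" "a k j = a j k" "a l j = a j l" "a l k = a k l"
    "i < N" "j < N" "k < N" "l < N" "i \<noteq> j" "i \<noteq> k" "i \<noteq> l" "j \<noteq> k" "j \<noteq> l" "k \<noteq> l"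
  using assms by (auto simp: idx_def intro: symm)

lemma idx_swap:
  assumes "idx i j k l" shows "idx j i k l" "idx i j l k" "idx j i l k"
  using assms by (auto simp: idx_def)

text \<open>A label 4 or 5 next to a heavy edge settles the case at once: all terms of the triangle
  expression are nonnegative, and the squared heavy edge alone reaches 3.\<close>

lemma edge_label:
  assumes d: "idx i j k l" and u: "0 \<le> a i j" "a i j < 14" "3 \<le> (a i j) ^ 2"
    and m: "mid_label (a i k)" and p: "0 \<le> a j k" "a j k < 2"
  shows "field_degree K \<le> enat 23"
proof (rule triangle_label)
  show "distinct [i, j, k]" "i < N" "j < N" "k < N" using d by (auto simp: idx_def)
  have "0 \<le> a i j * a j k * a i k" using u m p by (simp add: mid_label_def)
  then show "3 \<le> (a i j) ^ 2 + a i j * a j k * a i k + (a j k) ^ 2"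
    using u(3) zero_le_power2[of "a j k"] by linarith
qed (use u m p in \<open>auto simp: mid_label_def\<close>)

lemma le_25: "field_degree K \<le> enat 23 \<Longrightarrow> field_degree K \<le> enat 25"
  by (erule order_trans) simp

lemma pair_edge_label:
  assumes d: "idx i j k l" and u: "0 \<le> a i j" "a i j < 14" "3 \<le> (a i j) ^ 2"
    and b: "label (a i k)" "label (a j k)" "label (a i l)" "label (a j l)"
    and m: "mid_label (a i k) \<or> mid_label (a j k) \<or> mid_label (a i l) \<or> mid_label (a j l)"
  shows "field_degree K \<le> enat 23"
  using m edge_label[OF d] edge_label[OF idx_swap(1)[OF d]] edge_label[OF idx_swap(2)[OF d]] edge_label[OF idx_swap(3)[OF d]]
    u label_bounds[OF b(1)] label_bounds[OF b(2)] label_bounds[OF b(3)] label_bounds[OF b(4)] idx_symm(1)[OF d]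
  by auto

lemma chain_degree:
  assumes d: "idx i j k l" and z: "a i l = 0" "a j k = 0" "a k l = 0" and u: "1 \<le> a i j" "a i j < 14" "3 \<le> (a i j) ^ 2"
    and p: "label (a i k)" "a i k \<noteq> 0" "\<not> mid_label (a i k)" "label (a j l)" "a j l \<noteq> 0" "\<not> mid_label (a j l)"
  shows "field_degree K \<le> enat 25"
proof -
  note b = label_bounds[OF p(1)] label_bounds[OF p(4)] and s = idx_symm[OF d]
  consider "a i k = 1" | "a j l = 1" | "3 \<le> (a i k) ^ 2" "3 \<le> (a j l) ^ 2" using p by (auto simp: label_def)
  then show ?thesis
  proof cases
    case 1
    show ?thesis by (rule chain_plain[OF d]) (use 1 z u b p in auto)
  next
    case 2
    show ?thesis by (rule chain_plain[OF idx_swap(3)[OF d]]) (use 2 z u b p s in auto)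
  next
    case 3
    show ?thesis by (rule chain_large[OF d]) (use 3 z u b p in auto)
  qed
qed

text \<open>Once labels 4 and 5 at \<open>i\<close> and \<open>j\<close> are disposed of, the
  determinants of the triangles i, k, l and j, k, l leave only stars, double triangles and chains
  when \<open>k\<close>, \<open>l\<close> are not joined, and tailed triangles, squares and paths
  when they are.\<close>

lemma pair_degree:
  assumes d: "idx i j k l" and u: "1 < a i j" "a i j < 14" "3 < (a i j) ^ 2"
    and lab: "label (a i k)" "label (a j k)" "label (a i l)" "label (a j l)" "label (a k l)"
    and det: "(a i k) ^ 2 + (a k l) ^ 2 + (a i l) ^ 2 + a i k * a k l * a i l < 4"
      "(a j k) ^ 2 + (a k l) ^ 2 + (a j l) ^ 2 + a j k * a k l * a j l < 4"
    and con: "a i k \<noteq> 0 \<or> a j k \<noteq> 0" "a i l \<noteq> 0 \<or> a j l \<noteq> 0 \<or> a k l \<noteq> 0"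
  shows "field_degree K \<le> enat 25"
proof (cases "mid_label (a i k) \<or> mid_label (a j k) \<or> mid_label (a i l) \<or> mid_label (a j l)")
  case True
  then show ?thesis using u lab by (intro le_25 pair_edge_label[OF d]) auto
next
  case False
  note b = label_bounds[OF lab(1)] label_bounds[OF lab(2)] label_bounds[OF lab(3)] label_bounds[OF lab(4)] label_bounds[OF lab(5)]
  note s = idx_symm[OF d]
  \<comment> \<open>Both labels are 1 or have square at least 3. Two nonzero ones must be 1, because
    1 + 3 already reaches 4; then q^2 + q < 2 excludes every nonzero label \<open>q\<close>.\<close>
  have excl: "x = 0 \<or> y = 0 \<or> (x = 1 \<and> y = 1 \<and> q = 0)"
    if "label x" "label y" "label q" "\<not> mid_label x" "\<not> mid_label y" "x ^ 2 + q ^ 2 + y ^ 2 + x * q * y < 4" for x y q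
  proof (rule ccontr)
    assume n: "\<not> ?thesis"
    note l = label_bounds[OF that(1)] label_bounds[OF that(2)] label_bounds[OF that(3)]
    have nn: "0 \<le> x * q * y" "0 \<le> q ^ 2" using l by auto
    have "1 \<le> x ^ 2" "1 \<le> y ^ 2" using n l by auto
    moreover have "x = 1 \<or> 3 \<le> x ^ 2" "y = 1 \<or> 3 \<le> y ^ 2" using that n by (auto simp: label_def)
    ultimately have xy: "x = 1" "y = 1" using that(6) nn by linarith+
    then have "q \<noteq> 0" using n by auto
    then have "1 \<le> q ^ 2" "1 \<le> q" using l(11,12) by blast+
    moreover have "q ^ 2 + q < 2" using that(6) unfolding xy by simp
    ultimately show False by linarith
  qed
  note e1 = excl[OF lab(1,3,5) _ _ det(1)] and e2 = excl[OF lab(2,4,5) _ _ det(2)]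
  have E1: "a i k = 0 \<or> a i l = 0 \<or> (a i k = 1 \<and> a i l = 1 \<and> a k l = 0)" using e1 False by simp
  have E2: "a j k = 0 \<or> a j l = 0 \<or> (a j k = 1 \<and> a j l = 1 \<and> a k l = 0)" using e2 False by simp
  have gt: "3 < (a i j) ^ 2 + a i j * x + 1" if "0 \<le> x" for x
  proof -
    have "0 \<le> a i j * x" using u that by simp
    then show ?thesis using u by linarith
  qed
  show ?thesis
  proof (cases "a k l = 0")
    case q: True
    consider "a i k = 1" "a i l = 1" "a j l = 0" | "a i k = 1" "a i l = 1" "a j k = 0"
      | "a i k = 1" "a i l = 1" "a j k = 1" "a j l = 1"
      | "a j k = 1" "a j l = 1" "a i l = 0" | "a j k = 1" "a j l = 1" "a i k = 0"
      | "a i k \<noteq> 0" "a i l = 0" "a j k = 0" "a j l \<noteq> 0" | "a i k = 0" "a i l \<noteq> 0" "a j k \<noteq> 0" "a j l = 0"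
      using E1 E2 con q by blast
    then show ?thesis
    proof cases
      case 1
      show ?thesis by (rule star_plain[OF d]) (use 1 q u b gt in auto)
    next
      case 2
      show ?thesis by (rule star_plain[OF idx_swap(2)[OF d]]) (use 2 q u b gt s in auto)
    next
      case 3
      show ?thesis by (rule le_25, rule double_triangle_degree[OF d]) (use 3 q u in auto)
    next
      case 4
      show ?thesis by (rule star_plain[OF idx_swap(1)[OF d]]) (use 4 q u b gt s in auto)
    next
      case 5
      show ?thesis by (rule star_plain[OF idx_swap(3)[OF d]]) (use 5 q u b gt s in auto)
    next
      case 6
      show ?thesis by (rule chain_degree[OF d]) (use 6 q u lab False in auto)
    next
      case 7
      show ?thesis by (rule chain_degree[OF idx_swap(2)[OF d]]) (use 7 q u lab False s in auto)
    qed
  next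
    case q: False
    then have q1: "1 \<le> (a k l) ^ 2" using b by blast
    have "x = 0 \<or> x = 1 \<and> small_label (a k l)"
      if "label x" "\<not> mid_label x" "x ^ 2 + (a k l) ^ 2 + y ^ 2 + x * a k l * y < 4" "0 \<le> y" for x y
    proof (rule ccontr)
      assume n: "\<not> ?thesis"
      have "0 \<le> x * a k l * y" "0 \<le> y ^ 2" using label_bounds[OF that(1)] b that(4) by auto
      then have l: "x ^ 2 + (a k l) ^ 2 < 4" using that(3) by linarith
      then have x: "x = 1" using n that(1,2) q1 by (auto simp: label_def)
      then have "(a k l) ^ 2 < 3" using l by simp
      then have "small_label (a k l)" using lab(5) q by (auto simp: label_def small_label_iff)
      then show False using n x by simp
    qed
    note w = this
    have W: "a i k = 0 \<or> a i k = 1 \<and> small_label (a k l)" "a j k = 0 \<or> a j k = 1 \<and> small_label (a k l)"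
      "a i l = 0 \<or> a i l = 1" "a j l = 0 \<or> a j l = 1"
      using w[of "a i k" "a i l"] w[of "a j k" "a j l"] w[of "a i l" "a i k"] w[of "a j l" "a j k"] lab False b det
      by (auto simp: mult_ac add_ac)
    then have sm: "small_label (a k l)" using con by auto
    consider "a i k = 1" "a i l = 0" "a j k = 1" "a j l = 0" | "a i k = 1" "a i l = 0" "a j k = 0" "a j l = 1"
      | "a i k = 1" "a i l = 0" "a j k = 0" "a j l = 0" | "a i k = 0" "a i l = 0" "a j k = 1" "a j l = 0"
      | "a i k = 0" "a i l = 1" "a j k = 1" "a j l = 0"
      using W E1 E2 q con by auto
    then show ?thesis
    proof cases
      case 1
      show ?thesis by (rule le_25, rule tailed_triangle_degree[OF d]) (use 1 u sm in auto)
    next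
      case 2
      show ?thesis by (rule square_degree[OF idx_swap(2)[OF d]]) (use 2 u sm s in auto)
    next
      case 3
      show ?thesis by (rule path_degree[OF idx_swap(1)[OF d]]) (use 3 u sm s in auto)
    next
      case 4
      show ?thesis by (rule path_degree[OF d]) (use 4 u sm in auto)
    next
      case 5
      show ?thesis by (rule square_degree[OF d]) (use 5 u sm in auto)
    qed
  qed
qed

text \<open>Here the heavy edge is an ordinary label with m at least 7, and \<open>l\<close> hangs
  on \<open>k\<close> alone. In the application \<open>i\<close> and \<open>k\<close> are the two
  distinguished vertices, so \<open>a i k\<close> may exceed the values allowed to the other labels'
  determinants.\<close>

lemma spike_degree:
  assumes d: "idx i j k l" and z: "a i l = 0" "a j l = 0" and b: "0 \<le> a i j" "a i j < 2" "3 < (a i j) ^ 2"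
    and lab: "label (a i k)" "label (a j k)" "label (a k l)" and det: "(a j k) ^ 2 + (a k l) ^ 2 < 4"
    and con: "a k l \<noteq> 0" "a i k \<noteq> 0 \<or> a j k \<noteq> 0"
  shows "field_degree K \<le> enat 25"
proof -
  note n = label_bounds[OF lab(1)] label_bounds[OF lab(2)] label_bounds[OF lab(3)]
  note s = idx_symm[OF d]
  have i: "idx j i k l" "idx k i j l" "idx k i l j" "idx i k j l" using d by (auto simp: idx_def)
  have b1: "1 < a i j"
  proof (rule ccontr)
    assume "\<not> 1 < a i j"
    then have "(a i j) ^ 2 \<le> 1" using b by (intro power_le_one) auto
    then show False using b by simp
  qed
  have r1: "1 \<le> (a k l) ^ 2" using n con by blast
  consider (label_u) "mid_label (a i k)" | (label_y) "mid_label (a j k)"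
    | (tree) "a i k = 0" "a j k = 1" | (cycle) "a i k \<noteq> 0" "a j k = 1"
    | (path) "a i k = 1" "a j k = 0" | (chain) "3 \<le> (a i k) ^ 2" "a j k = 0"
    using lab(1,2) det r1 con(2) by (auto simp: label_def)
  then show ?thesis
  proof cases
    case label_u
    show ?thesis by (rule le_25, rule edge_label[OF d]) (use label_u b n in auto)
  next
    case label_y
    show ?thesis by (rule le_25, rule edge_label[OF i(1)]) (use label_y b n s in auto)
  next
    case tree
    then have "(a k l) ^ 2 < 3" using det by simp
    then have "small_label (a k l)" using lab(3) con by (auto simp: label_def small_label_iff)
    then show ?thesis by (intro path_degree[OF d]) (use tree z b in auto)
  next
    case cycle
    \<comment> \<open>The triangle is viewed as a star centred at \<open>k\<close>; the heavy edge
      \<open>a i j\<close>, now opposite the centre, enters through the mixed term, which exceeds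
      1.\<close>
    have u1: "1 \<le> a i k" "1 \<le> (a i k) ^ 2" using n cycle by auto
    then have "1 * a i j \<le> a i k * a i j" using b by (intro mult_right_mono) auto
    then have w: "3 < (a i k) ^ 2 + a i k * a i j + 1" using u1 b1 by linarith
    have "(a k l) ^ 2 < 3" using det cycle by simp
    then have "a k l = 1 \<or> mid_label (a k l)" using lab(3) con by (auto simp: label_def)
    then show ?thesis
    proof
      assume "a k l = 1"
      then show ?thesis by (intro star_plain[OF i(2)]) (use cycle z b n w s in auto)
    next
      assume "mid_label (a k l)"
      then show ?thesis by (intro le_25 star_label[OF i(2)]) (use cycle z b n w s in \<open>auto simp: mid_label_def\<close>)
    qed
  next
    case path
    then consider "small_label (a k l)" | "3 \<le> (a k l) ^ 2" using lab(3) con by (auto simp: label_def small_label_iff)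
    then show ?thesis
    proof cases
      case 1
      then show ?thesis by (intro path_degree[OF i(1)]) (use path z b s in auto)
    next
      case 2
      then show ?thesis by (intro chain_large[OF i(4)]) (use path z b n s in auto)
    qed
  next
    case chain
    have "a i k \<noteq> 0" using chain(1) by auto
    then have u1: "1 \<le> a i k" by (rule n(3))
    consider "a k l = 1" | "mid_label (a k l)" | "3 \<le> (a k l) ^ 2" using lab(3) con by (auto simp: label_def)
    then show ?thesis
    proof cases
      case 1
      then show ?thesis by (intro chain_plain[OF i(3)]) (use chain z b b1 n s in auto)
    next
      case 2
      then show ?thesis by (intro le_25 edge_label[OF i(3)]) (use chain z n s in auto)
    next
      case 3
      then show ?thesis by (intro chain_large[OF i(4)]) (use chain u1 z b n s in auto)
    qed
  qed
qed

end

section \<open>The five explicit types\<close>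

lemma sym4_simps:
  "sym4 p q r s t w 0 (Suc 0) = p" "sym4 p q r s t w 0 2 = q" "sym4 p q r s t w 0 3 = r"
  "sym4 p q r s t w (Suc 0) 2 = s" "sym4 p q r s t w (Suc 0) 3 = t" "sym4 p q r s t w 2 3 = w"
  by (simp_all add: sym4_def doubleton_eq_iff)

lemma label_0: "label 0"
  by (simp add: label_def)

lemma cc_3_to_5: assumes "3 \<le> n" "n \<le> 5" shows "n = 3 \<or> mid_label (cc n)"
  using assms mid_label_cc[of n] by (auto simp: le_Suc_eq numeral_eq_Suc)

lemma cc_sq_less_3: assumes "2 \<le> n" "n \<le> 5" shows "(cc n) ^ 2 < 3"
proof -
  have "n = 2 \<or> n = 3 \<or> mid_label (cc n)" using cc_3_to_5[of n] assms by linarith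
  then show ?thesis using cc_simps(1,2) mid_label_less_3(2) by auto
qed

lemma cc_sq_less_4: assumes "2 \<le> n" shows "(cc n) ^ 2 < 4"
  using cc_bounds[OF assms] power_strict_mono[of "cc n" 2 2] by simp

context v_arithmetic begin

lemma four_idx: "N = 4 \<Longrightarrow> idx 0 (Suc 0) 2 3"
  unfolding idx_def by simp

lemma type1_degree:
  assumes "N = 4" "2 < u" "u < 14" "type1 u a" shows "field_degree K \<le> enat 23"
proof -
  note d = four_idx[OF assms(1)]
  obtain s k r p where A: "a = sym4 u (cc s) (cc r) (cc k) (cc p) 0"
    and n: "3 \<le> s" "s \<le> 5" "3 \<le> k" "k \<le> 5" "3 \<le> r" "r \<le> 5" "3 \<le> p" "p \<le> 5"
    using assms(4) unfolding type1_def by auto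
  have u: "4 < u ^ 2" using power_strict_mono[of 2 u 2] assms by simp
  have l: "label (cc s)" "label (cc k)" "label (cc r)" "label (cc p)" using n by (auto intro: label_cc)
  show ?thesis
  proof (cases "mid_label (cc s) \<or> mid_label (cc k) \<or> mid_label (cc r) \<or> mid_label (cc p)")
    case True
    show ?thesis by (rule pair_edge_label[OF d]) (use True l u assms in \<open>simp_all add: A sym4_simps\<close>)
  next
    case False
    then have "s = 3" "k = 3" "r = 3" "p = 3" using cc_3_to_5 n by blast+
    then show ?thesis by (intro double_triangle_degree[OF d]) (use assms in \<open>simp_all add: A sym4_simps cc_simps\<close>)
  qed
qed

lemma type2_degree:
  assumes "N = 4" "2 < u" "u < 14" "type2 u a" shows "field_degree K \<le> enat 23"
proof -
  note d = four_idx[OF assms(1)]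
  obtain s k p where A: "a = sym4 u (cc s) 0 (cc k) 0 (cc p)"
    and n: "3 \<le> s" "s \<le> 5" "3 \<le> k" "k \<le> 5" "3 \<le> p" "p \<le> 5"
    using assms(4) unfolding type2_def by fastforce
  have u: "4 < u ^ 2" using power_strict_mono[of 2 u 2] assms by simp
  have l: "label (cc s)" "label (cc k)" "label 0" using n by (auto intro: label_cc label_0)
  show ?thesis
  proof (cases "mid_label (cc s) \<or> mid_label (cc k)")
    case True
    show ?thesis by (rule pair_edge_label[OF d]) (use True l u assms in \<open>auto simp: A sym4_simps\<close>)
  next
    case False
    then have "s = 3" "k = 3" using cc_3_to_5 n by blast+
    moreover have "small_label (cc p)" using cc_3_to_5[OF n(5,6)] cc_simps(2) by (auto simp: small_label_iff)
    ultimately show ?thesis by (intro tailed_triangle_degree[OF d]) (use assms in \<open>simp_all add: A sym4_simps cc_simps\<close>)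
  qed
qed

lemma type3_degree:
  assumes "N = 4" "2 < u" "u < 14" "type3 u a" shows "field_degree K \<le> enat 25"
proof -
  obtain s k r where A: "a = sym4 u 0 (cc s) (cc k) 0 (cc r)"
    and n: "2 \<le> s" "s \<le> 5" "3 \<le> k" "k \<le> 5" "3 \<le> r" "r \<le> 5" "k = 3 \<and> (s = 2 \<or> s = 3) \<or> r = 3"
    using assms(4) unfolding type3_def by auto
  have u: "4 < u ^ 2" using power_strict_mono[of 2 u 2] assms by simp
  have l: "label (cc s)" "label (cc k)" "label (cc r)" "label 0" using n by (auto intro: label_cc label_0)
  have b: "(cc s) ^ 2 < 3" "(cc k) ^ 2 < 3" "(cc r) ^ 2 < 3" using n by (auto intro: cc_sq_less_3)
  have "(cc r) ^ 2 + (cc s) ^ 2 < 4" "(cc k) ^ 2 + (cc r) ^ 2 < 4" using n(7) b by (auto simp: cc_simps)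
  moreover have "k = 3 \<or> mid_label (cc k)" "r = 3 \<or> mid_label (cc r)" using n by (auto dest: cc_3_to_5)
  then have "cc k \<noteq> 0" "cc r \<noteq> 0" using cc_simps(2) mid_label_less_3(1)[of 0] by auto
  ultimately show ?thesis
    by (intro pair_degree[OF four_idx[OF assms(1)]]) (use l u assms in \<open>simp_all add: A sym4_simps\<close>)
qed

lemma type4_degree:
  assumes "N = 4" "2 < u" "u < 14" "type4 u a" shows "field_degree K \<le> enat 25"
proof -
  obtain s k r where A: "a = sym4 u (cc s) (cc r) (cc k) 0 0"
    and n: "3 \<le> s" "s \<le> 5" "3 \<le> r" "r \<le> 5" "2 \<le> k" "s = 3 \<or> r = 3"
    using assms(4) unfolding type4_def by auto
  have u: "4 < u ^ 2" using power_strict_mono[of 2 u 2] assms by simp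
  have l: "label (cc s)" "label (cc k)" "label (cc r)" "label 0" using n by (auto intro: label_cc label_0)
  have b: "(cc s) ^ 2 < 3" "(cc r) ^ 2 < 3" "(cc k) ^ 2 < 4" using n by (auto intro: cc_sq_less_3 cc_sq_less_4)
  have "(cc s) ^ 2 + (cc r) ^ 2 < 4" using n(6) b by (auto simp: cc_simps)
  moreover have "s = 3 \<or> mid_label (cc s)" "r = 3 \<or> mid_label (cc r)" using n by (auto dest: cc_3_to_5)
  then have "cc s \<noteq> 0" "cc r \<noteq> 0" using cc_simps(2) mid_label_less_3(1)[of 0] by auto
  ultimately show ?thesis
    by (intro pair_degree[OF four_idx[OF assms(1)]]) (use b l u assms in \<open>simp_all add: A sym4_simps\<close>)
qed

lemma type5_degree:
  assumes "N = 4" "2 < u" "u < 14" "type5 u a" shows "field_degree K \<le> enat 25"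
proof -
  obtain s k where A: "a = sym4 u (cc s) 0 0 (cc k) 0" and n: "3 \<le> s" "3 \<le> k"
    using assms(4) unfolding type5_def by auto
  have u: "4 < u ^ 2" using power_strict_mono[of 2 u 2] assms by simp
  have l: "label (cc s)" "label (cc k)" "label 0" using n by (auto intro: label_cc label_0)
  have b: "(cc s) ^ 2 < 4" "(cc k) ^ 2 < 4" using n by (auto intro: cc_sq_less_4)
  have nz: "cc m \<noteq> 0" if "3 \<le> m" for m
  proof -
    have "m = 3 \<or> mid_label (cc m) \<or> 3 \<le> (cc m) ^ 2" using cc_3_to_5[of m] cc_ge_6[of m] that by linarith
    then show ?thesis using cc_simps(2) mid_label_less_3(1)[of 0] by auto
  qed
  show ?thesis
    by (intro pair_degree[OF four_idx[OF assms(1)]]) (use b l u nz[OF n(1)] nz[OF n(2)] assms in \<open>simp_all add: A sym4_simps\<close>)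
qed

end

section \<open>Blocks of the form and the case of multiquadratic entries\<close>

lemma not_neg_definite:
  assumes "num_pos_eig N a = 1" shows "\<not> neg_definite N a {0..<N}"
proof
  assume neg: "neg_definite N a {0..<N}"
  have "{t. t > 0 \<and> poly (char_poly (to_mat N a)) t = 0} \<noteq> {}"
    using assms unfolding num_pos_eig_def by (intro notI) simp
  then obtain t where t: "0 < t" "poly (char_poly (to_mat N a)) t = 0" by blast
  have A: "to_mat N a \<in> carrier_mat N N" by (simp add: to_mat_def)
  obtain v where v: "v \<in> carrier_vec N" "v \<noteq> 0\<^sub>v N" "to_mat N a *\<^sub>v v = t \<cdot>\<^sub>v v"
    using t(2) unfolding eigenvalue_root_char_poly[OF A, symmetric] eigenvalue_def eigenvector_def
    by (auto simp: to_mat_def)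
  define x where "x i = v $ i" for i
  have ev: "(\<Sum>j\<in>{0..<N}. a i j * x j) = t * x i" if "i < N" for i
  proof -
    have "(to_mat N a *\<^sub>v v) $ i = t * x i" using v that by (simp add: x_def)
    then show ?thesis using v(1) that by (simp add: to_mat_def scalar_prod_def x_def)
  qed
  have "\<exists>m\<in>{0..<N}. x m \<noteq> 0"
  proof (rule ccontr)
    assume "\<not> ?thesis"
    then have "v = 0\<^sub>v N" using v(1) by (intro eq_vecI) (auto simp: x_def)
    then show False using v(2) by simp
  qed
  then have "(\<Sum>i\<in>{0..<N}. \<Sum>j\<in>{0..<N}. x i * a i j * x j) < 0"
    using neg[unfolded neg_definite_def, THEN spec, of x] by blast
  moreover have "(\<Sum>i\<in>{0..<N}. \<Sum>j\<in>{0..<N}. x i * a i j * x j) = (\<Sum>i\<in>{0..<N}. t * x i ^ 2)"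
  proof (rule sum.cong[OF refl])
    fix i assume "i \<in> {0..<N}"
    then have "x i * (\<Sum>j\<in>{0..<N}. a i j * x j) = x i * (t * x i)" using ev by simp
    then show "(\<Sum>j\<in>{0..<N}. x i * a i j * x j) = t * x i ^ 2"
      by (simp add: sum_distrib_left mult.assoc power2_eq_square mult.left_commute)
  qed
  moreover have "0 \<le> (\<Sum>i\<in>{0..<N}. t * x i ^ 2)" using t by (intro sum_nonneg) auto
  ultimately show False by linarith
qed

lemma neg_definite_split:
  assumes S: "S \<subseteq> T" "finite T" and z: "\<And>i j. i \<in> S \<Longrightarrow> j \<in> T - S \<Longrightarrow> b i j = 0 \<and> b j i = 0"
    and n: "neg_definite N b S" "neg_definite N b (T - S)"
  shows "neg_definite N b T"
  unfolding neg_definite_def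
proof (intro allI impI)
  fix x :: "nat \<Rightarrow> real" assume x: "\<exists>i\<in>T. x i \<noteq> 0"
  let ?q = "\<lambda>R. \<Sum>i\<in>R. \<Sum>j\<in>R. x i * b i j * x j"
  have fin: "finite S" "finite (T - S)" using S finite_subset by auto
  have le: "?q R \<le> 0" "(\<exists>i\<in>R. x i \<noteq> 0) \<Longrightarrow> ?q R < 0" if "neg_definite N b R" for R
  proof -
    show lt: "?q R < 0" if "\<exists>i\<in>R. x i \<noteq> 0"
      using \<open>neg_definite N b R\<close>[unfolded neg_definite_def, THEN spec, of x] that by blast
    show "?q R \<le> 0"
    proof (cases "\<exists>i\<in>R. x i \<noteq> 0")
      case True then show ?thesis using lt by simp
    next
      case False then show ?thesis by simp
    qed
  qed
  have sp: "(\<Sum>i\<in>T. f i) = (\<Sum>i\<in>T - S. f i) + (\<Sum>i\<in>S. f i)" for f :: "nat \<Rightarrow> real"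
    by (rule sum.subset_diff[OF S])
  have 1: "(\<Sum>j\<in>T. x i * b i j * x j) = (\<Sum>j\<in>S. x i * b i j * x j)" if "i \<in> S" for i
  proof -
    have "(\<Sum>j\<in>T - S. x i * b i j * x j) = 0" using z that by (intro sum.neutral) simp
    then show ?thesis by (simp add: sp[of "\<lambda>j. x i * b i j * x j"])
  qed
  have 2: "(\<Sum>j\<in>T. x i * b i j * x j) = (\<Sum>j\<in>T - S. x i * b i j * x j)" if "i \<in> T - S" for i
  proof -
    have "(\<Sum>j\<in>S. x i * b i j * x j) = 0" using z that by (intro sum.neutral) simp
    then show ?thesis by (simp add: sp[of "\<lambda>j. x i * b i j * x j"])
  qed
  have "?q T = ?q (T - S) + ?q S" unfolding sp[of "\<lambda>i. \<Sum>j\<in>T. x i * b i j * x j"] using 1 2 by simp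
  moreover have "(\<exists>i\<in>S. x i \<noteq> 0) \<or> (\<exists>i\<in>T - S. x i \<noteq> 0)" using x by blast
  ultimately show "?q T < 0" using le[OF n(1)] le[OF n(2)] by linarith
qed

context v_arithmetic begin

lemma embedding_of_nat: "real_embedding E \<phi> \<Longrightarrow> \<phi> (real n) = real n" "real n \<in> E"
proof -
  show E: "real n \<in> E" for n using real_subfield_of_int[OF E_subfield, of "int n"] by simp
  assume "real_embedding E \<phi>"
  note h = real_embeddingD[OF E_subfield this]
  show "\<phi> (real n) = real n"
  proof (induction n)
    case (Suc n)
    have "\<phi> (1 + real n) = 1 + \<phi> (real n)" using h(2) h(3)[of 1 "real n"] E[of 1] E[of n] by simp
    then show ?case using Suc by simp
  qed (simp add: h(1))
qed

lemma sqrt_embedding: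
  assumes "real_embedding E \<phi>" "sqrt (real d) \<in> E"
  shows "\<phi> (sqrt (real d)) = sqrt (real d) \<or> \<phi> (sqrt (real d)) = - sqrt (real d)"
proof -
  have "\<phi> (sqrt (real d)) ^ 2 = \<phi> (sqrt (real d) ^ 2)"
    by (rule real_embeddingD(7)[OF E_subfield assms, symmetric])
  also have "\<dots> = sqrt (real d) ^ 2" using embedding_of_nat(1)[OF assms(1)] by simp
  finally show ?thesis by (simp only: power2_eq_iff)
qed

text \<open>A unit \<open>x + y \<surd>d\<close> has conjugates of absolute value \<open>\<epsilon>\<close> or \<open>1/\<epsilon>\<close> according to the sign
  character of \<open>\<surd>d\<close>, so the norm bound makes the character sum nonnegative.\<close>

lemma character_sum_nonneg:
  assumes \<Phi>: "finite \<Phi>" "\<And>\<phi>. \<phi> \<in> \<Phi> \<Longrightarrow> real_embedding E \<phi>"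
      "\<And>x. x \<in> E \<Longrightarrow> algebraic_int x \<Longrightarrow> x \<noteq> 0 \<Longrightarrow> 1 \<le> (\<Prod>\<phi>\<in>\<Phi>. \<bar>\<phi> x\<bar>)"
    and d: "sqrt (real d) \<in> E"
    and pell: "0 < d" "0 < x" "0 < y" "\<bar>(real x) ^ 2 - real d * (real y) ^ 2\<bar> = 1"
  shows "0 \<le> (\<Sum>\<phi>\<in>\<Phi>. \<phi> (sqrt (real d)) / sqrt (real d))"
proof -
  define s :: real where "s = sqrt (real d)"
  define X Y :: real where "X = real x" and "Y = real y"
  define \<epsilon> where "\<epsilon> = X + Y * s"
  have s: "1 \<le> s" "s ^ 2 = real d" using pell(1) by (simp_all add: s_def)
  have XY: "1 \<le> X" "1 \<le> Y" using pell(2,3) by (simp_all add: X_def Y_def)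
  have "0 < Y * s" using s XY by (intro mult_pos_pos) auto
  then have \<epsilon>1: "1 < \<epsilon>" using XY by (simp add: \<epsilon>_def)
  have "\<bar>X - Y * s\<bar> * \<epsilon> = \<bar>(X - Y * s) * (X + Y * s)\<bar>" using \<epsilon>1 by (simp add: \<epsilon>_def abs_mult)
  also have "(X - Y * s) * (X + Y * s) = X ^ 2 - s ^ 2 * Y ^ 2" by (simp add: power2_eq_square algebra_simps)
  also have "\<bar>\<dots>\<bar> = 1" unfolding s(2) X_def Y_def by (rule pell(4))
  finally have conj: "\<bar>X - Y * s\<bar> = 1 / \<epsilon>" using \<epsilon>1 by (simp add: field_simps)
  have E: "X \<in> E" "Y \<in> E" "s \<in> E" using d embedding_of_nat(2) by (simp_all add: X_def Y_def s_def)
  have "algebraic_int s" unfolding s_def by (intro algebraic_int_sqrt) (simp add: int_imp_algebraic_int)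
  then have ai: "algebraic_int \<epsilon>" unfolding \<epsilon>_def X_def Y_def
    by (intro algebraic_int_add_mult) (simp_all add: int_imp_algebraic_int)
  have "1 \<le> (\<Prod>\<phi>\<in>\<Phi>. \<bar>\<phi> \<epsilon>\<bar>)" by (rule \<Phi>(3)) (use E E_intros ai \<epsilon>1 in \<open>auto simp: \<epsilon>_def\<close>)
  also have "\<dots> = (\<Prod>\<phi>\<in>\<Phi>. \<epsilon> powr (\<phi> s / s))"
  proof (rule prod.cong[OF refl])
    fix \<phi> assume "\<phi> \<in> \<Phi>"
    note em = \<Phi>(2)[OF this]
    note h = real_embeddingD[OF E_subfield em]
    have e: "\<phi> \<epsilon> = X + Y * \<phi> s" unfolding \<epsilon>_def using E E_intros h(3,4) embedding_of_nat(1)[OF em] by (simp add: X_def Y_def)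
    have "\<phi> s = s \<or> \<phi> s = - s" using sqrt_embedding[OF em d] by (simp add: s_def)
    then show "\<bar>\<phi> \<epsilon>\<bar> = \<epsilon> powr (\<phi> s / s)"
    proof
      assume 1: "\<phi> s = s"
      then have "\<phi> \<epsilon> = \<epsilon>" using e by (simp add: \<epsilon>_def)
      then show ?thesis using 1 s \<epsilon>1 by simp
    next
      assume 1: "\<phi> s = - s"
      then have "\<bar>\<phi> \<epsilon>\<bar> = 1 / \<epsilon>" using e conj by simp
      then show ?thesis using 1 s \<epsilon>1 by (simp add: powr_minus_divide)
    qed
  qed
  also have "\<dots> = \<epsilon> powr (\<Sum>\<phi>\<in>\<Phi>. \<phi> s / s)" using \<epsilon>1 \<Phi>(1) by (simp add: powr_sum)
  finally have "\<epsilon> powr 0 \<le> \<epsilon> powr (\<Sum>\<phi>\<in>\<Phi>. \<phi> s / s)" using \<epsilon>1 by simp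
  then show ?thesis using \<epsilon>1 unfolding s_def[symmetric] by (simp only: powr_le_cancel_iff)
qed

text \<open>The product of the three factors 1 + \<chi> is 8 on embeddings with all signs positive
  and 0 on the others. Expanding its sum gives |\<Phi>| plus seven nonnegative character sums, so at
  least one eighth of the embeddings have all signs positive, and these are trivial on
  \<open>K\<close>.\<close>

lemma degree_le_8:
  assumes fixed: "\<And>\<phi>. real_embedding E \<phi> \<Longrightarrow> (sqrt 2 \<in> E \<Longrightarrow> \<phi> (sqrt 2) = sqrt 2) \<Longrightarrow>
      (sqrt 3 \<in> E \<Longrightarrow> \<phi> (sqrt 3) = sqrt 3) \<Longrightarrow> (sqrt 5 \<in> E \<Longrightarrow> \<phi> (sqrt 5) = sqrt 5) \<Longrightarrow> \<forall>x\<in>K. \<phi> x = x"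
  shows "field_degree K \<le> enat 8"
  unfolding field_degree_def
proof (rule Sup_least, safe)
  fix B assume B: "finite B" "B \<subseteq> K" "Q_indep B"
  obtain \<Phi> where \<Phi>: "finite \<Phi>" "\<exists>\<phi>\<in>\<Phi>. \<forall>x\<in>K. \<phi> x = x" "\<And>\<phi>. \<phi> \<in> \<Phi> \<Longrightarrow> real_embedding E \<phi>"
    "\<And>x. x \<in> E \<Longrightarrow> algebraic_int x \<Longrightarrow> x \<noteq> 0 \<Longrightarrow> 1 \<le> (\<Prod>\<phi>\<in>\<Phi>. \<bar>\<phi> x\<bar>)"
    "\<And>B. finite B \<Longrightarrow> B \<subseteq> K \<Longrightarrow> Q_indep B \<Longrightarrow> card B * card {\<phi>\<in>\<Phi>. \<forall>x\<in>K. \<phi> x = x} \<le> card \<Phi>"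
    by (rule embeddings) (rule that)
  define T where "T = {\<phi>\<in>\<Phi>. \<forall>x\<in>K. \<phi> x = x}"
  have T: "finite T" "card T > 0" using \<Phi>(1,2) by (auto simp: T_def card_gt_0_iff)
  note cs = character_sum_nonneg[OF \<Phi>(1,3,4)]
  \<comment> \<open>A root outside \<open>E\<close> gets the constant sign 1, so its factor is 2 on
    every embedding and constrains none of them.\<close>
  define \<chi> where "\<chi> d \<phi> = (if sqrt d \<in> E then \<phi> (sqrt d) / sqrt d else 1)" for d and \<phi> :: "real \<Rightarrow> real"
  have sign: "\<chi> (real d) \<phi> = 1 \<or> \<chi> (real d) \<phi> = - 1" if "\<phi> \<in> \<Phi>" "0 < d" for \<phi> d
  proof (cases "sqrt (real d) \<in> E")
    case True
    have "sqrt (real d) \<noteq> 0" using that(2) by simp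
    then show ?thesis using sqrt_embedding[OF \<Phi>(3)[OF that(1)] True] True by (elim disjE) (simp_all add: \<chi>_def)
  qed (simp add: \<chi>_def)
  have sg: "\<chi> 2 \<phi> = 1 \<or> \<chi> 2 \<phi> = - 1" "\<chi> 3 \<phi> = 1 \<or> \<chi> 3 \<phi> = - 1" "\<chi> 5 \<phi> = 1 \<or> \<chi> 5 \<phi> = - 1" if "\<phi> \<in> \<Phi>" for \<phi>
    using sign[OF that, of 2] sign[OF that, of 3] sign[OF that, of 5] by simp_all
  have nonneg: "0 \<le> (\<Sum>\<phi>\<in>\<Phi>. \<chi> d \<phi>)" if "sqrt d \<in> E \<Longrightarrow> 0 \<le> (\<Sum>\<phi>\<in>\<Phi>. \<phi> (sqrt d) / sqrt d)" for d
    using that by (cases "sqrt d \<in> E") (simp_all add: \<chi>_def)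
  have one: "0 \<le> (\<Sum>\<phi>\<in>\<Phi>. \<chi> 2 \<phi>)" "0 \<le> (\<Sum>\<phi>\<in>\<Phi>. \<chi> 3 \<phi>)" "0 \<le> (\<Sum>\<phi>\<in>\<Phi>. \<chi> 5 \<phi>)"
    \<comment> \<open>Each instance names a solution of x^2 - d y^2 = \<plusminus>1, here 9 - 8, 4 -
      3 and 4 - 5; the same is done below for 6, 10, 15 and 30.\<close>
    using cs[of 2 3 2] cs[of 3 2 1] cs[of 5 2 1] by (auto intro: nonneg)
  have prod2: "(\<forall>\<phi>\<in>\<Phi>. \<chi> p \<phi> * \<chi> q \<phi> = \<phi> (sqrt (p * q)) / sqrt (p * q)) \<and> sqrt (p * q) \<in> E"
    if "sqrt p \<in> E" "sqrt q \<in> E" for p q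
  proof (intro conjI ballI)
    show "sqrt (p * q) \<in> E" using E_intros that by (simp add: real_sqrt_mult)
    fix \<phi> assume "\<phi> \<in> \<Phi>"
    note h = real_embeddingD[OF E_subfield \<Phi>(3)[OF this]]
    show "\<chi> p \<phi> * \<chi> q \<phi> = \<phi> (sqrt (p * q)) / sqrt (p * q)"
      using that h(4)[OF that] by (simp add: \<chi>_def real_sqrt_mult)
  qed
  have two: "0 \<le> (\<Sum>\<phi>\<in>\<Phi>. \<chi> p \<phi> * \<chi> q \<phi>)"
    if "0 \<le> (\<Sum>\<phi>\<in>\<Phi>. \<chi> p \<phi>)" "0 \<le> (\<Sum>\<phi>\<in>\<Phi>. \<chi> q \<phi>)"
      "sqrt (p * q) \<in> E \<Longrightarrow> 0 \<le> (\<Sum>\<phi>\<in>\<Phi>. \<phi> (sqrt (p * q)) / sqrt (p * q))" for p q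
  proof (cases "sqrt p \<in> E \<and> sqrt q \<in> E")
    case True
    then show ?thesis using prod2[of p q] that(3) by simp
  next
    case False
    then have "(\<forall>\<phi>. \<chi> p \<phi> = 1) \<or> (\<forall>\<phi>. \<chi> q \<phi> = 1)" by (auto simp: \<chi>_def)
    then show ?thesis using that by auto
  qed
  have t23: "0 \<le> (\<Sum>\<phi>\<in>\<Phi>. \<chi> 2 \<phi> * \<chi> 3 \<phi>)"
    by (rule two[OF one(1,2)]) (use cs[of 6 5 2] in simp)
  have t25: "0 \<le> (\<Sum>\<phi>\<in>\<Phi>. \<chi> 2 \<phi> * \<chi> 5 \<phi>)"
    by (rule two[OF one(1,3)]) (use cs[of 10 3 1] in simp)
  have t35: "0 \<le> (\<Sum>\<phi>\<in>\<Phi>. \<chi> 3 \<phi> * \<chi> 5 \<phi>)"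
    by (rule two[OF one(2,3)]) (use cs[of 15 4 1] in simp)
  have t235: "0 \<le> (\<Sum>\<phi>\<in>\<Phi>. \<chi> 2 \<phi> * \<chi> 3 \<phi> * \<chi> 5 \<phi>)"
  proof (cases "sqrt 2 \<in> E \<and> sqrt 3 \<in> E")
    case True
    then have p6: "sqrt 6 \<in> E" "\<And>\<phi>. \<phi> \<in> \<Phi> \<Longrightarrow> \<chi> 2 \<phi> * \<chi> 3 \<phi> = \<chi> 6 \<phi>"
      using prod2[of 2 3] by (auto simp: \<chi>_def)
    have "0 \<le> (\<Sum>\<phi>\<in>\<Phi>. \<chi> 6 \<phi> * \<chi> 5 \<phi>)"
      by (rule two) (use one t23 p6(2) cs[of 30 11 2] in simp_all)
    then show ?thesis using p6(2) by simp
  next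
    case False
    then have "(\<forall>\<phi>. \<chi> 2 \<phi> = 1) \<or> (\<forall>\<phi>. \<chi> 3 \<phi> = 1)" by (auto simp: \<chi>_def)
    then show ?thesis using t25 t35 by auto
  qed
  have "real (card \<Phi>) \<le> (\<Sum>\<phi>\<in>\<Phi>. (1 + \<chi> 2 \<phi>) * (1 + \<chi> 3 \<phi>) * (1 + \<chi> 5 \<phi>))"
  proof -
    have "(\<Sum>\<phi>\<in>\<Phi>. (1 + \<chi> 2 \<phi>) * (1 + \<chi> 3 \<phi>) * (1 + \<chi> 5 \<phi>)) = (\<Sum>\<phi>\<in>\<Phi>. 1 + \<chi> 2 \<phi> + \<chi> 3 \<phi> + \<chi> 5 \<phi>
        + \<chi> 2 \<phi> * \<chi> 3 \<phi> + \<chi> 2 \<phi> * \<chi> 5 \<phi> + \<chi> 3 \<phi> * \<chi> 5 \<phi> + \<chi> 2 \<phi> * \<chi> 3 \<phi> * \<chi> 5 \<phi>)"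
      by (intro sum.cong refl) (simp add: algebra_simps)
    then show ?thesis using one t23 t25 t35 t235 by (simp add: sum.distrib)
  qed
  also have "\<dots> \<le> (\<Sum>\<phi>\<in>\<Phi>. if \<phi> \<in> T then 8 else 0)"
  proof (rule sum_mono)
    fix \<phi> assume m: "\<phi> \<in> \<Phi>"
    show "(1 + \<chi> 2 \<phi>) * (1 + \<chi> 3 \<phi>) * (1 + \<chi> 5 \<phi>) \<le> (if \<phi> \<in> T then 8 else 0)"
    proof (cases "\<chi> 2 \<phi> = 1 \<and> \<chi> 3 \<phi> = 1 \<and> \<chi> 5 \<phi> = 1")
      case True
      have "\<forall>x\<in>K. \<phi> x = x" by (rule fixed[OF \<Phi>(3)[OF m]]) (use True in \<open>simp_all add: \<chi>_def\<close>)
      then have "\<phi> \<in> T" using m by (simp add: T_def)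
      then show ?thesis using True by simp
    next
      case False
      then show ?thesis using sg[OF m] by auto
    qed
  qed
  also have "\<dots> = 8 * real (card T)"
  proof -
    have "\<Phi> \<inter> {\<phi>. \<phi> \<in> T} = T" by (auto simp: T_def)
    then show ?thesis using \<Phi>(1) by (simp add: sum.If_cases)
  qed
  finally have "card \<Phi> \<le> 8 * card T" by linarith
  then have "card B * card T \<le> 8 * card T" using \<Phi>(5)[OF B] unfolding T_def by (rule order_trans[rotated])
  then show "enat (card B) \<le> enat 8" using T(2) by simp
qed

end

section \<open>Edge matrices\<close>

lemma neg_definite_cong:
  assumes "neg_definite N b S" "\<And>i j. i \<in> S \<Longrightarrow> j \<in> S \<Longrightarrow> b i j = c i j"
  shows "neg_definite N c S"
proof -
  have "(\<Sum>i\<in>S. \<Sum>j\<in>S. x i * b i j * x j) = (\<Sum>i\<in>S. \<Sum>j\<in>S. x i * c i j * x j)" for x :: "nat \<Rightarrow> real"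
    by (intro sum.cong refl) (simp add: assms(2))
  then show ?thesis using assms(1) by (simp add: neg_definite_def)
qed

lemma rtrancl_leaving:
  assumes "(x, z) \<in> R\<^sup>*" "x \<in> T" "z \<notin> T"
  shows "\<exists>y w. y \<in> T \<and> w \<notin> T \<and> (y, w) \<in> R \<and> (x, w) \<in> R\<^sup>*"
  using assms
proof (induction rule: rtrancl_induct)
  case base
  then show ?case by simp
next
  case (step y z)
  show ?case
  proof (cases "y \<in> T")
    case True
    moreover have "(x, z) \<in> R\<^sup>*" using step.hyps by (rule rtrancl_into_rtrancl)
    ultimately show ?thesis using step by blast
  next
    case False
    then show ?thesis using step by blast
  qed
qed

locale edge_chamber = v_arithmetic +
  fixes e1 e2 :: nat
  assumes edge: "edge_matrix N a e1 e2" and min14: "minimality N a 14"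
    and card4: "4 \<le> card (hyperbolic_component N a e1 e2)"
begin

abbreviation "G \<equiv> graph_edges N a"
abbreviation "C \<equiv> hyperbolic_component N a e1 e2"

lemma e: "e1 < N" "e2 < N" "e1 \<noteq> e2"
  using edge by (simp_all add: edge_matrix_def)

lemma neg_sub:
  assumes "S \<subseteq> {0..<N}" "e1 \<notin> S \<or> e2 \<notin> S" shows "neg_definite N a S"
proof -
  have "neg_definite N a ({0..<N} - {e1})" "neg_definite N a ({0..<N} - {e2})"
    using edge by (simp_all add: edge_matrix_def)
  moreover have "S \<subseteq> {0..<N} - {e1} \<or> S \<subseteq> {0..<N} - {e2}" using assms by blast
  ultimately show ?thesis using neg_definite_subset finite_Diff[OF finite_atLeastLessThan] by blast
qed

lemma not_neg: "\<not> neg_definite N a {0..<N}"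
  using edge by (intro not_neg_definite) (simp add: edge_matrix_def)

lemma G_iff: "(i, j) \<in> G \<longleftrightarrow> i < N \<and> j < N \<and> i \<noteq> j \<and> a i j \<noteq> 0"
  by (simp add: graph_edges_def)

lemma sym_G: "sym (G\<^sup>*)"
proof (rule sym_rtrancl, rule symI)
  fix i j assume "(i, j) \<in> G"
  then show "(j, i) \<in> G" using symm[of i j] by (simp add: G_iff)
qed

text \<open>Otherwise the component of \<open>e1\<close> and its complement each miss one
  distinguished vertex and are negative definite, so the whole matrix would be, against its positive
  eigenvalue.\<close>

lemma connected: "(e1, e2) \<in> G\<^sup>*"
proof (rule ccontr)
  assume n: "(e1, e2) \<notin> G\<^sup>*"
  define S where "S = {j. j < N \<and> (e1, j) \<in> G\<^sup>*}"
  have S: "S \<subseteq> {0..<N}" "e1 \<in> S" "e2 \<notin> S" using e n by (auto simp: S_def)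
  have "neg_definite N a {0..<N}"
  proof (rule neg_definite_split[OF S(1)])
    fix i j assume ij: "i \<in> S" "j \<in> {0..<N} - S"
    then have "(i, j) \<notin> G" unfolding S_def by (auto intro: rtrancl_into_rtrancl)
    then have "a i j = 0" using ij S(1) by (auto simp: G_iff)
    then show "a i j = 0 \<and> a j i = 0" using symm[of j i] ij S(1) by auto
  qed (use S neg_sub[of S] neg_sub[of "{0..<N} - S"] in auto)
  then show False using not_neg by simp
qed

lemma C_eq: "C = {j. j < N \<and> (e1, j) \<in> G\<^sup>*}"
  using connected rtrancl_trans[of e1 e2 G] unfolding hyperbolic_component_def by blast

lemma C_reach: assumes "x \<in> C" "y \<in> C" shows "(x, y) \<in> G\<^sup>*"
proof -
  have "(e1, x) \<in> G\<^sup>*" "(e1, y) \<in> G\<^sup>*" using assms by (simp_all add: C_eq)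
  then show ?thesis using symD[OF sym_G] rtrancl_trans by fast
qed

lemma C_closed: assumes "x \<in> C" "y < N" "x \<noteq> y" "a x y \<noteq> 0" shows "y \<in> C"
  using assms unfolding C_eq by (auto intro: rtrancl_into_rtrancl simp: G_iff)

lemma C_props: "e1 \<in> C" "e2 \<in> C" "C \<subseteq> {0..<N}"
  using e connected by (auto simp: C_eq)

lemma grow:
  assumes "T \<subseteq> C" "x \<in> T" "card T < 4" shows "\<exists>y\<in>T. \<exists>w\<in>C - T. a y w \<noteq> 0"
proof -
  have fin: "finite T" by (rule finite_subset[OF order_trans[OF assms(1) C_props(3)]]) simp
  have "\<not> C \<subseteq> T" using card_mono[OF fin, of C] card4 assms(3) by linarith
  then obtain z where z: "z \<in> C" "z \<notin> T" by blast
  have xC: "x \<in> C" using assms by blast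
  obtain y w where yw: "y \<in> T" "w \<notin> T" "(y, w) \<in> G" "(x, w) \<in> G\<^sup>*"
    using rtrancl_leaving[OF C_reach[OF xC z(1)] assms(2) z(2)] by blast
  then have "y \<noteq> w" "a y w \<noteq> 0" "w < N" by (auto simp: G_iff)
  moreover have "w \<in> C" using C_closed[of y w] calculation assms(1) yw(1) by blast
  ultimately show ?thesis using yw(1,2) by blast
qed

text \<open>Only the entry between the two distinguished vertices can reach 2: every other pair lies
  in a negative definite block.\<close>

lemma less_2:
  assumes "i < N" "j < N" "i \<noteq> j" "e1 \<notin> {i, j} \<or> e2 \<notin> {i, j}" shows "a i j < 2"
proof -
  have sub: "{i, j} \<subseteq> {0..<N}" using assms by auto
  have "(a i j) ^ 2 < 2 ^ 2" using neg2[OF neg_sub[OF sub assms(4)] gram_like[OF sub] assms(3)] by simp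
  then show ?thesis by (rule power2_less_imp_less) simp
qed

lemma lab:
  assumes "i < N" "j < N" "i \<noteq> j" "e1 \<notin> {i, j} \<or> e2 \<notin> {i, j}" shows "label (a i j)"
  using entry_label[OF assms(1-3)] less_2[OF assms] by simp

lemma det3:
  assumes d: "distinct [i, j, k]" "i < N" "j < N" "k < N" and x: "e1 \<notin> {i, j, k} \<or> e2 \<notin> {i, j, k}"
  shows "(a i j)^2 + (a j k)^2 + (a i k)^2 + a i j * a j k * a i k < 4"
proof -
  have sub: "{i, j, k} \<subseteq> {0..<N}" using d by auto
  show ?thesis by (rule neg3_det[OF neg_sub[OF sub x] gram_like[OF sub] d(1)])
qed

text \<open>The heavy edge uses up more than 3 of the determinant bound 4, while any nonzero label
  at either end would add at least 1.\<close>

lemma big_isolated: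
  assumes d: "distinct [i, j, k]" "i < N" "j < N" "k < N" and x: "e1 \<notin> {i, j, k} \<or> e2 \<notin> {i, j, k}"
    and big: "3 < (a i j) ^ 2"
  shows "a i k = 0" "a j k = 0"
proof -
  have l: "label (a i k)" "label (a j k)" using d x by (auto intro!: lab)
  have "0 \<le> a i j * a j k * a i k" using entry_nonneg[of i j] label_bounds(1)[OF l(1)] label_bounds(1)[OF l(2)] d by simp
  then have "(a j k) ^ 2 + (a i k) ^ 2 < 1" using det3[OF d x] big by linarith
  then have "(a i k) ^ 2 < 1" "(a j k) ^ 2 < 1" using zero_le_power2[of "a i k"] zero_le_power2[of "a j k"] by linarith+
  then show "a i k = 0" "a j k = 0" using label_bounds(4)[OF l(1)] label_bounds(4)[OF l(2)] by linarith+
qed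

lemma big_pair_degree:
  assumes u: "3 < (a e1 e2) ^ 2" shows "field_degree K \<le> enat 25"
proof -
  have "\<exists>y\<in>{e1, e2}. \<exists>w\<in>C - {e1, e2}. a y w \<noteq> 0" using C_props e by (intro grow[of _ e1]) auto
  then obtain k where k: "k \<in> C" "k \<noteq> e1" "k \<noteq> e2" "a e1 k \<noteq> 0 \<or> a e2 k \<noteq> 0" by blast
  have "\<exists>y\<in>{e1, e2, k}. \<exists>w\<in>C - {e1, e2, k}. a y w \<noteq> 0" using C_props k e by (intro grow[of _ e1]) auto
  then obtain l where l: "l \<in> C" "l \<noteq> e1" "l \<noteq> e2" "l \<noteq> k" "a e1 l \<noteq> 0 \<or> a e2 l \<noteq> 0 \<or> a k l \<noteq> 0" by blast
  have n: "k < N" "l < N" using k(1) l(1) C_props(3) by auto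
  have "1 ^ 2 < (a e1 e2) ^ 2" using u by simp
  then have "1 < a e1 e2" using entry_nonneg[OF e] by (rule power2_less_imp_less)
  moreover have "a e1 e2 < 14" using min14 e by (simp add: minimality_def)
  moreover have "idx e1 e2 k l" using e n k l by (auto simp: idx_def)
  moreover have "label (a e1 k)" "label (a e2 k)" "label (a e1 l)" "label (a e2 l)" "label (a k l)"
    using e n k l by (auto intro!: lab)
  moreover have "(a e1 k)^2 + (a k l)^2 + (a e1 l)^2 + a e1 k * a k l * a e1 l < 4"
    "(a e2 k)^2 + (a k l)^2 + (a e2 l)^2 + a e2 k * a k l * a e2 l < 4"
    using e n k l by (auto intro!: det3)
  ultimately show ?thesis using pair_degree[of e1 e2 k l] u k(4) l(5) by blast
qed

text \<open>By \<open>big_isolated\<close>, \<open>e2\<close> is the only further vertex that may be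
  joined to \<open>e1\<close> or \<open>j\<close>. Connectedness therefore attaches
  \<open>e2\<close> next, and a fourth vertex to \<open>e2\<close> alone.\<close>

lemma big_spike_degree:
  assumes j: "j < N" "j \<noteq> e1" "j \<noteq> e2" and big: "3 < (a e1 j) ^ 2" and u: "a e1 e2 < 2"
  shows "field_degree K \<le> enat 25"
proof -
  have z: "a e1 k = 0" "a j k = 0" if "k < N" "k \<noteq> e1" "k \<noteq> j" "k \<noteq> e2" for k
    using big_isolated[OF _ e(1) j(1) that(1) _ big] that j e by auto
  have "a e1 j \<noteq> 0" using big by auto
  then have jC: "j \<in> C" using C_closed[OF C_props(1) j(1)] j(2) by simp
  have "\<exists>y\<in>{e1, j}. \<exists>w\<in>C - {e1, j}. a y w \<noteq> 0" using C_props jC j by (intro grow[of _ e1]) auto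
  then obtain w where "w \<in> C" "w \<noteq> e1" "w \<noteq> j" "a e1 w \<noteq> 0 \<or> a j w \<noteq> 0" by blast
  moreover have "w < N" using calculation C_props(3) by auto
  ultimately have con: "a e1 e2 \<noteq> 0 \<or> a j e2 \<noteq> 0" using z[of w] by metis
  have "\<exists>y\<in>{e1, j, e2}. \<exists>w\<in>C - {e1, j, e2}. a y w \<noteq> 0" using C_props jC j e by (intro grow[of _ e1]) auto
  then obtain l where l: "l \<in> C" "l \<noteq> e1" "l \<noteq> j" "l \<noteq> e2" "a e1 l \<noteq> 0 \<or> a j l \<noteq> 0 \<or> a e2 l \<noteq> 0" by blast
  have lN: "l < N" using l(1) C_props(3) by auto
  have r: "a e2 l \<noteq> 0" using l z[OF lN] by simp
  have "(a j e2) ^ 2 + (a e2 l) ^ 2 + (a j l) ^ 2 + a j e2 * a e2 l * a j l < 4"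
    using e lN j l by (intro det3) auto
  then have det: "(a j e2) ^ 2 + (a e2 l) ^ 2 < 4" using z[OF lN] l by simp
  show ?thesis
  proof (rule spike_degree[of e1 j e2 l])
    show "idx e1 j e2 l" using e lN j l by (auto simp: idx_def)
    show "label (a e1 e2)" using entry_label[OF e] u by simp
    show "label (a j e2)" "label (a e2 l)" using e lN j l by (auto intro!: lab)
    show "0 \<le> a e1 j" "a e1 j < 2" using e j by (auto intro!: entry_nonneg less_2)
  qed (use z[OF lN] l r det con big in auto)
qed

text \<open>An embedding fixing the three square roots fixes all entries of the hyperbolic
  component. Were it nontrivial on \<open>K\<close>, the component itself would be negative
  definite; its complement always is, so the whole matrix would be.\<close>

lemma no_big_degree:
  assumes small: "\<And>i j. i \<in> C \<Longrightarrow> j \<in> C \<Longrightarrow> i \<noteq> j \<Longrightarrow> (a i j) ^ 2 \<le> 3"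
  shows "field_degree K \<le> enat 8"
proof (rule degree_le_8)
  fix \<phi> assume \<phi>: "real_embedding E \<phi>" and s2: "sqrt 2 \<in> E \<Longrightarrow> \<phi> (sqrt 2) = sqrt 2"
    and s3: "sqrt 3 \<in> E \<Longrightarrow> \<phi> (sqrt 3) = sqrt 3" and s5: "sqrt 5 \<in> E \<Longrightarrow> \<phi> (sqrt 5) = sqrt 5"
  note h = real_embeddingD[OF E_subfield \<phi>]
  show "\<forall>x\<in>K. \<phi> x = x"
  proof (rule ccontr)
    assume "\<not> ?thesis"
    then have \<psi>: "nontriv \<phi>" using \<phi> by (auto simp: nontriv_def)
    have fixed: "\<phi> (a i j) = a i j" if ij: "i \<in> C" "j \<in> C" for i j
    proof (cases "i = j")
      case True
      have "i < N" using ij C_props(3) by auto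
      moreover have "\<phi> (- 2) = - 2" using h(5)[of 2] embedding_of_nat[where n = 2] \<phi> by simp
      ultimately show ?thesis using True diag by simp
    next
      case False
      have n: "i < N" "j < N" using ij C_props(3) by auto
      define r where "r = a i j"
      have rE: "r \<in> E" using entry_E[OF n] by (simp add: r_def)
      have r3: "r ^ 2 \<le> 3" using small[OF ij False] by (simp add: r_def)
      then have "r ^ 2 < 2 ^ 2" by simp
      then have "r < 2" by (rule power2_less_imp_less) simp
      then have "label r" using entry_label[OF n False] by (simp add: r_def)
      then consider "r = 0" | "r = 1" | "0 \<le> r" "r ^ 2 = 2" | "0 \<le> r" "r ^ 2 = r + 1" | "0 \<le> r" "r ^ 2 = 3"
        using r3 by (auto simp: label_def mid_label_def)
      then have "\<phi> r = r"
      proof cases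
        case 3
        then have "sqrt 2 = r" by (intro real_sqrt_unique)
        then show ?thesis using s2 rE by simp
      next
        case 4
        then have "r \<noteq> 0" by auto
        have "1 \<le> r"
        proof (rule ccontr)
          assume "\<not> 1 \<le> r"
          then have "r ^ 2 \<le> 1" using 4 by (intro power_le_one) auto
          then have "r = 0" using 4 by simp
          then show False using \<open>r \<noteq> 0\<close> by simp
        qed
        moreover have "(2 * r - 1) ^ 2 = 5" using 4(2) by (simp add: power2_eq_square algebra_simps)
        ultimately have sq: "sqrt 5 = 2 * r - 1" by (intro real_sqrt_unique) auto
        have "\<phi> (2 * r - 1) = 2 * \<phi> r - 1" using rE by (simp add: phi_simps[OF \<psi>] E_intros)
        then show ?thesis using s5 rE unfolding sq by (simp add: E_intros)
      next
        case 5
        then have "sqrt 3 = r" by (intro real_sqrt_unique)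
        then show ?thesis using s3 rE by simp
      qed (simp_all add: h)
      then show ?thesis by (simp add: r_def)
    qed
    have "neg_definite N a C" by (rule neg_definite_cong[OF nontriv_neg_sub[OF \<psi> C_props(3)] fixed])
    moreover have "neg_definite N a ({0..<N} - C)" using C_props by (intro neg_sub) auto
    moreover have "a i j = 0 \<and> a j i = 0" if "i \<in> C" "j \<in> {0..<N} - C" for i j
    proof -
      have "i < N" "j < N" "i \<noteq> j" using that C_props(3) by auto
      then have "a i j = 0" using C_closed[of i j] that by blast
      then show ?thesis using symm[of j i] \<open>i < N\<close> \<open>j < N\<close> by simp
    qed
    ultimately have "neg_definite N a {0..<N}" by (intro neg_definite_split[OF C_props(3)]) auto
    then show False using not_neg by simp
  qed
qed

lemma swap: "edge_chamber N a e2 e1"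
proof
  show "edge_matrix N a e2 e1" using edge by (auto simp: edge_matrix_def)
  show "4 \<le> card (hyperbolic_component N a e2 e1)" using card4 by (simp add: hyperbolic_component_def Un_commute)
qed (rule min14)

lemma edge_degree: "field_degree K \<le> enat 25"
proof (cases "3 < (a e1 e2) ^ 2")
  case True
  then show ?thesis by (rule big_pair_degree)
next
  case False
  then have "(a e1 e2) ^ 2 < 2 ^ 2" by simp
  then have u: "a e1 e2 < 2" by (rule power2_less_imp_less) simp
  interpret sw: edge_chamber N a e2 e1 by (rule swap)
  show ?thesis
  proof (cases "\<exists>i\<in>C. \<exists>j\<in>C. i \<noteq> j \<and> 3 < (a i j) ^ 2")
    case big: True
    then obtain i j where ij: "i \<in> C" "j \<in> C" "i \<noteq> j" "3 < (a i j) ^ 2" by blast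
    have n: "i < N" "j < N" using ij C_props(3) by auto
    have sy: "a e2 e1 = a e1 e2" "a j i = a i j" using symm e n by auto
    consider "{i, j} = {e1, e2}" | "i = e1" "j \<noteq> e2" | "j = e1" "i \<noteq> e2" | "i = e2" "j \<noteq> e1" | "j = e2" "i \<noteq> e1"
      | "e1 \<notin> {i, j}" "e2 \<notin> {i, j}" by auto
    then show ?thesis
    proof cases
      case 1
      then have "(a e1 e2) ^ 2 = (a i j) ^ 2" using sy by (auto simp: doubleton_eq_iff)
      then show ?thesis using False ij(4) by simp
    next
      case 2
      then show ?thesis using big_spike_degree[of j] n ij u by auto
    next
      case 3
      then show ?thesis using big_spike_degree[of i] n ij u sy by auto
    next
      case 4
      then show ?thesis using sw.big_spike_degree[of j] n ij u sy by auto
    next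
      case 5
      then show ?thesis using sw.big_spike_degree[of i] n ij u sy by auto
    next
      case 6
      \<comment> \<open>A heavy edge away from both distinguished vertices would be a component by
        itself, since a third vertex completes a triple missing \<open>e1\<close> or
        \<open>e2\<close>.\<close>
      have "card {i, j} < 4" using ij(3) by simp
      then obtain y w where w: "y \<in> {i, j}" "w \<in> C" "w \<notin> {i, j}" "a y w \<noteq> 0"
        using grow[of "{i, j}" i] ij by blast
      have "w < N" using w(2) C_props(3) by auto
      then have "a i w = 0" "a j w = 0" using big_isolated[OF _ n, of w] w ij 6 e(3) by auto
      then show ?thesis using w(1,4) by auto
    qed
  next
    case False
    then have "field_degree K \<le> enat 8" by (intro no_big_degree) force
    then show ?thesis by (rule order_trans) simp
  qed
qed

end

theorem theorem3p3:
  shows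
   "(\<forall>(u::real) A. totally_real_algebraic_integer u \<and> 2 < u \<and> u < 14 \<and> V_arithmetic 4 A \<longrightarrow>
       ((type1 u A \<or> type2 u A) \<longrightarrow> field_degree (ground_field 4 A) \<le> 23) \<and>
       ((type3 u A \<or> type4 u A \<or> type5 u A) \<longrightarrow> field_degree (ground_field 4 A) \<le> 25)) \<and>
    (\<forall>N a e1 e2. edge_matrix N a e1 e2 \<and> V_arithmetic N a \<and> minimality N a 14 \<and>
       card (hyperbolic_component N a e1 e2) \<ge> 4 \<longrightarrow>
       field_degree (ground_field N a) \<le> 25)"
proof -
  have lit: "enat 23 = 23" "enat 25 = 25" by (simp_all add: numeral_eq_enat)
  have "field_degree (ground_field 4 A) \<le> 23" if "2 < u" "u < 14" "V_arithmetic 4 A" "type1 u A \<or> type2 u A" for u A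
  proof -
    interpret v_arithmetic 4 A by unfold_locales (rule that(3))
    show ?thesis using type1_degree[OF refl that(1,2)] type2_degree[OF refl that(1,2)] that(4)
      unfolding K_def lit by blast
  qed
  moreover have "field_degree (ground_field 4 A) \<le> 25"
    if "2 < u" "u < 14" "V_arithmetic 4 A" "type3 u A \<or> type4 u A \<or> type5 u A" for u A
  proof -
    interpret v_arithmetic 4 A by unfold_locales (rule that(3))
    show ?thesis using type3_degree[OF refl that(1,2)] type4_degree[OF refl that(1,2)] type5_degree[OF refl that(1,2)] that(4)
      unfolding K_def lit by blast
  qed
  moreover have "field_degree (ground_field N a) \<le> 25"
    if "edge_matrix N a e1 e2" "V_arithmetic N a" "minimality N a 14" "4 \<le> card (hyperbolic_component N a e1 e2)" for N a e1 e2
  proof -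
    interpret edge_chamber N a e1 e2 by unfold_locales (use that in auto)
    show ?thesis using edge_degree unfolding K_def lit .
  qed
  ultimately show ?thesis by blast
qed

end
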